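(* Let $R$ be a local ring with residue field $k$. Suppose that there exists a surjective $R$-module homomorphism from a direct sum of syzygies of $k$ (that is, a possibly infinite direct sum of modules each of the form $\Omega_R^n k$ with $n\geq 0$) to a faithfully flat $R$-module. Then $R$ is regular.
   Context: All rings are commutative and noetherian. Modules are not assumed to be finitely generated. $\Omega_R^n k$ denotes the $n$-th syzygy of $k$ in its minimal $R$-free resolution ($\Omega_R^0k=k$). *)

theory Defs
  imports "HOL-Algebra.Algebra" "HOL-Library.Extended_Nat"
begin

section \<open>Noetherian local rings and regularity\<close>

locale noetherian_local_ring = cring R + noetherian_ring R for R (structure) +
  fixes \<mm> :: "'a set"
  assumes maximal: "maximalideal \<mm> R"
    and unique_maximal: "maximalideal J R \<Longrightarrow> J = \<mm>"

definition krull_dim :: "('a, 'r) ring_scheme \<Rightarrow> enat" where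
  "krull_dim R = Sup {enat n |n. \<exists>p :: nat \<Rightarrow> 'a set.
     (\<forall>i\<le>n. primeideal (p i) R) \<and> (\<forall>i<n. p i \<subset> p (Suc i))}"

definition regular_local_ring :: "('a, 'r) ring_scheme \<Rightarrow> 'a set \<Rightarrow> bool" where
  "regular_local_ring R \<mm> \<longleftrightarrow> noetherian_local_ring R \<mm> \<and>
     (\<exists>A \<subseteq> carrier R. finite A \<and> genideal R A = \<mm> \<and> enat (card A) = krull_dim R)"


section \<open>Modules\<close>

text \<open>The record \<^typ>\<open>('a, 'b) module\<close> extends the ring record; \<^locale>\<open>module\<close> does not
  constrain the fields \<open>mult\<close> and \<open>one\<close>, and they are left undefined below.\<close>

definition mod_hom ::
  "('a, 'r) ring_scheme \<Rightarrow> ('a, 'm) module \<Rightarrow> ('a, 'n) module \<Rightarrow> ('m \<Rightarrow> 'n) set" where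
  "mod_hom R M N = {h \<in> hom (add_monoid M) (add_monoid N).
     \<forall>a\<in>carrier R. \<forall>x\<in>carrier M. h (a \<odot>\<^bsub>M\<^esub> x) = a \<odot>\<^bsub>N\<^esub> h x}"

definition mod_isomorphic ::
  "('a, 'r) ring_scheme \<Rightarrow> ('a, 'm) module \<Rightarrow> ('a, 'n) module \<Rightarrow> bool" where
  "mod_isomorphic R M N \<longleftrightarrow> (\<exists>h\<in>mod_hom R M N. bij_betw h (carrier M) (carrier N))"

definition exact_at ::
  "('a, 'l) module \<Rightarrow> ('a, 'm) module \<Rightarrow> ('a, 'n) module \<Rightarrow> ('l \<Rightarrow> 'm) \<Rightarrow> ('m \<Rightarrow> 'n) \<Rightarrow> bool" where
  "exact_at L M N f g \<longleftrightarrow> f ` carrier L = a_kernel M N g"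

definition regular_module :: "('a, 'r) ring_scheme \<Rightarrow> ('a, 'a) module" where
  "regular_module R = \<lparr>carrier = carrier R, monoid.mult = undefined, one = undefined,
     ring.zero = \<zero>\<^bsub>R\<^esub>, add = (\<oplus>\<^bsub>R\<^esub>), smult = (\<otimes>\<^bsub>R\<^esub>)\<rparr>"

text \<open>As for \<^const>\<open>rcoset_mult\<close>, the union in the scalar multiplication is the single coset
  of \<open>a \<odot> x\<close> for any representative \<open>x\<close>.\<close>

definition quot_module :: "('a, 'm) module \<Rightarrow> 'm set \<Rightarrow> ('a, 'm set) module" where
  "quot_module M H = \<lparr>carrier = a_rcosets\<^bsub>M\<^esub> H, monoid.mult = undefined, one = undefined,
     ring.zero = H, add = set_add M, smult = (\<lambda>a Y. \<Union>x\<in>Y. H +>\<^bsub>M\<^esub> (a \<odot>\<^bsub>M\<^esub> x))\<rparr>"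

definition direct_sum :: "'i set \<Rightarrow> ('i \<Rightarrow> ('a, 'm) module) \<Rightarrow> ('a, 'i \<Rightarrow> 'm) module" where
  "direct_sum I M = \<lparr>
     carrier = {x \<in> \<Pi>\<^sub>E i\<in>I. carrier (M i). finite {i \<in> I. x i \<noteq> \<zero>\<^bsub>M i\<^esub>}},
     monoid.mult = undefined, one = undefined,
     ring.zero = (\<lambda>i\<in>I. \<zero>\<^bsub>M i\<^esub>),
     add = (\<lambda>x y. \<lambda>i\<in>I. x i \<oplus>\<^bsub>M i\<^esub> y i),
     smult = (\<lambda>a x. \<lambda>i\<in>I. a \<odot>\<^bsub>M i\<^esub> x i)\<rparr>"

definition free_module :: "('a, 'r) ring_scheme \<Rightarrow> 'b set \<Rightarrow> ('a, 'b \<Rightarrow> 'a) module" where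
  "free_module R B = direct_sum B (\<lambda>_. regular_module R)"

definition basis_vec :: "('a, 'r) ring_scheme \<Rightarrow> 'b set \<Rightarrow> 'b \<Rightarrow> 'b \<Rightarrow> 'a" where
  "basis_vec R B b = (\<lambda>c\<in>B. if c = b then \<one>\<^bsub>R\<^esub> else \<zero>\<^bsub>R\<^esub>)"

definition submodule_span :: "('a, 'r) ring_scheme \<Rightarrow> ('a, 'm) module \<Rightarrow> 'm set \<Rightarrow> 'm set" where
  "submodule_span R M A = \<Inter>{H. submodule H R M \<and> A \<subseteq> H}"

definition ideal_smult :: "('a, 'r) ring_scheme \<Rightarrow> 'a set \<Rightarrow> ('a, 'm) module \<Rightarrow> 'm set" where
  "ideal_smult R J M = submodule_span R M {a \<odot>\<^bsub>M\<^esub> x |a x. a \<in> J \<and> x \<in> carrier M}"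


section \<open>Tensor products and faithful flatness\<close>

definition tensor_free ::
  "('a, 'r) ring_scheme \<Rightarrow> ('a, 'm) module \<Rightarrow> ('a, 'n) module \<Rightarrow> ('a, 'm \<times> 'n \<Rightarrow> 'a) module" where
  "tensor_free R M N = free_module R (carrier M \<times> carrier N)"

definition tensor_rels ::
  "('a, 'r) ring_scheme \<Rightarrow> ('a, 'm) module \<Rightarrow> ('a, 'n) module \<Rightarrow> ('m \<times> 'n \<Rightarrow> 'a) set" where
  "tensor_rels R M N =
    (let F = tensor_free R M N; e = (\<lambda>x y. basis_vec R (carrier M \<times> carrier N) (x, y)) in
       {e (x \<oplus>\<^bsub>M\<^esub> x') y \<ominus>\<^bsub>F\<^esub> (e x y \<oplus>\<^bsub>F\<^esub> e x' y) |x x' y.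
          x \<in> carrier M \<and> x' \<in> carrier M \<and> y \<in> carrier N}
     \<union> {e x (y \<oplus>\<^bsub>N\<^esub> y') \<ominus>\<^bsub>F\<^esub> (e x y \<oplus>\<^bsub>F\<^esub> e x y') |x y y'.
          x \<in> carrier M \<and> y \<in> carrier N \<and> y' \<in> carrier N}
     \<union> {e (a \<odot>\<^bsub>M\<^esub> x) y \<ominus>\<^bsub>F\<^esub> (a \<odot>\<^bsub>F\<^esub> e x y) |a x y.
          a \<in> carrier R \<and> x \<in> carrier M \<and> y \<in> carrier N}
     \<union> {e x (a \<odot>\<^bsub>N\<^esub> y) \<ominus>\<^bsub>F\<^esub> (a \<odot>\<^bsub>F\<^esub> e x y) |a x y.
          a \<in> carrier R \<and> x \<in> carrier M \<and> y \<in> carrier N})"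

definition tensor_kernel ::
  "('a, 'r) ring_scheme \<Rightarrow> ('a, 'm) module \<Rightarrow> ('a, 'n) module \<Rightarrow> ('m \<times> 'n \<Rightarrow> 'a) set" where
  "tensor_kernel R M N = submodule_span R (tensor_free R M N) (tensor_rels R M N)"

definition tensor_product ::
  "('a, 'r) ring_scheme \<Rightarrow> ('a, 'm) module \<Rightarrow> ('a, 'n) module
     \<Rightarrow> ('a, ('m \<times> 'n \<Rightarrow> 'a) set) module" where
  "tensor_product R M N = quot_module (tensor_free R M N) (tensor_kernel R M N)"

definition pure_tensor ::
  "('a, 'r) ring_scheme \<Rightarrow> ('a, 'm) module \<Rightarrow> ('a, 'n) module
     \<Rightarrow> 'm \<Rightarrow> 'n \<Rightarrow> ('m \<times> 'n \<Rightarrow> 'a) set" where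
  "pure_tensor R M N x y =
     tensor_kernel R M N +>\<^bsub>tensor_free R M N\<^esub> basis_vec R (carrier M \<times> carrier N) (x, y)"

text \<open>The map \<open>id\<^sub>M \<otimes> f : M \<otimes> N \<longrightarrow> M \<otimes> N'\<close>. An element \<open>Y\<close> of \<open>M \<otimes> N\<close> is a
  coset of formal combinations \<open>u\<close> of pairs \<open>(x, y)\<close>, sent to \<open>\<Sum> u (x, y) (x \<otimes> f y)\<close>;
  for linear \<open>f\<close> the value is the same for all \<open>u \<in> Y\<close>, so that the image below is a
  singleton.\<close>

definition tensor_map ::
  "('a, 'r) ring_scheme \<Rightarrow> ('a, 'm) module \<Rightarrow> ('a, 'n) module \<Rightarrow> ('a, 'k) module
     \<Rightarrow> ('n \<Rightarrow> 'k) \<Rightarrow> ('m \<times> 'n \<Rightarrow> 'a) set \<Rightarrow> ('m \<times> 'k \<Rightarrow> 'a) set" where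
  "tensor_map R M N N' f Y = the_elem
     ((\<lambda>u. \<Oplus>\<^bsub>tensor_product R M N'\<^esub> p\<in>{p \<in> carrier M \<times> carrier N. u p \<noteq> \<zero>\<^bsub>R\<^esub>}.
         u p \<odot>\<^bsub>tensor_product R M N'\<^esub> pure_tensor R M N' (fst p) (f (snd p))) ` Y)"

text \<open>\<open>M\<close> is faithfully flat if a sequence \<open>L \<longrightarrow> N \<longrightarrow> P\<close> is exact exactly when
  \<open>M \<otimes> L \<longrightarrow> M \<otimes> N \<longrightarrow> M \<otimes> P\<close> is. Since HOL cannot quantify over types, the
  type \<open>'u\<close> carrying the test modules is a parameter. Every finitely generated \<open>R\<close>-module
  is isomorphic to a quotient of some \<open>R\<^sup>n\<close>, whose carrier lives in
  \<open>(nat \<Rightarrow> 'a) set\<close>; this instance already gives full faithful flatness, because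
  flatness is detected by the inclusions of finitely generated ideals and faithfulness by the
  residue fields. Taking it in a hypothesis can therefore only make a theorem stronger than taking
  a larger \<open>'u\<close>. For a much smaller \<open>'u\<close> the notion degenerates.\<close>

definition faithfully_flat ::
  "'u itself \<Rightarrow> ('a, 'r) ring_scheme \<Rightarrow> ('a, 'm) module \<Rightarrow> bool" where
  "faithfully_flat (_ :: 'u itself) R M \<longleftrightarrow> module R M \<and>
     (\<forall>(L :: ('a, 'u) module) (N :: ('a, 'u) module) (P :: ('a, 'u) module) f g.
        module R L \<and> module R N \<and> module R P \<and> f \<in> mod_hom R L N \<and> g \<in> mod_hom R N P \<longrightarrow>
        (exact_at L N P f g \<longleftrightarrow>
         exact_at (tensor_product R M L) (tensor_product R M N) (tensor_product R M P)
           (tensor_map R M L N f) (tensor_map R M N P g)))"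


section \<open>Minimal free resolutions and syzygies\<close>

definition free_fin_rank :: "('a, 'r) ring_scheme \<Rightarrow> ('a, 'm) module \<Rightarrow> bool" where
  "free_fin_rank R F \<longleftrightarrow> module R F \<and> (\<exists>n. mod_isomorphic R (free_module R {..<n::nat}) F)"

text \<open>The differential \<open>d i\<close> goes from \<open>F (Suc i)\<close> to \<open>F i\<close>, and \<open>\<epsilon>\<close> is the
  augmentation \<open>F 0 \<longrightarrow> N\<close>.\<close>

definition minimal_free_resolution ::
  "('a, 'r) ring_scheme \<Rightarrow> 'a set \<Rightarrow> ('a, 'n) module
     \<Rightarrow> (nat \<Rightarrow> ('a, 'f) module) \<Rightarrow> (nat \<Rightarrow> 'f \<Rightarrow> 'f) \<Rightarrow> ('f \<Rightarrow> 'n) \<Rightarrow> bool" where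
  "minimal_free_resolution R \<mm> N F d \<epsilon> \<longleftrightarrow>
     (\<forall>i. free_fin_rank R (F i)) \<and>
     (\<forall>i. d i \<in> mod_hom R (F (Suc i)) (F i)) \<and>
     \<epsilon> \<in> mod_hom R (F 0) N \<and> \<epsilon> ` carrier (F 0) = carrier N \<and>
     exact_at (F 1) (F 0) N (d 0) \<epsilon> \<and>
     (\<forall>i. exact_at (F (Suc (Suc i))) (F (Suc i)) (F i) (d (Suc i)) (d i)) \<and>
     (\<forall>i. d i ` carrier (F (Suc i)) \<subseteq> ideal_smult R \<mm> (F i))"

text \<open>\<open>S\<close> is (isomorphic to) the \<open>n\<close>-th syzygy of \<open>N\<close>. Each finitely generated free
  module has a copy on the type \<open>nat \<Rightarrow> 'a\<close>, so fixing that type for the resolution is no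
  restriction.\<close>

definition is_syzygy ::
  "('a, 'r) ring_scheme \<Rightarrow> 'a set \<Rightarrow> ('a, 'n) module \<Rightarrow> nat \<Rightarrow> ('a, 's) module \<Rightarrow> bool" where
  "is_syzygy R \<mm> N n S \<longleftrightarrow> module R S \<and>
     (\<exists>(F :: nat \<Rightarrow> ('a, nat \<Rightarrow> 'a) module) d \<epsilon>. minimal_free_resolution R \<mm> N F d \<epsilon> \<and>
        (case n of
           0 \<Rightarrow> mod_isomorphic R N S
         | Suc j \<Rightarrow> mod_isomorphic R ((F j)\<lparr>carrier := d j ` carrier (F (Suc j))\<rparr>) S))"

definition residue_field_module ::
  "('a, 'r) ring_scheme \<Rightarrow> 'a set \<Rightarrow> ('a, 'a set) module" where
  "residue_field_module R \<mm> = quot_module (regular_module R) \<mm>"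

end

theory Submission
  imports Defs
begin

text \<open>Let \<open>F\<close> be the minimal free resolution of the residue field \<open>k = R/\<mm>\<close> and \<open>M\<close> the faithfully
flat module. Since \<open>M \<noteq> \<mm>M\<close>, some summand \<open>\<Omega>\<^sup>n k\<close> has an element whose image in \<open>M\<close> lies outside
\<open>\<mm>M\<close>. Composing with the surjection \<open>F\<^sub>n \<longrightarrow> \<Omega>\<^sup>n k\<close> gives a linear map \<open>f : F\<^sub>n \<longrightarrow> M\<close> which kills the
boundaries \<open>d F\<^bsub>n+1\<^esub>\<close> and an element \<open>e \<in> F\<^sub>n\<close> with \<open>f e \<notin> \<mm>M\<close>. Such a pair \<open>(f, e)\<close> forces \<open>R\<close> to be
regular; this is the theorem of Dutta on free summands of syzygies, with \<open>M\<close> in place of \<open>R\<close>.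

Choose a regular sequence \<open>x\<^sub>1, \<dots>, x\<^sub>t\<close> in \<open>\<mm>\<close> whose members are linearly independent modulo
\<open>\<mm>\<^sup>2\<close> and which cannot be prolonged, and put \<open>J = (x\<^sub>1, \<dots>, x\<^sub>t)\<close>. By prime avoidance, \<open>R/J\<close> then has a
nonzero socle: there is \<open>s \<notin> J\<close> with \<open>\<mm>s \<subseteq> J\<close> (\<open>exists_maximal_minimal_regular\<close>). The heart of the
argument is that the map \<open>Tor\<^sub>n(k, R/J) \<longrightarrow> Tor\<^sub>n(k, k)\<close> is injective, which says that
every \<open>v \<in> \<mm>F\<^sub>n\<close> with \<open>d v \<in> JF\<^bsub>n-1\<^esub>\<close> lies in \<open>d F\<^bsub>n+1\<^esub> + JF\<^sub>n\<close>
(\<open>tor_residue_field_injective\<close>). Suppose \<open>s \<in> \<mm>\<close>. Then \<open>v = s e\<close> is in \<open>\<mm>F\<^sub>n\<close>, and \<open>d v = s (d e)\<close> is in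
\<open>s\<mm>F\<^bsub>n-1\<^esub> \<subseteq> JF\<^bsub>n-1\<^esub>\<close> because the resolution is minimal, so \<open>s e = d w + j\<close> with \<open>j \<in> JF\<^sub>n\<close> and
\<open>s (f e) = f j \<in> JM\<close>. Flatness of \<open>M\<close> turns this into \<open>f e \<in> (J : s)M = \<mm>M\<close>
(\<open>faithfully_flat_colon\<close>), a contradiction. Hence \<open>s\<close> is a unit and \<open>\<mm> = J\<close>.

It remains to see that \<open>t\<close> is the dimension of \<open>R\<close>. The ideals \<open>(x\<^sub>1, \<dots>, x\<^sub>i)\<close> form a chain of primes, so
the dimension is at least \<open>t\<close>, and Krull's height theorem bounds it by \<open>t\<close>
(\<open>regular_of_minimal_regular\<close>). The height theorem is proved here in the form of an exchange lemma for
chains of primes; all localizations that occur in the usual proof are replaced by saturations of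
ideals of \<open>R\<close>.\<close>

section \<open>Ideals in noetherian rings\<close>

lemma (in cring) ideal_closed:
  assumes "ideal J R"
  shows "J \<subseteq> carrier R" and "\<zero> \<in> J"
    and "\<And>a b. a \<in> J \<Longrightarrow> b \<in> J \<Longrightarrow> a \<oplus> b \<in> J"
    and "\<And>a b. a \<in> J \<Longrightarrow> b \<in> J \<Longrightarrow> a \<ominus> b \<in> J"
    and "\<And>a r. a \<in> J \<Longrightarrow> r \<in> carrier R \<Longrightarrow> r \<otimes> a \<in> J"
    and "\<And>a r. a \<in> J \<Longrightarrow> r \<in> carrier R \<Longrightarrow> a \<otimes> r \<in> J"
proof -
  interpret J: ideal J R by fact
  show "J \<subseteq> carrier R" "\<zero> \<in> J"
    and "\<And>a b. a \<in> J \<Longrightarrow> b \<in> J \<Longrightarrow> a \<oplus> b \<in> J"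
    and "\<And>a b. a \<in> J \<Longrightarrow> b \<in> J \<Longrightarrow> a \<ominus> b \<in> J"
    and "\<And>a r. a \<in> J \<Longrightarrow> r \<in> carrier R \<Longrightarrow> r \<otimes> a \<in> J"
    and "\<And>a r. a \<in> J \<Longrightarrow> r \<in> carrier R \<Longrightarrow> a \<otimes> r \<in> J"
    using J.a_subset by (auto simp: a_minus_def J.I_l_closed J.I_r_closed)
qed

lemma (in cring) ideal_criterion:
  assumes "J \<subseteq> carrier R" "\<zero> \<in> J"
    and add: "\<And>a b. a \<in> J \<Longrightarrow> b \<in> J \<Longrightarrow> a \<oplus> b \<in> J"
    and mult: "\<And>a r. a \<in> J \<Longrightarrow> r \<in> carrier R \<Longrightarrow> r \<otimes> a \<in> J"
  shows "ideal J R"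
proof (rule idealI)
  show "ring R" by (rule ring_axioms)
  have neg: "\<ominus> a \<in> J" if "a \<in> J" for a
  proof -
    have "\<ominus> a = (\<ominus> \<one>) \<otimes> a" using that assms(1) by (simp add: l_minus subset_iff)
    then show ?thesis using mult[OF that, of "\<ominus> \<one>"] by simp
  qed
  show "subgroup J (add_monoid R)"
  proof (rule add.subgroupI)
    show "J \<subseteq> carrier R" "J \<noteq> {}" using assms(1,2) by auto
    show "\<ominus> a \<in> J" if "a \<in> J" for a using neg[OF that] .
    show "a \<oplus> b \<in> J" if "a \<in> J" "b \<in> J" for a b using add[OF that] .
  qed
  show "x \<otimes> a \<in> J" if "a \<in> J" "x \<in> carrier R" for a x using mult[OF that] .
  show "a \<otimes> x \<in> J" if "a \<in> J" "x \<in> carrier R" for a x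
    using mult[OF that] that assms(1) by (simp add: m_comm subset_iff)
qed

definition (in ring) adjoin :: "'a set \<Rightarrow> 'a \<Rightarrow> 'a set" where
  "adjoin J x = {j \<oplus> r \<otimes> x |j r. j \<in> J \<and> r \<in> carrier R}"

lemma (in cring) adjoin_ideal:
  assumes "ideal J R" "x \<in> carrier R"
  shows "ideal (adjoin J x) R" and "J \<subseteq> adjoin J x" and "x \<in> adjoin J x"
proof -
  note J = ideal_closed[OF assms(1)]
  show "J \<subseteq> adjoin J x"
  proof
    fix j assume "j \<in> J"
    then have "j = j \<oplus> \<zero> \<otimes> x" using J(1) assms(2) by auto
    then show "j \<in> adjoin J x" unfolding adjoin_def using \<open>j \<in> J\<close> by blast
  qed
  have "x = \<zero> \<oplus> \<one> \<otimes> x" using assms(2) by simp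
  then show "x \<in> adjoin J x" unfolding adjoin_def using J(2) by blast
  show "ideal (adjoin J x) R"
  proof (rule ideal_criterion)
    show "adjoin J x \<subseteq> carrier R" unfolding adjoin_def using J(1) assms(2) by auto
    show "\<zero> \<in> adjoin J x" using \<open>J \<subseteq> adjoin J x\<close> J(2) by blast
  next
    fix a b assume "a \<in> adjoin J x" "b \<in> adjoin J x"
    then obtain i r j s where a: "a = i \<oplus> r \<otimes> x" and b: "b = j \<oplus> s \<otimes> x"
      and ij: "i \<in> J" "j \<in> J" and rs: "r \<in> carrier R" "s \<in> carrier R"
      unfolding adjoin_def by blast
    have c: "i \<in> carrier R" "j \<in> carrier R" using ij J(1) by auto
    have "a \<oplus> b = (i \<oplus> j) \<oplus> (r \<oplus> s) \<otimes> x"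
      unfolding a b using c rs assms(2) by algebra
    then show "a \<oplus> b \<in> adjoin J x" unfolding adjoin_def using J(3)[OF ij] rs by blast
  next
    fix a s assume "a \<in> adjoin J x" and s: "s \<in> carrier R"
    then obtain i r where a: "a = i \<oplus> r \<otimes> x" and i: "i \<in> J" and r: "r \<in> carrier R"
      unfolding adjoin_def by blast
    have c: "i \<in> carrier R" using i J(1) by auto
    have "s \<otimes> a = s \<otimes> i \<oplus> (s \<otimes> r) \<otimes> x"
      unfolding a using c r s assms(2) by algebra
    then show "s \<otimes> a \<in> adjoin J x" unfolding adjoin_def using J(5)[OF i s] r s by blast
  qed
qed

lemma (in cring) adjoin_minimal:
  assumes "ideal I R" "J \<subseteq> I" "x \<in> I"
  shows "adjoin J x \<subseteq> I"
  unfolding adjoin_def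
  using ideal_closed(3)[OF assms(1)] ideal_closed(5)[OF assms(1) assms(3)] assms(2) by blast

lemma (in cring) Idl_insert:
  assumes "A \<subseteq> carrier R" "x \<in> carrier R"
  shows "Idl (insert x A) = adjoin (Idl A) x"
proof
  have A: "ideal (Idl A) R" by (rule genideal_ideal) fact
  note adj = adjoin_ideal[OF A assms(2)]
  show "Idl (insert x A) \<subseteq> adjoin (Idl A) x"
    using genideal_minimal[OF adj(1)] adj(2,3) genideal_self[OF assms(1)] by auto
  have "insert x A \<subseteq> carrier R" using assms by auto
  then show "adjoin (Idl A) x \<subseteq> Idl (insert x A)"
    using genideal_self[of "insert x A"] subset_Idl_subset[of "insert x A" A]
    by (intro adjoin_minimal genideal_ideal) auto
qed

lemma (in cring) Idl_empty: "Idl {} = {\<zero>}"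
  using genideal_minimal[OF zeroideal, of "{}"] ideal_closed(2)[OF genideal_ideal, of "{}"] by auto

lemma (in cring) ideal_eq_carrier_iff:
  assumes "ideal J R" shows "J = carrier R \<longleftrightarrow> \<one> \<in> J"
  using ideal.one_imp_carrier[OF assms] by auto

definition (in ring) colon :: "'a set \<Rightarrow> 'a \<Rightarrow> 'a set" where
  "colon J g = {a \<in> carrier R. a \<otimes> g \<in> J}"

lemma (in cring) colon_ideal:
  assumes "ideal J R" "g \<in> carrier R"
  shows "ideal (colon J g) R" and "J \<subseteq> colon J g"
proof -
  note J = ideal_closed[OF assms(1)]
  show "J \<subseteq> colon J g" 
  proof
    fix j assume j: "j \<in> J"
    then show "j \<in> colon J g"
      unfolding colon_def using J(1) J(6)[OF j assms(2)] by auto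
  qed
  show "ideal (colon J g) R"
  proof (rule ideal_criterion)
    show "\<zero> \<in> colon J g" unfolding colon_def using J(2) assms(2) by simp
    fix a r assume "a \<in> colon J g" "r \<in> carrier R"
    then show "r \<otimes> a \<in> colon J g" 
      unfolding colon_def using J(5)[of "a \<otimes> g" r] assms(2) by (simp add: m_assoc)
  next
    fix a b assume "a \<in> colon J g" "b \<in> colon J g"
    then show "a \<oplus> b \<in> colon J g" 
      unfolding colon_def using J(3)[of "a \<otimes> g" "b \<otimes> g"] assms(2) by (simp add: l_distr)
  qed (auto simp: colon_def)
qed

text \<open>The condition says that the class of \<open>g\<close> in \<open>R/J\<close> is nonzero and has a maximal annihilator.
Over a noetherian ring these annihilators are the maximal associated primes of \<open>R/J\<close>, and their union
is the set of zero divisors modulo \<open>J\<close>.\<close>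

definition (in ring) maximal_colon :: "'a set \<Rightarrow> 'a \<Rightarrow> bool" where
  "maximal_colon J g \<longleftrightarrow> g \<in> carrier R \<and> g \<notin> J \<and>
     (\<forall>h\<in>carrier R. h \<notin> J \<longrightarrow> colon J g \<subseteq> colon J h \<longrightarrow> colon J h = colon J g)"

text \<open>If \<open>b\<close> does not annihilate \<open>g\<close> modulo \<open>J\<close>, then \<open>b g\<close> is again nonzero and its annihilator contains that
of \<open>g\<close>, so the two agree by maximality; whatever annihilates \<open>b g\<close> therefore annihilates \<open>g\<close>.\<close>

lemma (in cring) maximal_colon_prime:
  assumes J: "ideal J R" and max: "maximal_colon J g"
  shows "primeideal (colon J g) R"
proof (rule primeidealI)
  have g: "g \<in> carrier R" "g \<notin> J" using max unfolding maximal_colon_def by auto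
  show "ideal (colon J g) R" by (rule colon_ideal) (fact J g)+
  show "cring R" ..
  show "carrier R \<noteq> colon J g"
  proof
    assume "carrier R = colon J g"
    then have "\<one> \<in> colon J g" by auto
    then show False unfolding colon_def using g by simp
  qed
  fix a b assume ab: "a \<in> carrier R" "b \<in> carrier R" "a \<otimes> b \<in> colon J g"
  show "a \<in> colon J g \<or> b \<in> colon J g"
  proof (rule disjCI)
    assume nb: "b \<notin> colon J g"
    have "colon J g \<subseteq> colon J (b \<otimes> g)"
    proof
      fix c assume "c \<in> colon J g"
      then have c: "c \<in> carrier R" "c \<otimes> g \<in> J" unfolding colon_def by auto
      have "c \<otimes> (b \<otimes> g) = b \<otimes> (c \<otimes> g)" using c(1) ab g by algebra
      then show "c \<in> colon J (b \<otimes> g)"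
        unfolding colon_def using ideal_closed(5)[OF J c(2) ab(2)] c(1) by simp
    qed
    moreover have "b \<otimes> g \<notin> J" using nb ab unfolding colon_def by auto
    ultimately have "colon J (b \<otimes> g) = colon J g"
      using max ab(2) g(1) unfolding maximal_colon_def by simp
    moreover have "a \<in> colon J (b \<otimes> g)"
      using ab g unfolding colon_def by (simp add: m_assoc)
    ultimately show "a \<in> colon J g" by simp
  qed
qed

locale noetherian_cring = cring R + noetherian_ring R for R (structure)

lemma (in noetherian_cring) exists_maximal_ideal_in:
  assumes "\<And>J. J \<in> \<J> \<Longrightarrow> ideal J R" "J\<^sub>0 \<in> \<J>"
  shows "\<exists>L\<in>\<J>. J\<^sub>0 \<subseteq> L \<and> (\<forall>K\<in>\<J>. L \<subseteq> K \<longrightarrow> K = L)"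
proof -
  have "\<exists>L\<in>{J\<in>\<J>. J\<^sub>0 \<subseteq> J}. \<forall>K\<in>{J\<in>\<J>. J\<^sub>0 \<subseteq> J}. L \<subseteq> K \<longrightarrow> K = L"
  proof (rule subset_Zorn_nonempty)
    show "{J\<in>\<J>. J\<^sub>0 \<subseteq> J} \<noteq> {}" using assms(2) by auto
    fix C assume C: "C \<noteq> {}" "subset.chain {J\<in>\<J>. J\<^sub>0 \<subseteq> J} C"
    have "subset.chain {I. ideal I R} C"
      using C(2) assms(1) unfolding pred_on.chain_def by blast
    then have "\<Union>C \<in> C" using ideal_chain_is_trivial C(1) by blast
    then show "\<Union>C \<in> {J\<in>\<J>. J\<^sub>0 \<subseteq> J}" using C(2) unfolding pred_on.chain_def by blast
  qed
  then obtain L where L: "L \<in> \<J>" "J\<^sub>0 \<subseteq> L"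
    and max: "\<And>K. K \<in> {J\<in>\<J>. J\<^sub>0 \<subseteq> J} \<Longrightarrow> L \<subseteq> K \<Longrightarrow> K = L" by auto
  have "K = L" if "K \<in> \<J>" "L \<subseteq> K" for K
    using max[of K] that order_trans[OF L(2) that(2)] by simp
  then show ?thesis using L by auto
qed

lemma (in noetherian_cring) exists_maximal_colon:
  assumes "ideal J R" "g \<in> carrier R" "g \<notin> J"
  obtains h where "maximal_colon J h" "colon J g \<subseteq> colon J h"
proof -
  define \<C> where "\<C> = {colon J h |h. h \<in> carrier R \<and> h \<notin> J}"
  have "ideal K R" if "K \<in> \<C>" for K
    using that colon_ideal(1)[OF assms(1)] unfolding \<C>_def by blast
  moreover have "colon J g \<in> \<C>" unfolding \<C>_def using assms by blast
  ultimately obtain L where L: "L \<in> \<C>" "colon J g \<subseteq> L" "\<forall>K\<in>\<C>. L \<subseteq> K \<longrightarrow> K = L"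
    using exists_maximal_ideal_in[of \<C>] by blast
  then obtain h where h: "L = colon J h" "h \<in> carrier R" "h \<notin> J" unfolding \<C>_def by blast
  have "colon J k = colon J h" if "k \<in> carrier R" "k \<notin> J" "colon J h \<subseteq> colon J k" for k
    using L(3) h(1) that unfolding \<C>_def by blast
  then have "maximal_colon J h" unfolding maximal_colon_def using h by blast
  then show ?thesis using that L(2) h(1) by blast
qed

text \<open>An ideal \<open>Q\<close> that is maximal among those containing \<open>J\<close> and disjoint from \<open>S\<close> is prime: for \<open>a, b \<notin> Q\<close>
both \<open>Q + (a)\<close> and \<open>Q + (b)\<close> meet \<open>S\<close>, and if \<open>a b\<close> were in \<open>Q\<close>, the product of two points of \<open>S\<close> found
there would be a point of \<open>Q \<inter> S\<close>.\<close>

lemma (in noetherian_cring) exists_prime_disjoint: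
  assumes J: "ideal J R" and S: "S \<subseteq> carrier R" "\<one> \<in> S"
    and mult: "\<And>a b. a \<in> S \<Longrightarrow> b \<in> S \<Longrightarrow> a \<otimes> b \<in> S"
    and disj: "J \<inter> S = {}"
  obtains Q where "primeideal Q R" "J \<subseteq> Q" "Q \<inter> S = {}"
proof -
  define \<C> where "\<C> = {L. ideal L R \<and> L \<inter> S = {}}"
  have "J \<in> \<C>" unfolding \<C>_def using J disj by simp
  then obtain Q where Q: "Q \<in> \<C>" "J \<subseteq> Q" "\<forall>K\<in>\<C>. Q \<subseteq> K \<longrightarrow> K = Q"
    using exists_maximal_ideal_in[of \<C> J] unfolding \<C>_def by blast
  have id: "ideal Q R" and QS: "Q \<inter> S = {}" using Q(1) unfolding \<C>_def by auto
  note Qc = ideal_closed[OF id]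
  have meet: "\<exists>q\<in>Q. \<exists>r\<in>carrier R. q \<oplus> r \<otimes> a \<in> S" if a: "a \<in> carrier R" "a \<notin> Q" for a
  proof -
    note adj = adjoin_ideal[OF id a(1)]
    have "adjoin Q a \<inter> S \<noteq> {}"
    proof
      assume "adjoin Q a \<inter> S = {}"
      then have "adjoin Q a \<in> \<C>" unfolding \<C>_def using adj(1) by simp
      then have "adjoin Q a = Q" using Q(3) adj(2) by blast
      then show False using adj(3) a(2) by simp
    qed
    then show ?thesis unfolding adjoin_def by auto
  qed
  have "primeideal Q R"
  proof (rule primeidealI)
    show "ideal Q R" "cring R" by (fact id) (rule is_cring)
    show "carrier R \<noteq> Q" using S(2) QS by auto
    fix a b assume ab: "a \<in> carrier R" "b \<in> carrier R" "a \<otimes> b \<in> Q"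
    show "a \<in> Q \<or> b \<in> Q"
    proof (rule ccontr)
      assume "\<not> (a \<in> Q \<or> b \<in> Q)"
      then obtain q r q' r' where q: "q \<in> Q" "r \<in> carrier R" "q \<oplus> r \<otimes> a \<in> S"
        and q': "q' \<in> Q" "r' \<in> carrier R" "q' \<oplus> r' \<otimes> b \<in> S"
        using meet[OF ab(1)] meet[OF ab(2)] by blast
      have c: "q \<in> carrier R" "q' \<in> carrier R" using q q' Qc(1) by auto
      have "(q \<oplus> r \<otimes> a) \<otimes> (q' \<oplus> r' \<otimes> b) =
          q \<otimes> (q' \<oplus> r' \<otimes> b) \<oplus> (q' \<otimes> (r \<otimes> a) \<oplus> (r \<otimes> r') \<otimes> (a \<otimes> b))"
        using c q q' ab by algebra
      moreover have "\<dots> \<in> Q"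
        using q q' ab
        by (intro Qc(3) Qc(6)[OF q(1)] Qc(6)[OF q'(1)] Qc(5)[OF ab(3)]) (auto simp: c)
      ultimately show False using mult[OF q(3) q'(3)] QS by auto
    qed
  qed
  then show ?thesis using that Q(2) QS by blast
qed

lemma (in cring) primeideal_closed:
  assumes "primeideal P R"
  shows "ideal P R" and "\<one> \<notin> P"
    and "\<And>a b. a \<in> carrier R - P \<Longrightarrow> b \<in> carrier R - P \<Longrightarrow> a \<otimes> b \<in> carrier R - P"
proof -
  interpret P: primeideal P R by fact
  show "ideal P R" ..
  show "\<one> \<notin> P" using P.I_notcarr P.one_imp_carrier by auto
  show "\<And>a b. a \<in> carrier R - P \<Longrightarrow> b \<in> carrier R - P \<Longrightarrow> a \<otimes> b \<in> carrier R - P"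
    using P.I_prime by blast
qed

text \<open>This is the contraction to \<open>R\<close> of the extension of \<open>J\<close> to the local ring \<open>R\<^sub>P\<close>. Statements about ideals
of \<open>R\<^sub>P\<close> are phrased through it, so that the ring never changes.\<close>

definition (in ring) saturation :: "'a set \<Rightarrow> 'a set \<Rightarrow> 'a set" where
  "saturation P J = {a \<in> carrier R. \<exists>v\<in>carrier R - P. v \<otimes> a \<in> J}"

lemma (in cring) saturationI: "a \<in> carrier R \<Longrightarrow> v \<in> carrier R - P \<Longrightarrow> v \<otimes> a \<in> J \<Longrightarrow> a \<in> saturation P J"
  unfolding saturation_def by blast

lemma (in cring) saturation_ideal:
  assumes P: "primeideal P R" and J: "ideal J R"
  shows "ideal (saturation P J) R" and "J \<subseteq> saturation P J" and "saturation P (saturation P J) = saturation P J"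
proof -
  note Jc = ideal_closed[OF J] and Pc = primeideal_closed[OF P]
  show sub: "J \<subseteq> saturation P J"
  proof
    fix j assume j: "j \<in> J"
    have "\<one> \<otimes> j \<in> J" "\<one> \<in> carrier R - P" using j Jc(1) Pc(2) by auto
    then show "j \<in> saturation P J" unfolding saturation_def using j Jc(1) by blast
  qed
  show id: "ideal (saturation P J) R"
  proof (rule ideal_criterion)
    show "saturation P J \<subseteq> carrier R" by (auto simp: saturation_def)
    show "\<zero> \<in> saturation P J" using sub Jc(2) by auto
  next
    fix a b assume "a \<in> saturation P J" "b \<in> saturation P J"
    then obtain v w where v: "v \<in> carrier R - P" "v \<otimes> a \<in> J" and w: "w \<in> carrier R - P" "w \<otimes> b \<in> J"
      and ab: "a \<in> carrier R" "b \<in> carrier R" unfolding saturation_def by blast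
    have vw: "v \<in> carrier R" "w \<in> carrier R" using v w by auto
    have "(v \<otimes> w) \<otimes> (a \<oplus> b) = w \<otimes> (v \<otimes> a) \<oplus> v \<otimes> (w \<otimes> b)"
      using ab vw by algebra
    moreover have "\<dots> \<in> J" using Jc(3)[OF Jc(5)[OF v(2) vw(2)] Jc(5)[OF w(2) vw(1)]] .
    ultimately show "a \<oplus> b \<in> saturation P J"
      using ab Pc(3)[OF v(1) w(1)] by (intro saturationI[of _ "v \<otimes> w"]) auto
  next
    fix a r assume "a \<in> saturation P J" and r: "r \<in> carrier R"
    then obtain v where v: "v \<in> carrier R - P" "v \<otimes> a \<in> J" and a: "a \<in> carrier R"
      unfolding saturation_def by blast
    have vc: "v \<in> carrier R" using v by auto
    have "v \<otimes> (r \<otimes> a) = r \<otimes> (v \<otimes> a)" using a vc r by algebra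
    then show "r \<otimes> a \<in> saturation P J"
      using Jc(5)[OF v(2) r] v(1) a r by (intro saturationI[of _ v]) auto
  qed
  show "saturation P (saturation P J) = saturation P J"
  proof
    show "saturation P J \<subseteq> saturation P (saturation P J)"
    proof
      fix j assume j: "j \<in> saturation P J"
      then have jc: "j \<in> carrier R" by (auto simp: saturation_def)
      have "\<one> \<otimes> j \<in> saturation P J" "\<one> \<in> carrier R - P" using j jc Pc(2) by auto
      then show "j \<in> saturation P (saturation P J)" unfolding saturation_def[of P "saturation P J"] using jc by blast
    qed
    show "saturation P (saturation P J) \<subseteq> saturation P J"
    proof
      fix a assume "a \<in> saturation P (saturation P J)"
      then obtain v w where v: "v \<in> carrier R - P" and w: "w \<in> carrier R - P" "w \<otimes> (v \<otimes> a) \<in> J"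
        and a: "a \<in> carrier R" unfolding saturation_def by blast
      have "(w \<otimes> v) \<otimes> a \<in> J" using w v a by (simp add: m_assoc)
      then show "a \<in> saturation P J" unfolding saturation_def using Pc(3)[OF w(1) v] a by blast
    qed
  qed
qed

lemma (in cring) saturation_mono: "J \<subseteq> K \<Longrightarrow> saturation P J \<subseteq> saturation P K"
  unfolding saturation_def by blast

lemma (in cring) ideal_prod_Idl_insert:
  assumes P: "ideal P R" and B: "B \<subseteq> carrier R" and g: "g \<in> carrier R"
    and z: "z \<in> P \<cdot> (Idl (insert g B))"
  shows "\<exists>z'\<in>P \<cdot> (Idl B). \<exists>p\<in>P. z = z' \<oplus> p \<otimes> g"
  using z
proof induction
  note Pc = ideal_closed[OF P]
  have IB: "ideal (Idl B) R" using genideal_ideal[OF B] .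
  note Bc = ideal_closed[OF IB] and Mc = ideal_closed[OF ideal_prod_is_ideal[OF P IB]]
  {
    case (prod p m)
    then obtain b r where m: "m = b \<oplus> r \<otimes> g" "b \<in> Idl B" "r \<in> carrier R"
      unfolding Idl_insert[OF B g] adjoin_def by blast
    have c: "b \<in> carrier R" "p \<in> carrier R" using m Bc(1) prod Pc(1) by auto
    have "p \<otimes> m = p \<otimes> b \<oplus> (p \<otimes> r) \<otimes> g" unfolding m using c m(3) g by algebra
    then show ?case
      using ideal_prod.prod[OF prod(1) m(2)] Pc(6)[OF prod(1) m(3)]
      by (intro bexI[of _ "p \<otimes> b"] bexI[of _ "p \<otimes> r"])
  next
    case (sum s1 s2)
    then obtain z1 p1 z2 p2 where s: "s1 = z1 \<oplus> p1 \<otimes> g" "s2 = z2 \<oplus> p2 \<otimes> g"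
      and zp: "z1 \<in> P \<cdot> (Idl B)" "z2 \<in> P \<cdot> (Idl B)" "p1 \<in> P" "p2 \<in> P" by blast
    have c: "z1 \<in> carrier R" "z2 \<in> carrier R" "p1 \<in> carrier R" "p2 \<in> carrier R"
      using zp Mc(1) Pc(1) by auto
    have "s1 \<oplus> s2 = (z1 \<oplus> z2) \<oplus> (p1 \<oplus> p2) \<otimes> g" unfolding s using c g by algebra
    then show ?case using Mc(3)[OF zp(1,2)] Pc(3)[OF zp(3,4)]
      by (intro bexI[of _ "z1 \<oplus> z2"] bexI[of _ "p1 \<oplus> p2"])
  }
qed

text \<open>Nakayama's lemma over \<open>R\<^sub>P\<close>, without determinants: the relation \<open>v g \<in> J + P(g, B)\<close> for one generator
\<open>g\<close> reads \<open>(v - p) g \<in> J + P(B)\<close> for some \<open>p \<in> P\<close>. Since \<open>v - p\<close> is outside \<open>P\<close>, the generator \<open>g\<close> can be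
eliminated from the relations for the others, and induction applies.\<close>

lemma (in cring) nakayama_generators:
  assumes P: "primeideal P R" and J: "ideal J R" and fin: "finite A" and A: "A \<subseteq> carrier R"
    and gen: "\<And>a. a \<in> A \<Longrightarrow> \<exists>v\<in>carrier R - P. \<exists>z\<in>P \<cdot> (Idl A). v \<otimes> a \<ominus> z \<in> J"
  shows "\<exists>v\<in>carrier R - P. \<forall>a\<in>Idl A. v \<otimes> a \<in> J"
  using fin A gen
proof induction
  case empty
  then show ?case using primeideal_closed(2)[OF P] ideal_closed(2)[OF J]
    by (intro bexI[of _ \<one>]) (auto simp: Idl_empty)
next
  case (insert g B)
  note Pc = primeideal_closed[OF P] and Jc = ideal_closed[OF J]
  note Pi = ideal_closed[OF Pc(1)]
  have B: "B \<subseteq> carrier R" and g: "g \<in> carrier R" using insert.prems(1) by auto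
  have IB: "ideal (Idl B) R" using genideal_ideal[OF B] .
  note Bc = ideal_closed[OF IB] and Mi = ideal_prod_is_ideal[OF Pc(1) IB]
  note Mc = ideal_closed[OF Mi]
  obtain v z where v: "v \<in> carrier R - P" and z: "z \<in> P \<cdot> (Idl (insert g B))" "v \<otimes> g \<ominus> z \<in> J"
    using insert.prems(2)[of g] by auto
  obtain z' p where z': "z' \<in> P \<cdot> (Idl B)" "p \<in> P" "z = z' \<oplus> p \<otimes> g"
    using ideal_prod_Idl_insert[OF Pc(1) B g z(1)] by blast
  have c: "z' \<in> carrier R" "p \<in> carrier R" "v \<in> carrier R" using z' Mc(1) Pi(1) v by auto
  define w where "w = v \<ominus> p"
  have wc: "w \<in> carrier R" unfolding w_def using c by simp
  have "w \<notin> P"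
  proof
    assume "w \<in> P"
    then have "w \<oplus> p \<in> P" using Pi(3)[OF _ z'(2)] by simp
    moreover have "w \<oplus> p = v" unfolding w_def using c by algebra
    ultimately show False using v by simp
  qed
  then have w: "w \<in> carrier R - P" using wc by simp
  have wg: "w \<otimes> g \<ominus> z' \<in> J"
  proof -
    have "w \<otimes> g \<ominus> z' = v \<otimes> g \<ominus> z" unfolding w_def z'(3) using c g by algebra
    then show ?thesis using z(2) by simp
  qed
  have "\<exists>u\<in>carrier R - P. \<forall>a\<in>Idl B. u \<otimes> a \<in> J"
  proof (rule insert.IH[OF B])
    fix b assume b: "b \<in> B"
    then have bc: "b \<in> carrier R" using B by auto
    obtain v' y where v': "v' \<in> carrier R - P" and y: "y \<in> P \<cdot> (Idl (insert g B))" "v' \<otimes> b \<ominus> y \<in> J"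
      using insert.prems(2)[of b] b by auto
    obtain y' q where y': "y' \<in> P \<cdot> (Idl B)" "q \<in> P" "y = y' \<oplus> q \<otimes> g"
      using ideal_prod_Idl_insert[OF Pc(1) B g y(1)] by blast
    have c': "y' \<in> carrier R" "q \<in> carrier R" "v' \<in> carrier R" using y' Mc(1) Pi(1) v' by auto
    have "(w \<otimes> v') \<otimes> b \<ominus> (w \<otimes> y' \<oplus> q \<otimes> z') = w \<otimes> (v' \<otimes> b \<ominus> y) \<oplus> q \<otimes> (w \<otimes> g \<ominus> z')"
      unfolding y'(3) using c c' g wc bc by algebra
    moreover have "\<dots> \<in> J" using Jc(3)[OF Jc(5)[OF y(2) wc] Jc(5)[OF wg c'(2)]] .
    moreover have "w \<otimes> y' \<oplus> q \<otimes> z' \<in> P \<cdot> (Idl B)"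
      using Mc(3)[OF Mc(5)[OF y'(1) wc] Mc(5)[OF z'(1) c'(2)]] .
    ultimately show "\<exists>v\<in>carrier R - P. \<exists>z\<in>P \<cdot> (Idl B). v \<otimes> b \<ominus> z \<in> J"
      using Pc(3)[OF w v'] by (intro bexI[of _ "w \<otimes> v'"] bexI[of _ "w \<otimes> y' \<oplus> q \<otimes> z'"]) auto
  qed
  then obtain u where u: "u \<in> carrier R - P" "\<And>a. a \<in> Idl B \<Longrightarrow> u \<otimes> a \<in> J" by blast
  have uc: "u \<in> carrier R" using u by simp
  have z'B: "z' \<in> Idl B" using ideal_prod_inter[OF Pc(1) IB] z'(1) by auto
  have "(u \<otimes> w) \<otimes> a \<in> J" if "a \<in> Idl (insert g B)" for a
  proof -
    from that obtain b r where a: "a = b \<oplus> r \<otimes> g" "b \<in> Idl B" "r \<in> carrier R"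
      unfolding Idl_insert[OF B g] adjoin_def by blast
    have bc: "b \<in> carrier R" using a Bc(1) by auto
    have "(u \<otimes> w) \<otimes> a = w \<otimes> (u \<otimes> b) \<oplus> ((r \<otimes> u) \<otimes> (w \<otimes> g \<ominus> z') \<oplus> r \<otimes> (u \<otimes> z'))"
      unfolding a using c bc a(3) g wc uc by algebra
    moreover have "\<dots> \<in> J"
      using Jc(5)[OF u(2)[OF a(2)] wc] Jc(5)[OF wg, of "r \<otimes> u"] Jc(5)[OF u(2)[OF z'B] a(3)] a(3) uc
      by (intro Jc(3)) auto
    ultimately show ?thesis by simp
  qed
  then show ?case using Pc(3)[OF u(1) w] by blast
qed

lemma (in noetherian_cring) local_nakayama:
  assumes P: "primeideal P R" and J: "ideal J R" and M: "ideal M R"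
    and gen: "M \<subseteq> saturation P (J <+>\<^bsub>R\<^esub> P \<cdot> M)"
  shows "\<exists>v\<in>carrier R - P. \<forall>a\<in>M. v \<otimes> a \<in> J"
proof -
  obtain A where A: "A \<subseteq> carrier R" "finite A" "M = Idl A" using finetely_gen[OF M] by blast
  have "\<exists>v\<in>carrier R - P. \<forall>a\<in>Idl A. v \<otimes> a \<in> J"
  proof (rule nakayama_generators[OF P J A(2,1)])
    fix a assume "a \<in> A"
    then have "a \<in> M" using genideal_self[OF A(1)] A(3) by auto
    then obtain v j z where v: "v \<in> carrier R - P" "v \<otimes> a = j \<oplus> z" "j \<in> J" "z \<in> P \<cdot> M"
      using gen unfolding saturation_def set_add_def' by blast
    have c: "j \<in> carrier R" "z \<in> carrier R"
      using v(3,4) ideal_closed(1)[OF J] ideal_prod_in_carrier[OF primeideal_closed(1)[OF P] M] by auto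
    have "v \<otimes> a \<ominus> z = j" unfolding v(2) using c by algebra
    then show "\<exists>v\<in>carrier R - P. \<exists>z\<in>P \<cdot> (Idl A). v \<otimes> a \<ominus> z \<in> J"
      using v A(3) by (intro bexI[of _ v] bexI[of _ z]) simp_all
  qed
  then show ?thesis using A(3) by simp
qed


section \<open>Krull's height theorem\<close>

definition (in ring) minimal_prime_over :: "'a set \<Rightarrow> 'a set \<Rightarrow> bool" where
  "minimal_prime_over K P \<longleftrightarrow> primeideal P R \<and> K \<subseteq> P \<and>
     (\<forall>Q. primeideal Q R \<longrightarrow> K \<subseteq> Q \<longrightarrow> Q \<subseteq> P \<longrightarrow> Q = P)"

text \<open>If \<open>P\<close> is minimal over \<open>K\<close>, the local ring \<open>R\<^sub>P/KR\<^sub>P\<close> is artinian. Instead of measuring lengths, take a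
saturated ideal \<open>L \<supseteq> K\<close> that is maximal with the property that the chain \<open>I n \<inter> L\<close> becomes stationary
after localization. If \<open>L\<close> is proper, a maximal \<open>(L : h)\<close> with \<open>h \<notin> L\<close> is a prime between \<open>K\<close> and \<open>P\<close>,
hence equal to \<open>P\<close>. Thus \<open>L + (h)\<close> is a simple extension of \<open>L\<close> over \<open>R\<^sub>P\<close>, and the property passes to it.\<close>

lemma (in noetherian_cring) local_dcc:
  assumes min: "minimal_prime_over K P" and K: "ideal K R"
    and I: "\<And>n::nat. ideal (I n) R" and KI: "\<And>n. K \<subseteq> I n" and dec: "\<And>n. I (Suc n) \<subseteq> I n"
  shows "\<exists>n. I n \<subseteq> saturation P (I (Suc n))"
proof -
  have P: "primeideal P R" using min unfolding minimal_prime_over_def by auto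
  note Pc = primeideal_closed[OF P] and Kc = ideal_closed[OF K] and Ic = ideal_closed[OF I]
  define stable where "stable L \<longleftrightarrow> (\<exists>n\<^sub>0. \<forall>n\<ge>n\<^sub>0. I n \<inter> L \<subseteq> saturation P (I (Suc n)))" for L
  define \<C> where "\<C> = {L. ideal L R \<and> K \<subseteq> L \<and> saturation P L = L \<and> stable L}"
  have stable_sat: "stable (saturation P L)" if L: "ideal L R" and st: "stable L" for L
  proof -
    obtain n\<^sub>0 where n0: "\<And>n. n \<ge> n\<^sub>0 \<Longrightarrow> I n \<inter> L \<subseteq> saturation P (I (Suc n))"
      using st unfolding stable_def by blast
    have "I n \<inter> saturation P L \<subseteq> saturation P (I (Suc n))" if "n \<ge> n\<^sub>0" for n
    proof
      fix a assume a: "a \<in> I n \<inter> saturation P L"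
      then obtain v where v: "v \<in> carrier R - P" "v \<otimes> a \<in> L" and ac: "a \<in> carrier R"
        unfolding saturation_def by blast
      have "v \<otimes> a \<in> I n" using Ic(5) a v(1) by blast
      then have "v \<otimes> a \<in> saturation P (I (Suc n))" using n0[OF that] v(2) by blast
      then have "a \<in> saturation P (saturation P (I (Suc n)))" by (rule saturationI[OF ac v(1)])
      then show "a \<in> saturation P (I (Suc n))" using saturation_ideal(3)[OF P I] by simp
    qed
    then show ?thesis unfolding stable_def by blast
  qed
  have "saturation P K \<in> \<C>"
  proof -
    have "I n \<inter> K \<subseteq> saturation P (I (Suc n))" for n
      using KI[of "Suc n"] saturation_ideal(2)[OF P I, of "Suc n"] by auto
    then have "stable K" unfolding stable_def by blast
    then show ?thesis unfolding \<C>_def using saturation_ideal[OF P K] stable_sat[OF K] by simp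
  qed
  then obtain L where L: "L \<in> \<C>" "\<forall>L'\<in>\<C>. L \<subseteq> L' \<longrightarrow> L' = L"
    using exists_maximal_ideal_in[of \<C> "saturation P K"] unfolding \<C>_def by auto
  have Li: "ideal L R" and KL: "K \<subseteq> L" and satL: "saturation P L = L" and stL: "stable L"
    using L(1) unfolding \<C>_def by auto
  note Lc = ideal_closed[OF Li]
  have "\<one> \<in> L"
  proof (rule ccontr)
    assume "\<one> \<notin> L"
    then obtain h where h: "maximal_colon L h" using exists_maximal_colon[OF Li, of \<one>] by auto
    have hc: "h \<in> carrier R" "h \<notin> L" using h unfolding maximal_colon_def by auto
    have Q: "primeideal (colon L h) R" using maximal_colon_prime[OF Li h] .
    have "K \<subseteq> colon L h" using KL colon_ideal(2)[OF Li hc(1)] by simp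
    moreover have "colon L h \<subseteq> P"
    proof
      fix a assume "a \<in> colon L h"
      then have a: "a \<in> carrier R" "a \<otimes> h \<in> L" unfolding colon_def by auto
      show "a \<in> P"
      proof (rule ccontr)
        assume "a \<notin> P"
        then have "h \<in> saturation P L" using saturationI[of h a P L] a hc(1) by simp
        then show False using satL hc(2) by simp
      qed
    qed
    ultimately have QP: "colon L h = P"
      using min Q unfolding minimal_prime_over_def by blast
    note adj = adjoin_ideal[OF Li hc(1)]
    obtain n\<^sub>0 where n0: "\<And>n. n \<ge> n\<^sub>0 \<Longrightarrow> I n \<inter> L \<subseteq> saturation P (I (Suc n))"
      using stL unfolding stable_def by blast
    \<comment> \<open>\<open>T n\<close> says that \<open>I n\<close> hits the simple quotient \<open>(L + (h))/L\<close> over \<open>R\<^sub>P\<close>. Since the chain decreases,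
      this holds for all \<open>n\<close> or fails from some point on.\<close>
    define T where "T n \<longleftrightarrow> (\<exists>v\<in>carrier R - P. \<exists>c\<in>L. c \<oplus> v \<otimes> h \<in> I n)" for n
    have Tdec: "T m" if "T n" "m \<le> n" for m n
    proof -
      have "I n \<subseteq> I m" using lift_Suc_antimono_le[of I, OF dec that(2)] .
      then show ?thesis using that(1) unfolding T_def by blast
    qed
    have "stable (adjoin L h)"
    proof (cases "\<forall>n. T n")
      case True
      have "I n \<inter> adjoin L h \<subseteq> saturation P (I (Suc n))" if n: "n \<ge> n\<^sub>0" for n
      proof
        fix a assume a: "a \<in> I n \<inter> adjoin L h"
        then obtain c b where cb: "a = c \<oplus> b \<otimes> h" "c \<in> L" "b \<in> carrier R"
          unfolding adjoin_def by blast
        obtain v c' where v: "v \<in> carrier R - P" "c' \<in> L" "c' \<oplus> v \<otimes> h \<in> I (Suc n)"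
          using True unfolding T_def by blast
        have c: "c \<in> carrier R" "c' \<in> carrier R" "v \<in> carrier R" "a \<in> carrier R"
          using cb v Lc(1) hc(1) by auto
        define d where "d = b \<otimes> (c' \<oplus> v \<otimes> h)"
        have d: "d \<in> I (Suc n)" unfolding d_def using Ic(5)[OF v(3) cb(3)] .
        have "v \<otimes> a \<ominus> d = v \<otimes> c \<ominus> b \<otimes> c'"
          unfolding cb(1) d_def using c cb(3) hc(1) by algebra
        moreover have "v \<otimes> c \<ominus> b \<otimes> c' \<in> L"
          using Lc(4)[OF Lc(5)[OF cb(2) c(3)] Lc(5)[OF v(2) cb(3)]] .
        moreover have "v \<otimes> a \<ominus> d \<in> I n"
          using Ic(4)[OF Ic(5)[of a n v] _] a c(3) d dec by blast
        ultimately have "v \<otimes> a \<ominus> d \<in> saturation P (I (Suc n))" using n0[OF n] by auto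
        moreover have "d \<in> saturation P (I (Suc n))" using saturation_ideal(2)[OF P I] d by blast
        ultimately have "(v \<otimes> a \<ominus> d) \<oplus> d \<in> saturation P (I (Suc n))"
          using ideal_closed(3)[OF saturation_ideal(1)[OF P I]] by blast
        moreover have "(v \<otimes> a \<ominus> d) \<oplus> d = v \<otimes> a"
          using c Ic(1) d by (metis a_minus_def add.inv_solve_right' local.minus_closed m_closed subsetD)
        ultimately have "a \<in> saturation P (saturation P (I (Suc n)))" using saturationI[OF c(4) v(1)] by simp
        then show "a \<in> saturation P (I (Suc n))" using saturation_ideal(3)[OF P I] by simp
      qed
      then show ?thesis unfolding stable_def by blast
    next
      case False
      then obtain m where m: "\<not> T m" by blast
      have "I n \<inter> adjoin L h \<subseteq> saturation P (I (Suc n))" if n: "n \<ge> max n\<^sub>0 m" for n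
      proof
        fix a assume a: "a \<in> I n \<inter> adjoin L h"
        then obtain c b where cb: "a = c \<oplus> b \<otimes> h" "c \<in> L" "b \<in> carrier R"
          unfolding adjoin_def by blast
        have "b \<in> P"
        proof (rule ccontr)
          assume "b \<notin> P"
          then have "T n" unfolding T_def using a cb by blast
          then show False using m Tdec n by auto
        qed
        then have "b \<otimes> h \<in> L" using QP unfolding colon_def by auto
        then have "a \<in> L" using cb Lc(3) by blast
        then show "a \<in> saturation P (I (Suc n))" using n0[of n] n a by auto
      qed
      then show ?thesis unfolding stable_def by blast
    qed
    then have "saturation P (adjoin L h) \<in> \<C>"
      unfolding \<C>_def using saturation_ideal[OF P adj(1)] stable_sat[OF adj(1)] KL adj(2) by auto
    then have "saturation P (adjoin L h) = L" using L(2) saturation_ideal(2)[OF P adj(1)] adj(2) by auto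
    then show False using saturation_ideal(2)[OF P adj(1)] adj(3) hc(2) by auto
  qed
  then have "L = carrier R" using ideal_eq_carrier_iff[OF Li] by simp
  moreover obtain n where "I n \<inter> L \<subseteq> saturation P (I (Suc n))" using stL unfolding stable_def by blast
  ultimately show ?thesis using Ic(1)[of n] by (intro exI[of _ n]) auto
qed

primrec (in ring) ideal_power :: "'a set \<Rightarrow> nat \<Rightarrow> 'a set" where
  "ideal_power P 0 = carrier R"
| "ideal_power P (Suc n) = P \<cdot> ideal_power P n"

lemma (in cring) ideal_power_ideal: "ideal P R \<Longrightarrow> ideal (ideal_power P n) R"
  by (induction n) (auto intro: oneideal ideal_prod_is_ideal)

lemma (in cring) power_in_ideal_power:
  assumes "ideal P R" "x \<in> P" shows "x [^] (n::nat) \<in> ideal_power P n"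
proof (induction n)
  case (Suc n)
  then have "x \<otimes> x [^] n \<in> ideal_power P (Suc n)" using assms ideal_prod.prod by auto
  moreover have "x \<in> carrier R" using assms ideal_closed(1) by blast
  ultimately show ?case by (simp add: m_comm)
qed simp

lemma (in cring) ideal_sum:
  assumes I: "ideal I R" and J: "ideal J R"
  shows "ideal (I <+>\<^bsub>R\<^esub> J) R" "I \<subseteq> I <+>\<^bsub>R\<^esub> J" "J \<subseteq> I <+>\<^bsub>R\<^esub> J"
    "\<And>K. ideal K R \<Longrightarrow> I \<subseteq> K \<Longrightarrow> J \<subseteq> K \<Longrightarrow> I <+>\<^bsub>R\<^esub> J \<subseteq> K"
proof -
  note Ic = ideal_closed[OF I] and Jc = ideal_closed[OF J]
  show "ideal (I <+>\<^bsub>R\<^esub> J) R" by (rule add_ideals[OF I J])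
  show "I \<subseteq> I <+>\<^bsub>R\<^esub> J"
  proof
    fix a assume a: "a \<in> I"
    then have "a = a \<oplus> \<zero>" using Ic(1) by auto
    then show "a \<in> I <+>\<^bsub>R\<^esub> J" using a Jc(2) unfolding set_add_def' by blast
  qed
  show "J \<subseteq> I <+>\<^bsub>R\<^esub> J"
  proof
    fix a assume a: "a \<in> J"
    then have "a = \<zero> \<oplus> a" using Jc(1) by auto
    then show "a \<in> I <+>\<^bsub>R\<^esub> J" using a Ic(2) unfolding set_add_def' by blast
  qed
  show "I <+>\<^bsub>R\<^esub> J \<subseteq> K" if "ideal K R" "I \<subseteq> K" "J \<subseteq> K" for K
    using that ideal_closed(3)[OF that(1)] unfolding set_add_def' by blast
qed

text \<open>This contains Krull's principal ideal theorem. If no such \<open>q\<close> exists, then \<open>p\<^sub>2\<close> is minimal over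
\<open>p\<^sub>0 + (x)\<close> and \<open>x \<notin> p\<^sub>1\<close>. By the descending chain condition the symbolic powers of \<open>p\<^sub>1\<close> modulo \<open>p\<^sub>0\<close>
become stationary up to multiples of \<open>x\<close>, so by Nakayama at \<open>p\<^sub>2\<close> they become stationary. Nakayama
at \<open>p\<^sub>1\<close> then shows that some power of \<open>p\<^sub>1\<close> vanishes locally modulo \<open>p\<^sub>0\<close>, which contradicts
\<open>p\<^sub>0 \<subset> p\<^sub>1\<close>.\<close>

lemma (in noetherian_cring) krull_exchange:
  assumes p: "primeideal p\<^sub>0 R" "primeideal p\<^sub>1 R" "primeideal p\<^sub>2 R"
    and sub: "p\<^sub>0 \<subset> p\<^sub>1" "p\<^sub>1 \<subset> p\<^sub>2" and x: "x \<in> p\<^sub>2"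
  shows "\<exists>q. primeideal q R \<and> x \<in> q \<and> p\<^sub>0 \<subset> q \<and> q \<subset> p\<^sub>2"
proof (rule ccontr)
  assume no: "\<not> ?thesis"
  note p0 = primeideal_closed[OF p(1)] and p1 = primeideal_closed[OF p(2)]
    and p2 = primeideal_closed[OF p(3)]
  note p0i = ideal_closed[OF p0(1)] and p1i = ideal_closed[OF p1(1)] and p2i = ideal_closed[OF p2(1)]
  have x1: "x \<notin> p\<^sub>1" using no p(2) sub by blast
  have xc: "x \<in> carrier R" using x p2i(1) by auto
  note adj = adjoin_ideal[OF p0(1) xc]
  have min: "minimal_prime_over (adjoin p\<^sub>0 x) p\<^sub>2"
    unfolding minimal_prime_over_def
  proof (intro conjI allI impI)
    show "adjoin p\<^sub>0 x \<subseteq> p\<^sub>2" using adjoin_minimal[OF p2(1)] sub x by blast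
    fix Q assume Q: "primeideal Q R" "adjoin p\<^sub>0 x \<subseteq> Q" "Q \<subseteq> p\<^sub>2"
    show "Q = p\<^sub>2"
    proof (rule ccontr)
      assume "Q \<noteq> p\<^sub>2"
      moreover have "x \<in> Q" "p\<^sub>0 \<subseteq> Q" using Q(2) adj(2,3) by auto
      moreover have "x \<notin> p\<^sub>0" using x1 sub by auto
      ultimately show False using no Q(1,3) by blast
    qed
  qed (fact p)
  \<comment> \<open>The symbolic powers of \<open>p\<^sub>1\<close> modulo \<open>p\<^sub>0\<close>. Being saturated at \<open>p\<^sub>1\<close>, they allow cancelling \<open>x \<notin> p\<^sub>1\<close>.\<close>
  define sym where "sym n = saturation p\<^sub>1 (p\<^sub>0 <+>\<^bsub>R\<^esub> ideal_power p\<^sub>1 n)" for n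
  have pw: "ideal (ideal_power p\<^sub>1 n) R" for n using ideal_power_ideal[OF p1(1)] .
  note s0 = ideal_sum[OF p0(1) pw]
  note sym = saturation_ideal[OF p(2) s0(1), folded sym_def]
  have symp: "primeideal p\<^sub>1 R" by (fact p)
  have symdec: "sym (Suc n) \<subseteq> sym n" for n
  proof -
    have "ideal_power p\<^sub>1 (Suc n) \<subseteq> ideal_power p\<^sub>1 n"
      using ideal_prod_inter[OF p1(1) pw[of n]] by simp
    then have "p\<^sub>0 <+>\<^bsub>R\<^esub> ideal_power p\<^sub>1 (Suc n) \<subseteq> p\<^sub>0 <+>\<^bsub>R\<^esub> ideal_power p\<^sub>1 n"
      unfolding set_add_def' by blast
    then show ?thesis unfolding sym_def by (rule saturation_mono)
  qed
  note symc = ideal_closed[OF sym(1)]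
  have p0sym: "p\<^sub>0 \<subseteq> sym n" for n using s0(2) sym(2) by blast
  note adjs = adjoin_ideal[OF sym(1) xc]
  have "\<exists>n. adjoin (sym n) x \<subseteq> saturation p\<^sub>2 (adjoin (sym (Suc n)) x)"
  proof (rule local_dcc[OF min adj(1) adjs(1)])
    show "adjoin p\<^sub>0 x \<subseteq> adjoin (sym n) x" for n
      using adjoin_minimal[OF adjs(1)[of n]] p0sym adjs(2,3) by blast
    show "adjoin (sym (Suc n)) x \<subseteq> adjoin (sym n) x" for n
      using adjoin_minimal[OF adjs(1)[of n]] symdec adjs(2,3) by blast
  qed
  then obtain n where n: "adjoin (sym n) x \<subseteq> saturation p\<^sub>2 (adjoin (sym (Suc n)) x)" by blast
  have "sym n \<subseteq> saturation p\<^sub>2 (sym (Suc n) <+>\<^bsub>R\<^esub> p\<^sub>2 \<cdot> sym n)"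
  proof
    fix a assume a: "a \<in> sym n"
    then have "a \<in> saturation p\<^sub>2 (adjoin (sym (Suc n)) x)" using n adjs(2) by blast
    then obtain v b r where v: "v \<in> carrier R - p\<^sub>2" "v \<otimes> a = b \<oplus> r \<otimes> x" "b \<in> sym (Suc n)" "r \<in> carrier R"
      and ac: "a \<in> carrier R"
      unfolding saturation_def adjoin_def by blast
    have c: "b \<in> carrier R" "v \<in> carrier R" using v symc(1) by auto
    have "x \<otimes> r = v \<otimes> a \<ominus> b" unfolding v(2) using c v xc by algebra
    moreover have "v \<otimes> a \<ominus> b \<in> sym n"
      using symc(4)[OF symc(5)[OF a c(2)] subsetD[OF symdec v(3)]] .
    ultimately have "x \<otimes> r \<in> sym n" by simp
    then have "r \<in> saturation p\<^sub>1 (sym n)" using saturationI[of r x p\<^sub>1 "sym n"] x1 xc v(4) by simp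
    then have "r \<in> sym n" using sym(3)[of n] by simp
    then have "x \<otimes> r \<in> p\<^sub>2 \<cdot> sym n" by (rule ideal_prod.prod[OF x])
    then have "r \<otimes> x \<in> p\<^sub>2 \<cdot> sym n" using m_comm xc v(4) by simp
    then have "v \<otimes> a \<in> sym (Suc n) <+>\<^bsub>R\<^esub> p\<^sub>2 \<cdot> sym n"
      unfolding v(2) set_add_def' using v(3) by blast
    then show "a \<in> saturation p\<^sub>2 (sym (Suc n) <+>\<^bsub>R\<^esub> p\<^sub>2 \<cdot> sym n)" by (rule saturationI[OF ac v(1)])
  qed
  from local_nakayama[OF p(3) sym(1) sym(1) this]
  obtain v where v: "v \<in> carrier R - p\<^sub>2" "\<And>a. a \<in> sym n \<Longrightarrow> v \<otimes> a \<in> sym (Suc n)"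
    by auto
  have "sym n \<subseteq> sym (Suc n)"
  proof
    fix a assume a: "a \<in> sym n"
    have "v \<in> carrier R - p\<^sub>1" using v(1) sub by auto
    then have "a \<in> saturation p\<^sub>1 (sym (Suc n))" using saturationI[of a v p\<^sub>1 "sym (Suc n)"] v(2)[OF a] a symc(1) by auto
    then show "a \<in> sym (Suc n)" using sym(3)[of "Suc n"] by simp
  qed
  then have "ideal_power p\<^sub>1 n \<subseteq> saturation p\<^sub>1 (p\<^sub>0 <+>\<^bsub>R\<^esub> p\<^sub>1 \<cdot> ideal_power p\<^sub>1 n)"
    using s0(3)[of n] sym(2)[of n] unfolding sym_def[of "Suc n"] by auto
  from local_nakayama[OF p(2) p0(1) pw this]
  obtain w where w: "w \<in> carrier R - p\<^sub>1" "\<And>a. a \<in> ideal_power p\<^sub>1 n \<Longrightarrow> w \<otimes> a \<in> p\<^sub>0"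
    by auto
  obtain z where z: "z \<in> p\<^sub>1" "z \<notin> p\<^sub>0" using sub by blast
  have zc: "z \<in> carrier R - p\<^sub>0" using z p1i(1) by auto
  have "w \<otimes> z [^] n \<in> p\<^sub>0" using w(2) power_in_ideal_power[OF p1(1) z(1)] by blast
  moreover have "z [^] n \<in> carrier R - p\<^sub>0"
  proof (induction n)
    case 0
    then show ?case using p0(2) by simp
  next
    case (Suc n)
    then show ?case using p0(3)[OF Suc zc] by simp
  qed
  ultimately show False using p0(3)[of w "z [^] n"] w(1) sub by blast
qed

inductive (in ring) prime_chain :: "'a set \<Rightarrow> nat \<Rightarrow> 'a set \<Rightarrow> bool" where
  prime_chain_refl: "primeideal P R \<Longrightarrow> prime_chain P 0 P"
| prime_chain_step: "prime_chain p n P \<Longrightarrow> P \<subset> Q \<Longrightarrow> primeideal Q R \<Longrightarrow> prime_chain p (Suc n) Q"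

lemma (in ring) prime_chain_prime:
  assumes "prime_chain p n P" shows "primeideal p R" "primeideal P R" "p \<subseteq> P"
  using assms by (induction) auto

lemma (in ring) prime_chain_SucE:
  assumes "prime_chain p (Suc n) Q"
  obtains P where "prime_chain p n P" "P \<subset> Q" "primeideal Q R"
  using assms by (cases rule: prime_chain.cases) auto

text \<open>An element of the top of a chain can be pushed down one step at a time until it lies in every
member, at the cost of the bottom member.\<close>

lemma (in noetherian_cring) prime_chain_exchange:
  assumes "prime_chain p (Suc n) P" "x \<in> P"
  shows "\<exists>q. x \<in> q \<and> p \<subseteq> q \<and> prime_chain q n P"
  using assms
proof (induction n arbitrary: P)
  case 0
  then have "primeideal P R" "p \<subseteq> P" using prime_chain_prime by blast+
  then show ?case using 0(2) prime_chain_refl by blast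
next
  case (Suc n)
  obtain P1 where P1: "prime_chain p (Suc n) P1" "P1 \<subset> P" "primeideal P R"
    using Suc.prems(1) by (rule prime_chain_SucE)
  obtain P0 where P0: "prime_chain p n P0" "P0 \<subset> P1" "primeideal P1 R"
    using P1(1) by (rule prime_chain_SucE)
  obtain q where q: "primeideal q R" "x \<in> q" "P0 \<subset> q" "q \<subset> P"
    using krull_exchange[OF prime_chain_prime(2)[OF P0(1)] P0(3) P1(3) P0(2) P1(2) Suc.prems(2)] by blast
  have "prime_chain p (Suc n) q" using prime_chain_step[OF P0(1) q(3,1)] .
  then obtain q' where "x \<in> q'" "p \<subseteq> q'" "prime_chain q' n q" using Suc.IH q(2) by blast
  then show ?case using prime_chain_step[OF _ q(4) P1(3)] by blast
qed

text \<open>Krull's height theorem: each exchange uses up one generator and one step of the chain.\<close>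

lemma (in noetherian_cring) prime_chain_length_le:
  assumes "prime_chain p n P" "set xs \<subseteq> P"
    and "\<And>Q. primeideal Q R \<Longrightarrow> p \<union> set xs \<subseteq> Q \<Longrightarrow> P \<subseteq> Q"
  shows "n \<le> length xs"
  using assms
proof (induction xs arbitrary: p n)
  case Nil
  have "P \<subseteq> p" using Nil(3)[OF prime_chain_prime(1)[OF Nil(1)]] by simp
  show ?case
  proof (cases n)
    case (Suc m)
    then obtain P' where "prime_chain p m P'" "P' \<subset> P"
      using prime_chain_SucE[of p m P] Nil(1) Suc by blast
    then show ?thesis using prime_chain_prime(3)[of p m P'] \<open>P \<subseteq> p\<close> by auto
  qed simp
next
  case (Cons x xs)
  show ?case
  proof (cases n)
    case (Suc m)
    obtain q where q: "x \<in> q" "p \<subseteq> q" "prime_chain q m P"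
      using prime_chain_exchange[of p m P x] Cons.prems(1,2) Suc by auto
    have "m \<le> length xs"
    proof (rule Cons.IH[OF q(3)])
      show "set xs \<subseteq> P" using Cons.prems(2) by simp
      show "P \<subseteq> Q" if "primeideal Q R" "q \<union> set xs \<subseteq> Q" for Q
        using Cons.prems(3)[OF that(1)] that(2) q(1,2) by auto
    qed
    then show ?thesis using Suc by simp
  qed simp
qed

section \<open>Regular sequences in local rings\<close>

sublocale noetherian_local_ring \<subseteq> noetherian_cring R ..

lemma (in cring) exists_avoiding_prime:
  assumes "finite \<Q>" "primeideal P R" "ideal I R" "\<not> I \<subseteq> P"
    and "\<And>Q. Q \<in> \<Q> \<Longrightarrow> ideal Q R" "\<And>Q. Q \<in> \<Q> \<Longrightarrow> \<not> Q \<subseteq> P"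
  shows "\<exists>w\<in>I. w \<notin> P \<and> (\<forall>Q\<in>\<Q>. w \<in> Q)"
  using assms
proof (induction \<Q>)
  case empty
  then show ?case by auto
next
  case (insert Q \<Q>)
  note Ic = ideal_closed[OF insert.prems(2)]
  have Q: "ideal Q R" using insert.prems by auto
  note Qc = ideal_closed[OF Q]
  obtain w where w: "w \<in> I" "w \<notin> P" "\<forall>Q\<in>\<Q>. w \<in> Q"
    using insert.IH[OF insert.prems(1,2,3)] insert.prems(4,5) by auto
  obtain q where q: "q \<in> Q" "q \<notin> P" using insert.prems(5)[of Q] by auto
  have c: "q \<in> carrier R" "w \<in> carrier R" using q w Ic(1) Qc(1) by auto
  have "w \<otimes> q \<in> Q'" if "Q' \<in> \<Q>" for Q'
  proof -
    have "ideal Q' R" using insert.prems(4) that by simp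
    then show ?thesis using ideal_closed(6)[of Q' w q] w(3) that c by simp
  qed
  moreover have "w \<otimes> q \<notin> P" using primeideal_closed(3)[OF insert.prems(1), of w q] w q c by auto
  ultimately show ?case using Ic(6)[OF w(1) c(1)] Qc(5)[OF q(1) c(2)] by auto
qed

text \<open>The primes are treated one after the other. If \<open>y + z\<close> avoids the earlier primes but lies in \<open>P\<close>, add an
element of \<open>I\<close> that lies in all earlier primes but not in \<open>P\<close>; incomparability of the primes
guarantees that it exists.\<close>

lemma (in cring) prime_avoidance_coset:
  assumes "finite \<P>" "ideal I R" "y \<in> carrier R"
    and "\<And>P. P \<in> \<P> \<Longrightarrow> primeideal P R" "\<And>P. P \<in> \<P> \<Longrightarrow> \<not> I \<subseteq> P"
    and "\<And>P Q. P \<in> \<P> \<Longrightarrow> Q \<in> \<P> \<Longrightarrow> Q \<subseteq> P \<Longrightarrow> Q = P"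
  shows "\<exists>z\<in>I. \<forall>P\<in>\<P>. y \<oplus> z \<notin> P"
  using assms
proof (induction \<P>)
  case empty
  then show ?case using ideal_closed(2) by auto
next
  case (insert P \<P>)
  note Ic = ideal_closed[OF insert.prems(1)]
  have P: "primeideal P R" using insert.prems by auto
  note Pc = ideal_closed[OF primeideal_closed(1)[OF P]]
  have "\<exists>z\<in>I. \<forall>P\<in>\<P>. y \<oplus> z \<notin> P"
  proof (rule insert.IH[OF insert.prems(1,2)])
    fix P' assume "P' \<in> \<P>"
    then have P': "P' \<in> insert P \<P>" by simp
    show "primeideal P' R" "\<not> I \<subseteq> P'" using insert.prems(3,4)[OF P'] by auto
    fix Q assume "Q \<in> \<P>" "Q \<subseteq> P'"
    then show "Q = P'" using insert.prems(5)[OF P', of Q] by simp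
  qed
  then obtain z where z: "z \<in> I" "\<forall>P\<in>\<P>. y \<oplus> z \<notin> P" by blast
  have zc: "z \<in> carrier R" using z Ic(1) by auto
  show ?case
  proof (cases "y \<oplus> z \<in> P")
    case False
    then show ?thesis using z by auto
  next
    case True
    have "\<exists>w\<in>I. w \<notin> P \<and> (\<forall>Q\<in>\<P>. w \<in> Q)"
    proof (rule exists_avoiding_prime[OF insert.hyps(1) P insert.prems(1)])
      show "\<not> I \<subseteq> P" using insert.prems by auto
      show "ideal Q R" if "Q \<in> \<P>" for Q using insert.prems(3) that primeideal_closed(1) by auto
      show "\<not> Q \<subseteq> P" if "Q \<in> \<P>" for Q using insert.prems(5)[of P Q] that insert.hyps(2) by auto
    qed
    then obtain w where w: "w \<in> I" "w \<notin> P" "\<forall>Q\<in>\<P>. w \<in> Q" by blast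
    have wc: "w \<in> carrier R" using w Ic(1) by auto
    have "y \<oplus> (z \<oplus> w) \<notin> P"
    proof
      assume "y \<oplus> (z \<oplus> w) \<in> P"
      then have "(y \<oplus> (z \<oplus> w)) \<ominus> (y \<oplus> z) \<in> P" using Pc(4) True by blast
      moreover have "(y \<oplus> (z \<oplus> w)) \<ominus> (y \<oplus> z) = w" using insert.prems(2) zc wc by algebra
      ultimately show False using w(2) by simp
    qed
    moreover have "y \<oplus> (z \<oplus> w) \<notin> Q" if Q: "Q \<in> \<P>" for Q
    proof
      assume "y \<oplus> (z \<oplus> w) \<in> Q"
      moreover have "ideal Q R" using insert.prems(3) Q primeideal_closed(1) by auto
      ultimately have "(y \<oplus> (z \<oplus> w)) \<ominus> w \<in> Q" using ideal_closed(4) w(3) Q by blast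
      moreover have "(y \<oplus> (z \<oplus> w)) \<ominus> w = y \<oplus> z" using insert.prems(2) zc wc by algebra
      ultimately show False using z(2) Q by simp
    qed
    ultimately show ?thesis using Ic(3)[OF z(1) w(1)] by auto
  qed
qed

text \<open>The ideal generated by all \<open>h\<close> with maximal \<open>(J : h)\<close> is already generated by a finite set \<open>G\<close> of
them. For any such \<open>h\<close>, an element in all \<open>(J : g)\<close> with \<open>g \<in> G\<close> annihilates \<open>h\<close> modulo \<open>J\<close>; so the prime
\<open>(J : h)\<close> contains the intersection of the \<open>(J : g)\<close>, hence one of them, and equals it by
maximality.\<close>

lemma (in noetherian_cring) finite_maximal_colons:
  assumes J: "ideal J R"
  shows "\<exists>G. finite G \<and> (\<forall>g\<in>G. maximal_colon J g) \<and>
    (\<forall>h. maximal_colon J h \<longrightarrow> (\<exists>g\<in>G. colon J h = colon J g))"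
proof -
  define \<C> where "\<C> = {Idl G |G. finite G \<and> (\<forall>g\<in>G. maximal_colon J g)}"
  have carr: "G \<subseteq> carrier R" if "\<forall>g\<in>G. maximal_colon J g" for G
    using that unfolding maximal_colon_def by auto
  have idC: "ideal K R" if "K \<in> \<C>" for K
    using that genideal_ideal carr unfolding \<C>_def by blast
  have "Idl {} \<in> \<C>" unfolding \<C>_def by blast
  from exists_maximal_ideal_in[OF idC this]
  obtain L where L: "L \<in> \<C>" "\<forall>K\<in>\<C>. L \<subseteq> K \<longrightarrow> K = L" by auto
  obtain G where G: "L = Idl G" "finite G" "\<forall>g\<in>G. maximal_colon J g"
    using L(1) unfolding \<C>_def by blast
  have "\<exists>g\<in>G. colon J h = colon J g" if h: "maximal_colon J h" for h
  proof (rule ccontr)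
    assume no: "\<not> ?thesis"
    have hc: "h \<in> carrier R" "h \<notin> J" using h unfolding maximal_colon_def by auto
    have hG: "\<forall>g\<in>insert h G. maximal_colon J g" using G(3) h by simp
    have "Idl (insert h G) \<in> \<C>" unfolding \<C>_def using G(2) hG by blast
    moreover have "L \<subseteq> Idl (insert h G)"
      unfolding G(1) by (rule subset_Idl_subset[OF carr[OF hG]]) auto
    ultimately have "h \<in> Idl G" using L(2) genideal_self[OF carr[OF hG]] G(1) by auto
    have "\<exists>w\<in>carrier R. w \<notin> colon J h \<and> (\<forall>Q\<in>colon J ` G. w \<in> Q)"
    proof (rule exists_avoiding_prime)
      show "finite (colon J ` G)" using G(2) by simp
      show "primeideal (colon J h) R" by (rule maximal_colon_prime[OF J h])
      show "ideal (carrier R) R" by (rule oneideal)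
      show "\<not> carrier R \<subseteq> colon J h"
        using primeideal_closed(2)[OF maximal_colon_prime[OF J h]] by auto
      fix Q assume "Q \<in> colon J ` G"
      then obtain g where g: "g \<in> G" "Q = colon J g" by blast
      then have gm: "maximal_colon J g" using G(3) by simp
      then have gc: "g \<in> carrier R" unfolding maximal_colon_def by simp
      show "ideal Q R" unfolding g(2) by (rule colon_ideal(1)[OF J gc])
      show "\<not> Q \<subseteq> colon J h"
        using gm hc no g unfolding maximal_colon_def by blast
    qed
    then obtain w where w: "w \<in> carrier R" "w \<notin> colon J h" "\<forall>g\<in>G. w \<in> colon J g" by blast
    have "G \<subseteq> colon J w"
    proof
      fix g assume g: "g \<in> G"
      then have "g \<in> carrier R" using carr[OF G(3)] by auto
      moreover have "w \<otimes> g \<in> J" using w(3) g unfolding colon_def by auto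
      ultimately show "g \<in> colon J w" unfolding colon_def using w(1) by (simp add: m_comm)
    qed
    then have "Idl G \<subseteq> colon J w" by (rule genideal_minimal[OF colon_ideal(1)[OF J w(1)]])
    then have "h \<otimes> w \<in> J" using \<open>h \<in> Idl G\<close> unfolding colon_def by auto
    then show False using w(1,2) hc(1) unfolding colon_def by (simp add: m_comm)
  qed
  then show ?thesis using G(2,3) by blast
qed

context noetherian_local_ring
begin

lemma prime_m: "primeideal \<mm> R"
  using maximalideal_prime[OF maximal] .

lemma ideal_m: "ideal \<mm> R" and one_notin_m: "\<one> \<notin> \<mm>" and m_subset: "\<mm> \<subseteq> carrier R"
  using primeideal_closed[OF prime_m] ideal_closed(1) by auto

lemma proper_ideal_subset_m:
  assumes J: "ideal J R" "\<one> \<notin> J"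
  shows "J \<subseteq> \<mm>"
proof -
  define \<C> where "\<C> = {K. ideal K R \<and> \<one> \<notin> K}"
  have "J \<in> \<C>" unfolding \<C>_def using J by simp
  then obtain L where L: "L \<in> \<C>" "J \<subseteq> L" "\<forall>K\<in>\<C>. L \<subseteq> K \<longrightarrow> K = L"
    using exists_maximal_ideal_in[of \<C> J] unfolding \<C>_def by auto
  have "maximalideal L R"
  proof (rule maximalidealI)
    show "ideal L R" "carrier R \<noteq> L" using L(1) unfolding \<C>_def by auto
    show "K = L \<or> K = carrier R" if "ideal K R" "L \<subseteq> K" "K \<subseteq> carrier R" for K
      using L(3) that ideal_eq_carrier_iff[OF that(1)] unfolding \<C>_def by auto
  qed
  then show ?thesis using unique_maximal L(2) by blast
qed

lemma invertible_outside_m: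
  assumes a: "a \<in> carrier R" "a \<notin> \<mm>"
  shows "\<exists>b\<in>carrier R. b \<otimes> a = \<one>"
proof -
  note adj = adjoin_ideal[OF zeroideal a(1)]
  have "\<one> \<in> adjoin {\<zero>} a" using proper_ideal_subset_m[OF adj(1)] adj(3) a(2) by blast
  then obtain b where "\<one> = \<zero> \<oplus> b \<otimes> a" "b \<in> carrier R" unfolding adjoin_def by blast
  then show ?thesis using a(1) by (intro bexI[of _ b]) simp_all
qed

lemma nakayama:
  assumes J: "ideal J R" and M: "ideal M R" and sub: "M \<subseteq> J <+>\<^bsub>R\<^esub> \<mm> \<cdot> M"
  shows "M \<subseteq> J"
proof
  fix a assume a: "a \<in> M"
  have "M \<subseteq> saturation \<mm> (J <+>\<^bsub>R\<^esub> \<mm> \<cdot> M)"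
    using sub saturation_ideal(2)[OF prime_m ideal_sum(1)[OF J ideal_prod_is_ideal[OF ideal_m M]]] by simp
  from local_nakayama[OF prime_m J M this]
  obtain v where v: "v \<in> carrier R - \<mm>" "\<And>a. a \<in> M \<Longrightarrow> v \<otimes> a \<in> J" by auto
  obtain b where b: "b \<in> carrier R" "b \<otimes> v = \<one>" using invertible_outside_m v(1) by auto
  have ac: "a \<in> carrier R" using ideal_closed(1)[OF M] a by auto
  have "b \<otimes> (v \<otimes> a) \<in> J" using ideal_closed(5)[OF J v(2)[OF a] b(1)] .
  moreover have "b \<otimes> (v \<otimes> a) = (b \<otimes> v) \<otimes> a" using b(1) v(1) ac by (simp add: m_assoc)
  ultimately show "a \<in> J" using b(2) ac by simp
qed

text \<open>The class of \<open>s\<close> is a nonzero element of the socle of \<open>R/J\<close>.\<close>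

definition socle_element :: "'a set \<Rightarrow> 'a \<Rightarrow> bool" where
  "socle_element J s \<longleftrightarrow> s \<in> carrier R \<and> s \<notin> J \<and> (\<forall>a\<in>\<mm>. a \<otimes> s \<in> J)"

definition nonzerodivisor_mod :: "'a set \<Rightarrow> 'a \<Rightarrow> bool" where
  "nonzerodivisor_mod J x \<longleftrightarrow> (\<forall>a\<in>carrier R. x \<otimes> a \<in> J \<longrightarrow> a \<in> J)"

text \<open>The zero divisors modulo \<open>J\<close> form a finite union of primes \<open>(J : g)\<close>. None of them is \<open>\<mm>\<close>, because \<open>g\<close>
would be a socle element. Nakayama provides \<open>y \<in> \<mm>\<close> outside \<open>J + \<mm>\<^sup>2\<close>, and prime avoidance moves \<open>y\<close>
within its coset modulo \<open>\<mm>\<^sup>2\<close> away from the zero divisors.\<close>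

lemma exists_regular_element:
  assumes J: "ideal J R" "\<one> \<notin> J" and no: "\<And>s. \<not> socle_element J s"
  shows "\<exists>x\<in>\<mm>. x \<notin> J <+>\<^bsub>R\<^esub> \<mm> \<cdot> \<mm> \<and> nonzerodivisor_mod J x"
proof -
  note mm = ideal_prod_is_ideal[OF ideal_m ideal_m]
  note s = ideal_sum[OF J(1) mm]
  have "\<not> \<mm> \<subseteq> J"
  proof
    assume sub: "\<mm> \<subseteq> J"
    have "a \<otimes> \<one> \<in> J" if "a \<in> \<mm>" for a
    proof -
      have "a \<in> carrier R" "a \<in> J" using that sub m_subset by auto
      then show ?thesis by simp
    qed
    then show False using no[of \<one>] J(2) unfolding socle_element_def by simp
  qed
  then have "\<not> \<mm> \<subseteq> J <+>\<^bsub>R\<^esub> \<mm> \<cdot> \<mm>" using nakayama[OF J(1) ideal_m] by blast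
  then obtain y where y: "y \<in> \<mm>" "y \<notin> J <+>\<^bsub>R\<^esub> \<mm> \<cdot> \<mm>" by blast
  have yc: "y \<in> carrier R" using y m_subset by auto
  obtain G where G: "finite G" "\<forall>g\<in>G. maximal_colon J g"
    "\<forall>h. maximal_colon J h \<longrightarrow> (\<exists>g\<in>G. colon J h = colon J g)"
    using finite_maximal_colons[OF J(1)] by blast
  have gc: "g \<in> carrier R" "g \<notin> J" if "g \<in> G" for g
    using G(2) that unfolding maximal_colon_def by auto
  have "\<exists>z\<in>\<mm> \<cdot> \<mm>. \<forall>P\<in>colon J ` G. y \<oplus> z \<notin> P"
  proof (rule prime_avoidance_coset[OF _ mm yc])
    show "finite (colon J ` G)" using G(1) by simp
    fix P assume "P \<in> colon J ` G"
    then obtain g where g: "g \<in> G" "P = colon J g" by blast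
    show P: "primeideal P R" using maximal_colon_prime[OF J(1)] G(2) g by simp
    show "\<not> \<mm> \<cdot> \<mm> \<subseteq> P"
    proof
      assume sub: "\<mm> \<cdot> \<mm> \<subseteq> P"
      have "a \<otimes> g \<in> J" if a: "a \<in> \<mm>" for a
      proof -
        have "a \<otimes> a \<in> P" using sub ideal_prod.prod[OF a a] by blast
        then have "a \<in> P" using primeideal_closed(3)[OF P, of a a] a m_subset by auto
        then show ?thesis unfolding g(2) colon_def by simp
      qed
      then show False using no[of g] gc[OF g(1)] unfolding socle_element_def by simp
    qed
    fix Q assume "Q \<in> colon J ` G" "Q \<subseteq> P"
    then show "Q = P" using G(2) gc g unfolding maximal_colon_def by blast
  qed
  then obtain z where z: "z \<in> \<mm> \<cdot> \<mm>" "\<forall>g\<in>G. y \<oplus> z \<notin> colon J g" by blast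
  have zm: "z \<in> \<mm>" using ideal_prod_inter[OF ideal_m ideal_m] z(1) by auto
  then have zc: "z \<in> carrier R" using m_subset by auto
  have "y \<oplus> z \<notin> J <+>\<^bsub>R\<^esub> \<mm> \<cdot> \<mm>"
  proof
    assume "y \<oplus> z \<in> J <+>\<^bsub>R\<^esub> \<mm> \<cdot> \<mm>"
    then have "(y \<oplus> z) \<ominus> z \<in> J <+>\<^bsub>R\<^esub> \<mm> \<cdot> \<mm>"
      using ideal_closed(4)[OF s(1)] s(3) z(1) by blast
    moreover have "(y \<oplus> z) \<ominus> z = y" using yc zc by algebra
    ultimately show False using y(2) by simp
  qed
  moreover have "nonzerodivisor_mod J (y \<oplus> z)"
    unfolding nonzerodivisor_mod_def
  proof (intro ballI impI, rule ccontr)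
    fix a assume a: "a \<in> carrier R" "(y \<oplus> z) \<otimes> a \<in> J" "a \<notin> J"
    obtain h where h: "maximal_colon J h" "colon J a \<subseteq> colon J h"
      using exists_maximal_colon[OF J(1) a(1,3)] by blast
    have "y \<oplus> z \<in> colon J a" unfolding colon_def using a yc zc by simp
    then show False using h G(3) z(2) by blast
  qed
  moreover have "y \<oplus> z \<in> \<mm>" using ideal_closed(3)[OF ideal_m y(1) zm] .
  ultimately show ?thesis by blast
qed

text \<open>The members form a regular sequence when read from the last entry to the first. Avoiding \<open>\<mm>\<^sup>2\<close> in
each step makes them part of a minimal generating set of \<open>\<mm>\<close>.\<close>

primrec minimal_regular :: "'a list \<Rightarrow> bool" where
  "minimal_regular [] \<longleftrightarrow> True"
| "minimal_regular (x # xs) \<longleftrightarrow> minimal_regular xs \<and> x \<in> \<mm> \<and>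
     x \<notin> Idl (set xs) <+>\<^bsub>R\<^esub> \<mm> \<cdot> \<mm> \<and> nonzerodivisor_mod (Idl (set xs)) x"

lemma minimal_regular_ideal:
  assumes "minimal_regular xs"
  shows "set xs \<subseteq> \<mm>" "set xs \<subseteq> carrier R" "ideal (Idl (set xs)) R" "Idl (set xs) \<subseteq> \<mm>"
proof -
  show m: "set xs \<subseteq> \<mm>" using assms by (induction xs) auto
  then show c: "set xs \<subseteq> carrier R" using m_subset by auto
  show "ideal (Idl (set xs)) R" using genideal_ideal[OF c] .
  show "Idl (set xs) \<subseteq> \<mm>" using genideal_minimal[OF ideal_m m] .
qed

lemma exists_maximal_minimal_regular:
  "\<exists>xs s. minimal_regular xs \<and> socle_element (Idl (set xs)) s"
proof -
  define \<C> where "\<C> = {Idl (set xs) |xs. minimal_regular xs}"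
  have idC: "ideal K R" if "K \<in> \<C>" for K
    using that minimal_regular_ideal(3) unfolding \<C>_def by blast
  have "Idl (set []) \<in> \<C>" unfolding \<C>_def using minimal_regular.simps(1) by blast
  from exists_maximal_ideal_in[OF idC this]
  obtain L where L: "L \<in> \<C>" "\<forall>K\<in>\<C>. L \<subseteq> K \<longrightarrow> K = L" by auto
  obtain xs where xs: "L = Idl (set xs)" "minimal_regular xs" using L(1) unfolding \<C>_def by blast
  note I = minimal_regular_ideal[OF xs(2)]
  have "\<exists>s. socle_element (Idl (set xs)) s"
  proof (rule ccontr)
    assume "\<not> ?thesis"
    moreover have "\<one> \<notin> Idl (set xs)" using I(4) one_notin_m by auto
    ultimately obtain x where x: "x \<in> \<mm>" "x \<notin> Idl (set xs) <+>\<^bsub>R\<^esub> \<mm> \<cdot> \<mm>"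
      "nonzerodivisor_mod (Idl (set xs)) x"
      using exists_regular_element[OF I(3)] by blast
    then have xx: "minimal_regular (x # xs)" using xs(2) by simp
    then have "Idl (set (x # xs)) \<in> \<C>" unfolding \<C>_def by blast
    moreover have "L \<subseteq> Idl (set (x # xs))"
      unfolding xs(1) using minimal_regular_ideal(2)[OF xx] by (rule subset_Idl_subset) auto
    ultimately have "x \<in> Idl (set xs)"
      using L(2) xs(1) genideal_self[OF minimal_regular_ideal(2)[OF xx]] by auto
    then show False
      using x(2) ideal_sum(2)[OF I(3) ideal_prod_is_ideal[OF ideal_m ideal_m]] by blast
  qed
  then show ?thesis using xs(2) by blast
qed

lemma minimal_regular_notin:
  assumes "minimal_regular (x # xs)"
  shows "x \<notin> Idl (set xs)"
  using assms ideal_sum(2)[OF minimal_regular_ideal(3) ideal_prod_is_ideal[OF ideal_m ideal_m]]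
  by auto

lemma minimal_regular_distinct: "minimal_regular xs \<Longrightarrow> distinct xs"
proof (induction xs)
  case (Cons x xs)
  then have "minimal_regular xs" by simp
  then show ?case
    using Cons minimal_regular_notin[OF Cons.prems] genideal_self[OF minimal_regular_ideal(2)]
    by auto
qed simp

text \<open>A prime \<open>Q\<close> with \<open>J \<subseteq> Q \<subseteq> J + (x)\<close> and \<open>x \<notin> Q\<close> satisfies \<open>Q = J + x Q\<close>, so \<open>Q = J\<close> by Nakayama. Such a
\<open>Q\<close> exists because no product of a power of \<open>x\<close> and an element outside the prime \<open>J + (x)\<close> can lie in \<open>J\<close>.\<close>

lemma prime_of_prime_adjoin:
  assumes J: "ideal J R" and x: "x \<in> \<mm>" "nonzerodivisor_mod J x" "x \<notin> J"
    and prime: "primeideal (adjoin J x) R"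
  shows "primeideal J R"
proof -
  let ?J' = "adjoin J x"
  have xc: "x \<in> carrier R" using x m_subset by auto
  note adj = adjoin_ideal[OF J xc] and p' = primeideal_closed[OF prime] and Jc = ideal_closed[OF J]
  define S where "S = {u \<otimes> x [^] n |u n. u \<in> carrier R - ?J' \<and> n \<in> (UNIV :: nat set)}"
  have S: "u \<otimes> x [^] (n::nat) \<in> S" if "u \<in> carrier R - ?J'" for u n
    unfolding S_def using that by blast
  have cancel: "u \<in> J" if "u \<in> carrier R" "u \<otimes> x [^] (n::nat) \<in> J" for u n
    using that(2)
  proof (induction n)
    case (Suc n)
    have eq: "u \<otimes> x [^] Suc n = x \<otimes> (u \<otimes> x [^] n)" using that(1) xc by (simp add: m_ac)
    have "x \<otimes> (u \<otimes> x [^] n) \<in> J" using Suc.prems unfolding eq .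
    moreover have "u \<otimes> x [^] n \<in> carrier R" using that(1) xc by simp
    ultimately have "u \<otimes> x [^] n \<in> J" using x(2) unfolding nonzerodivisor_mod_def by blast
    then show ?case by (rule Suc.IH)
  qed (use that in simp)
  obtain Q where Q: "primeideal Q R" "J \<subseteq> Q" "Q \<inter> S = {}"
  proof (rule exists_prime_disjoint[OF J, of S])
    show "S \<subseteq> carrier R" unfolding S_def using xc by auto
    show "\<one> \<in> S" using S[of \<one> 0] p'(2) by simp
    show "J \<inter> S = {}"
    proof (rule ccontr)
      assume "J \<inter> S \<noteq> {}"
      then obtain u n where "u \<in> carrier R - ?J'" "u \<otimes> x [^] (n::nat) \<in> J" unfolding S_def by blast
      then show False using cancel adj(2) by blast
    qed
    fix a b assume "a \<in> S" "b \<in> S"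
    then obtain u n v m where ab: "a = u \<otimes> x [^] (n::nat)" "b = v \<otimes> x [^] (m::nat)"
      and uv: "u \<in> carrier R - ?J'" "v \<in> carrier R - ?J'" unfolding S_def by blast
    have c: "u \<in> carrier R" "v \<in> carrier R" "x [^] n \<in> carrier R" "x [^] m \<in> carrier R"
      using uv xc by auto
    have "a \<otimes> b = (u \<otimes> v) \<otimes> (x [^] n \<otimes> x [^] m)" unfolding ab using c by algebra
    then have "a \<otimes> b = (u \<otimes> v) \<otimes> x [^] (n + m)" using xc by (simp add: nat_pow_mult)
    then show "a \<otimes> b \<in> S" using S[OF p'(3)[OF uv]] by simp
  qed
  note Qp = primeideal_closed[OF Q(1)]
  note Qc = ideal_closed[OF Qp(1)]
  have xQ: "x \<notin> Q" using S[of \<one> 1] p'(2) xc Q(3) by auto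
  have "Q \<subseteq> J <+>\<^bsub>R\<^esub> \<mm> \<cdot> Q"
  proof
    fix q assume q: "q \<in> Q"
    have qc: "q \<in> carrier R" using q Qc(1) by auto
    have "q \<in> ?J'" using S[of q 0] q qc Q(3) by auto
    then obtain j r where jr: "q = j \<oplus> r \<otimes> x" "j \<in> J" "r \<in> carrier R" unfolding adjoin_def by blast
    have jc: "j \<in> carrier R" using jr Jc(1) by auto
    have "r \<otimes> x = q \<ominus> j" unfolding jr(1) using jc jr(3) xc by algebra
    then have "r \<otimes> x \<in> Q" using Qc(4)[OF q] jr(2) Q(2) by auto
    then have "r \<in> Q" using Qp(3)[of r x] xQ xc jr(3) by auto
    then have "x \<otimes> r \<in> \<mm> \<cdot> Q" by (rule ideal_prod.prod[OF x(1)])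
    then have "r \<otimes> x \<in> \<mm> \<cdot> Q" using m_comm[OF xc jr(3)] by simp
    then show "q \<in> J <+>\<^bsub>R\<^esub> \<mm> \<cdot> Q" unfolding set_add_def' jr(1) using jr(2) by blast
  qed
  then have "Q \<subseteq> J" by (rule nakayama[OF J Qp(1)])
  then show ?thesis using Q(1,2) by (metis subset_antisym)
qed

text \<open>Primality descends from the whole sequence to its initial parts, which thereby yield a chain of
primes as long as the sequence.\<close>

lemma minimal_regular_prime_chain:
  assumes "minimal_regular xs" "primeideal (Idl (set xs)) R"
  shows "\<exists>p. prime_chain p (length xs) (Idl (set xs))"
  using assms
proof (induction xs)
  case Nil
  then show ?case using prime_chain_refl by auto
next
  case (Cons x xs)
  have xs: "minimal_regular xs" and x: "x \<in> \<mm>" "nonzerodivisor_mod (Idl (set xs)) x"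
    using Cons.prems(1) by auto
  note I = minimal_regular_ideal[OF xs]
  have nin: "x \<notin> Idl (set xs)" using minimal_regular_notin[OF Cons.prems(1)] .
  have xc: "x \<in> carrier R" using x m_subset by auto
  have eq: "Idl (set (x # xs)) = adjoin (Idl (set xs)) x" using Idl_insert[OF I(2) xc] by simp
  have "primeideal (Idl (set xs)) R"
    using prime_of_prime_adjoin[OF I(3) x nin] Cons.prems(2) unfolding eq by simp
  then obtain p where "prime_chain p (length xs) (Idl (set xs))" using Cons.IH xs by blast
  moreover have "Idl (set xs) \<subset> Idl (set (x # xs))"
    unfolding eq using adjoin_ideal(2,3)[OF I(3) xc] nin by blast
  ultimately have "prime_chain p (Suc (length xs)) (Idl (set (x # xs)))"
    by (rule prime_chain_step) (rule Cons.prems(2))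
  then show ?case by auto
qed

lemma prime_chain_function:
  assumes "prime_chain p n P"
  shows "\<exists>f :: nat \<Rightarrow> 'a set. f n = P \<and> (\<forall>i\<le>n. primeideal (f i) R) \<and> (\<forall>i<n. f i \<subset> f (Suc i))"
  using assms
proof induction
  case (prime_chain_refl P)
  then show ?case by (intro exI[of _ "\<lambda>_. P"]) simp
next
  case (prime_chain_step p n P Q)
  then obtain f :: "nat \<Rightarrow> 'a set" where f: "f n = P" "\<forall>i\<le>n. primeideal (f i) R" "\<forall>i<n. f i \<subset> f (Suc i)"
    by blast
  show ?case
    by (rule exI[of _ "f(Suc n := Q)"]) (use f prime_chain_step in \<open>auto simp: less_Suc_eq le_Suc_eq\<close>)
qed

lemma function_prime_chain:
  fixes f :: "nat \<Rightarrow> 'a set"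
  assumes "\<And>i. i \<le> n \<Longrightarrow> primeideal (f i) R" "\<And>i. i < n \<Longrightarrow> f i \<subset> f (Suc i)"
  shows "prime_chain (f 0) n (f n)"
  using assms
proof (induction n)
  case 0
  then show ?case by (intro prime_chain_refl) simp
next
  case (Suc n)
  have "prime_chain (f 0) n (f n)" using Suc by simp
  then show ?case by (rule prime_chain_step) (use Suc.prems in auto)
qed

lemma regular_of_minimal_regular:
  assumes xs: "minimal_regular xs" and gen: "Idl (set xs) = \<mm>"
  shows "regular_local_ring R \<mm>"
proof -
  note I = minimal_regular_ideal[OF xs]
  have "krull_dim R = enat (length xs)"
  proof (rule antisym)
    show "krull_dim R \<le> enat (length xs)"
      unfolding krull_dim_def
    proof (rule Sup_least)
      fix d assume "d \<in> {enat n |n. \<exists>p :: nat \<Rightarrow> 'a set.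
        (\<forall>i\<le>n. primeideal (p i) R) \<and> (\<forall>i<n. p i \<subset> p (Suc i))}"
      then obtain n and f :: "nat \<Rightarrow> 'a set" where d: "d = enat n"
        and f: "\<And>i. i \<le> n \<Longrightarrow> primeideal (f i) R" "\<And>i. i < n \<Longrightarrow> f i \<subset> f (Suc i)" by blast
      have "n \<le> length xs"
      proof (cases n)
        case (Suc k)
        have "prime_chain (f 0) k (f k)" using f Suc by (intro function_prime_chain) auto
        moreover have "f k \<subset> \<mm>"
        proof -
          have "primeideal (f (Suc k)) R" using f(1) Suc by simp
          then have "f (Suc k) \<subseteq> \<mm>" using proper_ideal_subset_m primeideal_closed(1,2) by blast
          then show ?thesis using f(2)[of k] Suc by auto
        qed
        ultimately have "prime_chain (f 0) (Suc k) \<mm>" using prime_m by (rule prime_chain_step)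
        then have "Suc k \<le> length xs"
        proof (rule prime_chain_length_le[OF _ I(1)])
          fix Q assume "primeideal Q R" "f 0 \<union> set xs \<subseteq> Q"
          then show "\<mm> \<subseteq> Q" using genideal_minimal[of Q "set xs"] primeideal_closed(1) gen by auto
        qed
        then show ?thesis using Suc by simp
      qed simp
      then show "d \<le> enat (length xs)" using d by simp
    qed
    obtain p where "prime_chain p (length xs) \<mm>"
      using minimal_regular_prime_chain[OF xs] prime_m gen by auto
    from prime_chain_function[OF this]
    obtain f :: "nat \<Rightarrow> 'a set" where
      f: "\<forall>i\<le>length xs. primeideal (f i) R" "\<forall>i<length xs. f i \<subset> f (Suc i)"
      by (elim exE conjE)
    show "enat (length xs) \<le> krull_dim R"
      unfolding krull_dim_def
      by (intro Sup_upper CollectI exI[of _ "length xs"] exI[of _ f] conjI refl f)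
  qed
  moreover have "card (set xs) = length xs"
    using distinct_card[OF minimal_regular_distinct[OF xs]] .
  ultimately show ?thesis
    unfolding regular_local_ring_def using gen I(2) noetherian_local_ring_axioms
    by (intro conjI exI[of _ "set xs"]) simp_all
qed

end

section \<open>Modules, homomorphisms and spans\<close>

lemma module_closed:
  assumes "module R M"
  shows "\<zero>\<^bsub>M\<^esub> \<in> carrier M"
    and "\<And>x y. x \<in> carrier M \<Longrightarrow> y \<in> carrier M \<Longrightarrow> x \<oplus>\<^bsub>M\<^esub> y \<in> carrier M"
    and "\<And>a x. a \<in> carrier R \<Longrightarrow> x \<in> carrier M \<Longrightarrow> a \<odot>\<^bsub>M\<^esub> x \<in> carrier M"
    and "\<And>x. x \<in> carrier M \<Longrightarrow> \<ominus>\<^bsub>M\<^esub> x = (\<ominus>\<^bsub>R\<^esub> \<one>\<^bsub>R\<^esub>) \<odot>\<^bsub>M\<^esub> x"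
proof -
  interpret module R M by fact
  show "\<zero>\<^bsub>M\<^esub> \<in> carrier M"
    and "\<And>x y. x \<in> carrier M \<Longrightarrow> y \<in> carrier M \<Longrightarrow> x \<oplus>\<^bsub>M\<^esub> y \<in> carrier M"
    and "\<And>a x. a \<in> carrier R \<Longrightarrow> x \<in> carrier M \<Longrightarrow> a \<odot>\<^bsub>M\<^esub> x \<in> carrier M" by auto
  show "\<ominus>\<^bsub>M\<^esub> x = (\<ominus>\<^bsub>R\<^esub> \<one>\<^bsub>R\<^esub>) \<odot>\<^bsub>M\<^esub> x" if "x \<in> carrier M" for x
    using smult_l_minus[of "\<one>\<^bsub>R\<^esub>" x] that by simp
qed

lemma submodule_criterion:
  assumes M: "module R M" and H: "H \<subseteq> carrier M" "\<zero>\<^bsub>M\<^esub> \<in> H"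
    and "\<And>x y. x \<in> H \<Longrightarrow> y \<in> H \<Longrightarrow> x \<oplus>\<^bsub>M\<^esub> y \<in> H"
    and "\<And>a x. a \<in> carrier R \<Longrightarrow> x \<in> H \<Longrightarrow> a \<odot>\<^bsub>M\<^esub> x \<in> H"
  shows "submodule H R M"
proof -
  interpret module R M by fact
  show ?thesis
  proof (rule submoduleI)
    fix x assume x: "x \<in> H"
    then have "\<ominus>\<^bsub>M\<^esub> x = (\<ominus>\<^bsub>R\<^esub> \<one>\<^bsub>R\<^esub>) \<odot>\<^bsub>M\<^esub> x" using module_closed(4)[OF M] H(1) by blast
    moreover have "(\<ominus>\<^bsub>R\<^esub> \<one>\<^bsub>R\<^esub>) \<odot>\<^bsub>M\<^esub> x \<in> H" using assms(5)[OF _ x] by simp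
    ultimately show "\<ominus>\<^bsub>M\<^esub> x \<in> H" by simp
  qed (use assms in auto)
qed

lemma submodule_closed:
  assumes M: "module R M" and H: "submodule H R M"
  shows "H \<subseteq> carrier M" and "\<zero>\<^bsub>M\<^esub> \<in> H"
    and "\<And>x y. x \<in> H \<Longrightarrow> y \<in> H \<Longrightarrow> x \<oplus>\<^bsub>M\<^esub> y \<in> H"
    and "\<And>x y. x \<in> H \<Longrightarrow> y \<in> H \<Longrightarrow> x \<ominus>\<^bsub>M\<^esub> y \<in> H"
    and "\<And>a x. a \<in> carrier R \<Longrightarrow> x \<in> H \<Longrightarrow> a \<odot>\<^bsub>M\<^esub> x \<in> H"
proof -
  interpret module R M by fact
  note E = submoduleE[OF H]
  show sub: "H \<subseteq> carrier M" by (fact E(1))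
  show add: "\<And>x y. x \<in> H \<Longrightarrow> y \<in> H \<Longrightarrow> x \<oplus>\<^bsub>M\<^esub> y \<in> H" by (fact E(5))
  show sm: "\<And>a x. a \<in> carrier R \<Longrightarrow> x \<in> H \<Longrightarrow> a \<odot>\<^bsub>M\<^esub> x \<in> H" by (fact E(4))
  show "x \<ominus>\<^bsub>M\<^esub> y \<in> H" if "x \<in> H" "y \<in> H" for x y
    unfolding a_minus_def using add[OF that(1) E(3)[OF that(2)]] .
  obtain x where x: "x \<in> H" using E(2) by blast
  have "\<zero>\<^bsub>R\<^esub> \<odot>\<^bsub>M\<^esub> x = \<zero>\<^bsub>M\<^esub>" using x sub by auto
  then show "\<zero>\<^bsub>M\<^esub> \<in> H" using sm[OF _ x, of "\<zero>\<^bsub>R\<^esub>"] by simp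
qed

lemma mod_hom_apply:
  assumes M: "module R M" and N: "module R N" and h: "h \<in> mod_hom R M N"
  shows "\<And>x. x \<in> carrier M \<Longrightarrow> h x \<in> carrier N"
    and "\<And>x y. x \<in> carrier M \<Longrightarrow> y \<in> carrier M \<Longrightarrow> h (x \<oplus>\<^bsub>M\<^esub> y) = h x \<oplus>\<^bsub>N\<^esub> h y"
    and "\<And>a x. a \<in> carrier R \<Longrightarrow> x \<in> carrier M \<Longrightarrow> h (a \<odot>\<^bsub>M\<^esub> x) = a \<odot>\<^bsub>N\<^esub> h x"
    and "h \<zero>\<^bsub>M\<^esub> = \<zero>\<^bsub>N\<^esub>"
    and "\<And>x y. x \<in> carrier M \<Longrightarrow> y \<in> carrier M \<Longrightarrow> h (x \<ominus>\<^bsub>M\<^esub> y) = h x \<ominus>\<^bsub>N\<^esub> h y"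
proof -
  interpret M: module R M by fact
  interpret N: module R N by fact
  show closed: "\<And>x. x \<in> carrier M \<Longrightarrow> h x \<in> carrier N"
    and add: "\<And>x y. x \<in> carrier M \<Longrightarrow> y \<in> carrier M \<Longrightarrow> h (x \<oplus>\<^bsub>M\<^esub> y) = h x \<oplus>\<^bsub>N\<^esub> h y"
    and sm: "\<And>a x. a \<in> carrier R \<Longrightarrow> x \<in> carrier M \<Longrightarrow> h (a \<odot>\<^bsub>M\<^esub> x) = a \<odot>\<^bsub>N\<^esub> h x"
    using h unfolding mod_hom_def hom_def by auto
  have "h (\<zero>\<^bsub>R\<^esub> \<odot>\<^bsub>M\<^esub> \<zero>\<^bsub>M\<^esub>) = \<zero>\<^bsub>R\<^esub> \<odot>\<^bsub>N\<^esub> h \<zero>\<^bsub>M\<^esub>" by (rule sm) auto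
  then show "h \<zero>\<^bsub>M\<^esub> = \<zero>\<^bsub>N\<^esub>" using closed by simp
  have neg: "h (\<ominus>\<^bsub>M\<^esub> y) = \<ominus>\<^bsub>N\<^esub> h y" if "y \<in> carrier M" for y
    using that sm[of "\<ominus>\<^bsub>R\<^esub> \<one>\<^bsub>R\<^esub>" y] closed
    by (simp add: module_closed(4)[OF M] module_closed(4)[OF N])
  show "h (x \<ominus>\<^bsub>M\<^esub> y) = h x \<ominus>\<^bsub>N\<^esub> h y" if "x \<in> carrier M" "y \<in> carrier M" for x y
    unfolding a_minus_def using add[OF that(1), of "\<ominus>\<^bsub>M\<^esub> y"] neg[OF that(2)] that by simp
qed

lemma mod_homI:
  assumes "\<And>x. x \<in> carrier M \<Longrightarrow> h x \<in> carrier N"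
    and "\<And>x y. x \<in> carrier M \<Longrightarrow> y \<in> carrier M \<Longrightarrow> h (x \<oplus>\<^bsub>M\<^esub> y) = h x \<oplus>\<^bsub>N\<^esub> h y"
    and "\<And>a x. a \<in> carrier R \<Longrightarrow> x \<in> carrier M \<Longrightarrow> h (a \<odot>\<^bsub>M\<^esub> x) = a \<odot>\<^bsub>N\<^esub> h x"
  shows "h \<in> mod_hom R M N"
  unfolding mod_hom_def hom_def using assms by auto

lemma mod_hom_comp:
  assumes "h \<in> mod_hom R L M" "g \<in> mod_hom R M N"
  shows "g \<circ> h \<in> mod_hom R L N"
  using assms unfolding mod_hom_def hom_def by (auto simp: Pi_iff)

lemma submodule_vimage:
  assumes M: "module R M" and N: "module R N" and h: "h \<in> mod_hom R M N" and H: "submodule H R N"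
  shows "submodule {x \<in> carrier M. h x \<in> H} R M"
  using mod_hom_apply[OF M N h] submodule_closed[OF N H] module_closed[OF M]
  by (intro submodule_criterion[OF M]) auto

lemma submodule_zero:
  assumes M: "module R M" shows "submodule {\<zero>\<^bsub>M\<^esub>} R M"
proof -
  interpret module R M by fact
  show ?thesis by (rule submodule_criterion[OF M]) auto
qed

lemma mod_hom_inverse:
  assumes M: "module R M" and N: "module R N"
    and h: "h \<in> mod_hom R M N" "bij_betw h (carrier M) (carrier N)"
  shows "\<exists>g\<in>mod_hom R N M. \<forall>y\<in>carrier N. h (g y) = y"
proof -
  note ha = mod_hom_apply[OF M N h(1)] and Mc = module_closed[OF M]
  let ?g = "inv_into (carrier M) h"
  have g: "?g y \<in> carrier M" "h (?g y) = y" if "y \<in> carrier N" for y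
    using that h(2) by (auto simp: bij_betw_def inv_into_into f_inv_into_f)
  have eq: "?g y = x" if "x \<in> carrier M" "h x = y" for x y
    using that h(2) by (auto simp: bij_betw_def)
  have "?g \<in> mod_hom R N M"
    by (rule mod_homI) (auto intro!: eq simp: g ha Mc)
  then show ?thesis using g(2) by blast
qed

lemma smult_hom:
  assumes M: "module R M" and s: "s \<in> carrier R"
  shows "(\<lambda>x. s \<odot>\<^bsub>M\<^esub> x) \<in> mod_hom R M M"
proof -
  interpret module R M by fact
  show ?thesis
    using s by (intro mod_homI)
      (auto simp: smult_r_distr smult_assoc1[symmetric] m_comm)
qed

lemma submodule_span_closed:
  assumes M: "module R M" and A: "A \<subseteq> carrier M"
  shows "submodule (submodule_span R M A) R M" and "A \<subseteq> submodule_span R M A"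
proof -
  have c: "submodule (carrier M) R M" using module.carrier_is_submodule[OF M] .
  show "submodule (submodule_span R M A) R M"
    unfolding submodule_span_def
    by (rule submodule_criterion[OF M]) (use c A submodule_closed[OF M] in auto)
  show "A \<subseteq> submodule_span R M A" unfolding submodule_span_def by auto
qed

lemma submodule_span_least:
  assumes "submodule H R M" "A \<subseteq> H" shows "submodule_span R M A \<subseteq> H"
  unfolding submodule_span_def using assms by auto

lemma ideal_smult_closed:
  assumes M: "module R M" and J: "J \<subseteq> carrier R"
  shows "submodule (ideal_smult R J M) R M"
    and "\<And>a x. a \<in> J \<Longrightarrow> x \<in> carrier M \<Longrightarrow> a \<odot>\<^bsub>M\<^esub> x \<in> ideal_smult R J M"
proof -
  have A: "{a \<odot>\<^bsub>M\<^esub> x |a x. a \<in> J \<and> x \<in> carrier M} \<subseteq> carrier M"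
    using module_closed(3)[OF M] J by auto
  show "submodule (ideal_smult R J M) R M"
    unfolding ideal_smult_def by (rule submodule_span_closed(1)[OF M A])
  show "a \<odot>\<^bsub>M\<^esub> x \<in> ideal_smult R J M" if "a \<in> J" "x \<in> carrier M" for a x
    unfolding ideal_smult_def using submodule_span_closed(2)[OF M A] that by blast
qed

lemma ideal_smult_least:
  assumes "submodule H R M" "\<And>a x. a \<in> J \<Longrightarrow> x \<in> carrier M \<Longrightarrow> a \<odot>\<^bsub>M\<^esub> x \<in> H"
  shows "ideal_smult R J M \<subseteq> H"
  unfolding ideal_smult_def by (rule submodule_span_least) (use assms in auto)

lemma ideal_smult_mono:
  assumes M: "module R M" and "J \<subseteq> J'" "J' \<subseteq> carrier R"
  shows "ideal_smult R J M \<subseteq> ideal_smult R J' M"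
  using assms(2) ideal_smult_closed[OF M assms(3)] by (intro ideal_smult_least) auto

lemma mod_hom_ideal_smult:
  assumes M: "module R M" and N: "module R N" and h: "h \<in> mod_hom R M N" and J: "J \<subseteq> carrier R"
    and x: "x \<in> ideal_smult R J M"
  shows "h x \<in> ideal_smult R J N"
proof -
  note JN = ideal_smult_closed[OF N J] and ha = mod_hom_apply[OF M N h]
  have "ideal_smult R J M \<subseteq> {x \<in> carrier M. h x \<in> ideal_smult R J N}"
  proof (rule ideal_smult_least[OF submodule_vimage[OF M N h JN(1)]])
    fix a y assume "a \<in> J" "y \<in> carrier M"
    then show "a \<odot>\<^bsub>M\<^esub> y \<in> {x \<in> carrier M. h x \<in> ideal_smult R J N}"
      using JN(2) ha(1,3) module_closed(3)[OF M] J by auto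
  qed
  then show ?thesis using x by auto
qed

context cring
begin

lemma adjoin_smult_decomp:
  assumes M: "module R M" and J: "ideal J R" and x: "x \<in> carrier R"
    and z: "z \<in> ideal_smult R (adjoin J x) M"
  shows "\<exists>j\<in>ideal_smult R J M. \<exists>w\<in>carrier M. z = j \<oplus>\<^bsub>M\<^esub> x \<odot>\<^bsub>M\<^esub> w"
proof -
  interpret M: module R M by fact
  note Jc = ideal_closed[OF J] and JM = ideal_smult_closed[OF M ideal_closed(1)[OF J]]
  note JMc = submodule_closed[OF M JM(1)]
  let ?H = "{j \<oplus>\<^bsub>M\<^esub> x \<odot>\<^bsub>M\<^esub> w |j w. j \<in> ideal_smult R J M \<and> w \<in> carrier M}"
  have "submodule ?H R M"
  proof (rule submodule_criterion[OF M])
    show "?H \<subseteq> carrier M" using JMc(1) x by auto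
    have "\<zero>\<^bsub>M\<^esub> = \<zero>\<^bsub>M\<^esub> \<oplus>\<^bsub>M\<^esub> x \<odot>\<^bsub>M\<^esub> \<zero>\<^bsub>M\<^esub>" using x by simp
    then show "\<zero>\<^bsub>M\<^esub> \<in> ?H" using JMc(2) by blast
  next
    fix u v assume "u \<in> ?H" "v \<in> ?H"
    then obtain i w j w' where u: "u = i \<oplus>\<^bsub>M\<^esub> x \<odot>\<^bsub>M\<^esub> w" "i \<in> ideal_smult R J M" "w \<in> carrier M"
      and v: "v = j \<oplus>\<^bsub>M\<^esub> x \<odot>\<^bsub>M\<^esub> w'" "j \<in> ideal_smult R J M" "w' \<in> carrier M" by blast
    have "i \<in> carrier M" "j \<in> carrier M" using u(2) v(2) JMc(1) by auto
    then have "u \<oplus>\<^bsub>M\<^esub> v = (i \<oplus>\<^bsub>M\<^esub> j) \<oplus>\<^bsub>M\<^esub> x \<odot>\<^bsub>M\<^esub> (w \<oplus>\<^bsub>M\<^esub> w')"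
      unfolding u(1) v(1) using u(3) v(3) x by (simp add: M.smult_r_distr M.M.a_ac)
    then show "u \<oplus>\<^bsub>M\<^esub> v \<in> ?H" using JMc(3)[OF u(2) v(2)] M.M.a_closed[OF u(3) v(3)] by blast
  next
    fix a u assume a: "a \<in> carrier R" and "u \<in> ?H"
    then obtain i w where u: "u = i \<oplus>\<^bsub>M\<^esub> x \<odot>\<^bsub>M\<^esub> w" "i \<in> ideal_smult R J M" "w \<in> carrier M" by blast
    have "i \<in> carrier M" using u(2) JMc(1) by auto
    then have "a \<odot>\<^bsub>M\<^esub> u = a \<odot>\<^bsub>M\<^esub> i \<oplus>\<^bsub>M\<^esub> x \<odot>\<^bsub>M\<^esub> (a \<odot>\<^bsub>M\<^esub> w)"
      unfolding u(1) using u(3) a x by (simp add: M.smult_r_distr M.smult_assoc1[symmetric] m_comm)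
    then show "a \<odot>\<^bsub>M\<^esub> u \<in> ?H" using JMc(5)[OF a u(2)] M.smult_closed[OF a u(3)] by blast
  qed
  moreover have "b \<odot>\<^bsub>M\<^esub> y \<in> ?H" if b: "b \<in> adjoin J x" and y: "y \<in> carrier M" for b y
  proof -
    obtain j r where j: "b = j \<oplus> r \<otimes> x" "j \<in> J" "r \<in> carrier R" using b unfolding adjoin_def by blast
    have jc: "j \<in> carrier R" using j(2) Jc(1) by auto
    have "b \<odot>\<^bsub>M\<^esub> y = j \<odot>\<^bsub>M\<^esub> y \<oplus>\<^bsub>M\<^esub> x \<odot>\<^bsub>M\<^esub> (r \<odot>\<^bsub>M\<^esub> y)"
      unfolding j(1) using jc j(3) x y by (simp add: M.smult_l_distr M.smult_assoc1[symmetric] m_comm)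
    then show ?thesis using JM(2)[OF j(2) y] M.smult_closed[OF j(3) y] by blast
  qed
  ultimately have "ideal_smult R (adjoin J x) M \<subseteq> ?H" by (rule ideal_smult_least)
  then show ?thesis using z by blast
qed

lemma smult_ideal_prod:
  assumes M: "module R M" and I: "ideal I R" and J: "ideal J R"
    and a: "a \<in> I" and v: "v \<in> ideal_smult R J M"
  shows "a \<odot>\<^bsub>M\<^esub> v \<in> ideal_smult R (I \<cdot> J) M"
proof -
  interpret M: module R M by fact
  have ac: "a \<in> carrier R" using a ideal_closed(1)[OF I] by auto
  note IJ = ideal_smult_closed[OF M ideal_closed(1)[OF ideal_prod_is_ideal[OF I J]]]
  have "ideal_smult R J M \<subseteq> {v \<in> carrier M. a \<odot>\<^bsub>M\<^esub> v \<in> ideal_smult R (I \<cdot> J) M}"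
  proof (rule ideal_smult_least[OF submodule_vimage[OF M M smult_hom[OF M ac] IJ(1)]])
    fix b x assume b: "b \<in> J" and x: "x \<in> carrier M"
    have bc: "b \<in> carrier R" using b ideal_closed(1)[OF J] by auto
    have "a \<odot>\<^bsub>M\<^esub> (b \<odot>\<^bsub>M\<^esub> x) = (a \<otimes> b) \<odot>\<^bsub>M\<^esub> x" using ac bc x by (simp add: M.smult_assoc1)
    then show "b \<odot>\<^bsub>M\<^esub> x \<in> {v \<in> carrier M. a \<odot>\<^bsub>M\<^esub> v \<in> ideal_smult R (I \<cdot> J) M}"
      using IJ(2)[OF ideal_prod.prod[OF a b] x] M.smult_closed[OF bc x] by simp
  qed
  then show ?thesis using v by blast
qed

end

section \<open>Quotient modules\<close>

lemma quot_module_facts: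
  assumes M: "module R M" and H: "submodule H R M"
  shows "carrier (quot_module M H) = (\<lambda>x. H +>\<^bsub>M\<^esub> x) ` carrier M"
    and "\<And>x y. x \<in> carrier M \<Longrightarrow> y \<in> carrier M \<Longrightarrow>
      H +>\<^bsub>M\<^esub> x = H +>\<^bsub>M\<^esub> y \<longleftrightarrow> x \<ominus>\<^bsub>M\<^esub> y \<in> H"
    and "\<zero>\<^bsub>quot_module M H\<^esub> = H +>\<^bsub>M\<^esub> \<zero>\<^bsub>M\<^esub>"
    and "\<And>x y. x \<in> carrier M \<Longrightarrow> y \<in> carrier M \<Longrightarrow>
      (H +>\<^bsub>M\<^esub> x) \<oplus>\<^bsub>quot_module M H\<^esub> (H +>\<^bsub>M\<^esub> y) = H +>\<^bsub>M\<^esub> (x \<oplus>\<^bsub>M\<^esub> y)"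
    and "\<And>a x. a \<in> carrier R \<Longrightarrow> x \<in> carrier M \<Longrightarrow>
      a \<odot>\<^bsub>quot_module M H\<^esub> (H +>\<^bsub>M\<^esub> x) = H +>\<^bsub>M\<^esub> (a \<odot>\<^bsub>M\<^esub> x)"
    and "\<And>x y. x \<in> carrier M \<Longrightarrow> y \<in> H +>\<^bsub>M\<^esub> x \<Longrightarrow> y \<in> carrier M \<and> H +>\<^bsub>M\<^esub> y = H +>\<^bsub>M\<^esub> x"
    and "\<And>x. x \<in> carrier M \<Longrightarrow> x \<in> H +>\<^bsub>M\<^esub> x"
proof -
  interpret module R M by fact
  note Hc = submodule_closed[OF M H]
  interpret H: abelian_subgroup H M
    by (rule abelian_subgroupI3)
      (use H M.abelian_group_axioms in \<open>auto intro: additive_subgroupI submodule.axioms(1)\<close>)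
  show "carrier (quot_module M H) = (\<lambda>x. H +>\<^bsub>M\<^esub> x) ` carrier M"
    unfolding quot_module_def A_RCOSETS_def' by auto
  show mem: "y \<in> carrier M \<and> H +>\<^bsub>M\<^esub> y = H +>\<^bsub>M\<^esub> x" if "x \<in> carrier M" "y \<in> H +>\<^bsub>M\<^esub> x" for x y
    using H.a_elemrcos_carrier[OF that] H.a_repr_independence'[OF that(2,1)] by simp
  show self: "x \<in> H +>\<^bsub>M\<^esub> x" if "x \<in> carrier M" for x using H.a_rcos_self[OF that] .
  show eq: "H +>\<^bsub>M\<^esub> x = H +>\<^bsub>M\<^esub> y \<longleftrightarrow> x \<ominus>\<^bsub>M\<^esub> y \<in> H" if "x \<in> carrier M" "y \<in> carrier M" for x y
    using H.a_rcos_module[of y x] mem[of y x] self[of x] that unfolding a_minus_def by auto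
  show "\<zero>\<^bsub>quot_module M H\<^esub> = H +>\<^bsub>M\<^esub> \<zero>\<^bsub>M\<^esub>"
    unfolding quot_module_def using Hc(1) by simp
  show "(H +>\<^bsub>M\<^esub> x) \<oplus>\<^bsub>quot_module M H\<^esub> (H +>\<^bsub>M\<^esub> y) = H +>\<^bsub>M\<^esub> (x \<oplus>\<^bsub>M\<^esub> y)"
    if "x \<in> carrier M" "y \<in> carrier M" for x y
    unfolding quot_module_def using H.a_rcos_sum that by simp
  show "a \<odot>\<^bsub>quot_module M H\<^esub> (H +>\<^bsub>M\<^esub> x) = H +>\<^bsub>M\<^esub> (a \<odot>\<^bsub>M\<^esub> x)"
    if a: "a \<in> carrier R" and x: "x \<in> carrier M" for a x
  proof -
    have const: "H +>\<^bsub>M\<^esub> (a \<odot>\<^bsub>M\<^esub> y) = H +>\<^bsub>M\<^esub> (a \<odot>\<^bsub>M\<^esub> x)" if y: "y \<in> H +>\<^bsub>M\<^esub> x" for y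
    proof -
      have yc: "y \<in> carrier M" "y \<ominus>\<^bsub>M\<^esub> x \<in> H" using mem[OF x y] eq x by auto
      have "a \<odot>\<^bsub>M\<^esub> y \<ominus>\<^bsub>M\<^esub> a \<odot>\<^bsub>M\<^esub> x = a \<odot>\<^bsub>M\<^esub> (y \<ominus>\<^bsub>M\<^esub> x)"
        unfolding a_minus_def using a x yc(1) by (simp add: smult_r_distr smult_r_minus)
      then show ?thesis using eq a x yc Hc(5) by simp
    qed
    have "(\<Union>y\<in>H +>\<^bsub>M\<^esub> x. H +>\<^bsub>M\<^esub> (a \<odot>\<^bsub>M\<^esub> y)) = H +>\<^bsub>M\<^esub> (a \<odot>\<^bsub>M\<^esub> x)"
    proof (rule SUP_eq_const)
      show "H +>\<^bsub>M\<^esub> x \<noteq> {}" using self[OF x] by blast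
    qed (rule const)
    then show ?thesis unfolding quot_module_def by simp
  qed
qed

lemma quot_zero_iff:
  assumes M: "module R M" and H: "submodule H R M" and x: "x \<in> carrier M"
  shows "H +>\<^bsub>M\<^esub> x = \<zero>\<^bsub>quot_module M H\<^esub> \<longleftrightarrow> x \<in> H"
proof -
  interpret module R M by fact
  show ?thesis
    using quot_module_facts(2)[OF M H x, of "\<zero>\<^bsub>M\<^esub>"] x
    by (simp add: quot_module_facts(3)[OF M H] a_minus_def M.minus_equality[of "\<zero>\<^bsub>M\<^esub>" "\<zero>\<^bsub>M\<^esub>"])
qed

lemma quot_module_module:
  assumes M: "module R M" and H: "submodule H R M"
  shows "module R (quot_module M H)"
proof -
  let ?Q = "quot_module M H"
  interpret R: cring R by (rule module.axioms(1)[OF M])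
  note q = quot_module_facts[OF M H]
  note ab = abelian_groupE[OF module.axioms(2)[OF M]] and Mc = module_closed[OF M]
  note Ml = module.smult_l_distr[OF M] module.smult_r_distr[OF M] module.smult_assoc1[OF M]
    module.smult_one[OF M]
  have neg: "\<exists>Y\<in>carrier ?Q. Y \<oplus>\<^bsub>?Q\<^esub> Z = \<zero>\<^bsub>?Q\<^esub>" if Z: "Z \<in> carrier ?Q" for Z
  proof -
    obtain x where x: "x \<in> carrier M" "Z = H +>\<^bsub>M\<^esub> x" using Z unfolding q(1) by blast
    obtain y where y: "y \<in> carrier M" "y \<oplus>\<^bsub>M\<^esub> x = \<zero>\<^bsub>M\<^esub>" using ab(6)[OF x(1)] by blast
    have "(H +>\<^bsub>M\<^esub> y) \<oplus>\<^bsub>?Q\<^esub> Z = \<zero>\<^bsub>?Q\<^esub>" unfolding x(2) q(3) using q(4) x(1) y by simp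
    then show ?thesis unfolding q(1) using y(1) by blast
  qed
  have "abelian_group ?Q"
  proof (rule abelian_groupI)
    show "\<exists>Y\<in>carrier ?Q. Y \<oplus>\<^bsub>?Q\<^esub> Z = \<zero>\<^bsub>?Q\<^esub>" if "Z \<in> carrier ?Q" for Z by (rule neg[OF that])
  next
    fix Y Z assume "Y \<in> carrier ?Q" "Z \<in> carrier ?Q"
    then obtain y z where yz: "y \<in> carrier M" "Y = H +>\<^bsub>M\<^esub> y" "z \<in> carrier M" "Z = H +>\<^bsub>M\<^esub> z"
      unfolding q(1) by blast
    show "Y \<oplus>\<^bsub>?Q\<^esub> Z = Z \<oplus>\<^bsub>?Q\<^esub> Y"
      unfolding yz(2,4) q(4)[OF yz(1,3)] q(4)[OF yz(3,1)] ab(4)[OF yz(1,3)] ..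
  qed (auto simp: q(1,3,4) Mc ab(3,5))
  then show ?thesis
    using R.is_cring by (intro moduleI) (auto simp: q(1,4,5) Mc Ml)
qed

section \<open>Direct sums and free modules\<close>

lemma regular_module_module:
  assumes "cring R" shows "module R (regular_module R)"
proof -
  interpret cring R by fact
  have "abelian_group (regular_module R)"
  proof (rule abelian_groupI)
    fix x assume "x \<in> carrier (regular_module R)"
    then have x: "x \<in> carrier R" by (simp add: regular_module_def)
    then have "\<ominus>\<^bsub>R\<^esub> x \<in> carrier R" "\<ominus>\<^bsub>R\<^esub> x \<oplus>\<^bsub>R\<^esub> x = \<zero>\<^bsub>R\<^esub>" by (auto simp: l_neg)
    then show "\<exists>y\<in>carrier (regular_module R). y \<oplus>\<^bsub>regular_module R\<^esub> x = \<zero>\<^bsub>regular_module R\<^esub>"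
      by (auto simp: regular_module_def)
  qed (auto simp: regular_module_def a_ac)
  then show ?thesis
    by (intro moduleI) (auto simp: regular_module_def l_distr r_distr m_assoc is_cring)
qed

lemma direct_sum_simps:
  "x \<in> carrier (direct_sum I M) \<longleftrightarrow>
    x \<in> (\<Pi>\<^sub>E i\<in>I. carrier (M i)) \<and> finite {i \<in> I. x i \<noteq> \<zero>\<^bsub>M i\<^esub>}"
  "\<zero>\<^bsub>direct_sum I M\<^esub> = (\<lambda>i\<in>I. \<zero>\<^bsub>M i\<^esub>)"
  "x \<oplus>\<^bsub>direct_sum I M\<^esub> y = (\<lambda>i\<in>I. x i \<oplus>\<^bsub>M i\<^esub> y i)"
  "a \<odot>\<^bsub>direct_sum I M\<^esub> x = (\<lambda>i\<in>I. a \<odot>\<^bsub>M i\<^esub> x i)"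
  unfolding direct_sum_def by auto

lemma direct_sum_module:
  assumes R: "cring R" and M: "\<And>i. i \<in> I \<Longrightarrow> module R (M i)"
  shows "module R (direct_sum I M)"
proof -
  let ?D = "direct_sum I M"
  have ag: "abelian_group (M i)" if "i \<in> I" for i using module.axioms(2)[OF M[OF that]] .
  note ab = abelian_groupE[OF ag] and mc = module_closed[OF M]
  have lzero: "\<zero>\<^bsub>M i\<^esub> \<oplus>\<^bsub>M i\<^esub> \<zero>\<^bsub>M i\<^esub> = \<zero>\<^bsub>M i\<^esub>" if "i \<in> I" for i
    using ab(5)[OF that ab(2)[OF that]] .
  have add: "x \<oplus>\<^bsub>?D\<^esub> y \<in> carrier ?D" if x: "x \<in> carrier ?D" and y: "y \<in> carrier ?D" for x y
  proof -
    have "{i \<in> I. x i \<oplus>\<^bsub>M i\<^esub> y i \<noteq> \<zero>\<^bsub>M i\<^esub>} \<subseteq> {i \<in> I. x i \<noteq> \<zero>\<^bsub>M i\<^esub>} \<union> {i \<in> I. y i \<noteq> \<zero>\<^bsub>M i\<^esub>}"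
      using lzero by auto
    moreover have "finite ({i \<in> I. x i \<noteq> \<zero>\<^bsub>M i\<^esub>} \<union> {i \<in> I. y i \<noteq> \<zero>\<^bsub>M i\<^esub>})"
      using x y by (simp add: direct_sum_simps)
    ultimately have "finite {i \<in> I. x i \<oplus>\<^bsub>M i\<^esub> y i \<noteq> \<zero>\<^bsub>M i\<^esub>}" by (rule finite_subset)
    moreover have "{i \<in> I. (\<lambda>i\<in>I. x i \<oplus>\<^bsub>M i\<^esub> y i) i \<noteq> \<zero>\<^bsub>M i\<^esub>} = {i \<in> I. x i \<oplus>\<^bsub>M i\<^esub> y i \<noteq> \<zero>\<^bsub>M i\<^esub>}"
      by auto
    ultimately show ?thesis using x y ab(1) unfolding direct_sum_simps by (auto simp: PiE_iff)
  qed
  have smult: "a \<odot>\<^bsub>?D\<^esub> x \<in> carrier ?D" if a: "a \<in> carrier R" and x: "x \<in> carrier ?D" for a x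
  proof -
    have "{i \<in> I. a \<odot>\<^bsub>M i\<^esub> x i \<noteq> \<zero>\<^bsub>M i\<^esub>} \<subseteq> {i \<in> I. x i \<noteq> \<zero>\<^bsub>M i\<^esub>}"
      using module.smult_r_null[OF M a] by auto
    moreover have "finite {i \<in> I. x i \<noteq> \<zero>\<^bsub>M i\<^esub>}" using x by (simp add: direct_sum_simps)
    ultimately have "finite {i \<in> I. a \<odot>\<^bsub>M i\<^esub> x i \<noteq> \<zero>\<^bsub>M i\<^esub>}" by (rule finite_subset)
    moreover have "{i \<in> I. (\<lambda>i\<in>I. a \<odot>\<^bsub>M i\<^esub> x i) i \<noteq> \<zero>\<^bsub>M i\<^esub>} = {i \<in> I. a \<odot>\<^bsub>M i\<^esub> x i \<noteq> \<zero>\<^bsub>M i\<^esub>}"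
      by auto
    ultimately show ?thesis using x mc(3)[OF _ a] unfolding direct_sum_simps by (auto simp: PiE_iff)
  qed
  have zero: "\<zero>\<^bsub>?D\<^esub> \<in> carrier ?D"
  proof -
    have e: "{i \<in> I. (\<lambda>i\<in>I. \<zero>\<^bsub>M i\<^esub>) i \<noteq> \<zero>\<^bsub>M i\<^esub>} = {}" by auto
    show ?thesis unfolding direct_sum_simps e using ab(2) by auto
  qed
  interpret R: cring R by fact
  have inv: "(\<ominus>\<^bsub>R\<^esub> \<one>\<^bsub>R\<^esub>) \<odot>\<^bsub>?D\<^esub> x \<oplus>\<^bsub>?D\<^esub> x = \<zero>\<^bsub>?D\<^esub>"
    and closed: "(\<ominus>\<^bsub>R\<^esub> \<one>\<^bsub>R\<^esub>) \<odot>\<^bsub>?D\<^esub> x \<in> carrier ?D" if x: "x \<in> carrier ?D" for x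
  proof -
    show "(\<ominus>\<^bsub>R\<^esub> \<one>\<^bsub>R\<^esub>) \<odot>\<^bsub>?D\<^esub> x \<in> carrier ?D" using smult x by simp
    have "(\<ominus>\<^bsub>R\<^esub> \<one>\<^bsub>R\<^esub>) \<odot>\<^bsub>M i\<^esub> x i \<oplus>\<^bsub>M i\<^esub> x i = \<zero>\<^bsub>M i\<^esub>" if i: "i \<in> I" for i
    proof -
      have xi: "x i \<in> carrier (M i)" using x i unfolding direct_sum_simps by (auto simp: PiE_iff)
      then show ?thesis
        using mc(4)[OF i xi] abelian_group.l_neg[OF ag[OF i] xi] by simp
    qed
    then show "(\<ominus>\<^bsub>R\<^esub> \<one>\<^bsub>R\<^esub>) \<odot>\<^bsub>?D\<^esub> x \<oplus>\<^bsub>?D\<^esub> x = \<zero>\<^bsub>?D\<^esub>"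
      unfolding direct_sum_simps by (auto intro!: restrict_ext)
  qed
  have mem: "x i \<in> carrier (M i)" if "x \<in> carrier ?D" "i \<in> I" for x i
    using that unfolding direct_sum_simps by (auto simp: PiE_iff)
  have ext: "x = (\<lambda>i\<in>I. x i)" if "x \<in> carrier ?D" for x
    using that unfolding direct_sum_simps by (auto simp: PiE_iff extensional_restrict)
  show ?thesis
  proof (rule moduleI)
    show "abelian_group ?D"
    proof (rule abelian_groupI)
      show "\<zero>\<^bsub>?D\<^esub> \<oplus>\<^bsub>?D\<^esub> x = x" if "x \<in> carrier ?D" for x
      proof -
        have "\<zero>\<^bsub>?D\<^esub> \<oplus>\<^bsub>?D\<^esub> x = (\<lambda>i\<in>I. x i)"
          unfolding direct_sum_simps using ab(5) mem[OF that] by (auto intro!: restrict_ext)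
        then show ?thesis using ext[OF that] by simp
      qed
      show "x \<oplus>\<^bsub>?D\<^esub> y \<oplus>\<^bsub>?D\<^esub> z = x \<oplus>\<^bsub>?D\<^esub> (y \<oplus>\<^bsub>?D\<^esub> z)"
        if "x \<in> carrier ?D" "y \<in> carrier ?D" "z \<in> carrier ?D" for x y z
        using mem[OF that(1)] mem[OF that(2)] mem[OF that(3)] ab(3)
        unfolding direct_sum_simps by (auto intro!: restrict_ext)
      show "x \<oplus>\<^bsub>?D\<^esub> y = y \<oplus>\<^bsub>?D\<^esub> x" if "x \<in> carrier ?D" "y \<in> carrier ?D" for x y
        using mem[OF that(1)] mem[OF that(2)] ab(4)
        unfolding direct_sum_simps by (auto intro!: restrict_ext)
      show "\<exists>y\<in>carrier ?D. y \<oplus>\<^bsub>?D\<^esub> x = \<zero>\<^bsub>?D\<^esub>" if "x \<in> carrier ?D" for x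
        using inv[OF that] closed[OF that] by blast
    qed (use add zero in auto)
    show "\<one>\<^bsub>R\<^esub> \<odot>\<^bsub>?D\<^esub> x = x" if "x \<in> carrier ?D" for x
    proof -
      have "\<one>\<^bsub>R\<^esub> \<odot>\<^bsub>?D\<^esub> x = (\<lambda>i\<in>I. x i)"
        unfolding direct_sum_simps using module.smult_one[OF M] mem[OF that]
        by (auto intro!: restrict_ext)
      then show ?thesis using ext[OF that] by simp
    qed
    show "(a \<oplus>\<^bsub>R\<^esub> b) \<odot>\<^bsub>?D\<^esub> x = a \<odot>\<^bsub>?D\<^esub> x \<oplus>\<^bsub>?D\<^esub> b \<odot>\<^bsub>?D\<^esub> x"
      if "a \<in> carrier R" "b \<in> carrier R" "x \<in> carrier ?D" for a b x
      unfolding direct_sum_simps using module.smult_l_distr[OF M that(1,2)] mem[OF that(3)]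
      by (auto intro!: restrict_ext)
    show "a \<odot>\<^bsub>?D\<^esub> (x \<oplus>\<^bsub>?D\<^esub> y) = a \<odot>\<^bsub>?D\<^esub> x \<oplus>\<^bsub>?D\<^esub> a \<odot>\<^bsub>?D\<^esub> y"
      if "a \<in> carrier R" "x \<in> carrier ?D" "y \<in> carrier ?D" for a x y
      unfolding direct_sum_simps using module.smult_r_distr[OF M that(1)] mem[OF that(2)] mem[OF that(3)]
      by (auto intro!: restrict_ext)
    show "(a \<otimes>\<^bsub>R\<^esub> b) \<odot>\<^bsub>?D\<^esub> x = a \<odot>\<^bsub>?D\<^esub> (b \<odot>\<^bsub>?D\<^esub> x)"
      if "a \<in> carrier R" "b \<in> carrier R" "x \<in> carrier ?D" for a b x
      unfolding direct_sum_simps using module.smult_assoc1[OF M that(1,2)] mem[OF that(3)]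
      by (auto intro!: restrict_ext)
  qed (use smult R in auto)
qed

definition single :: "'i set \<Rightarrow> ('i \<Rightarrow> ('a, 'm) module) \<Rightarrow> 'i \<Rightarrow> 'm \<Rightarrow> 'i \<Rightarrow> 'm" where
  "single I M i z = (\<lambda>j\<in>I. if j = i then z else \<zero>\<^bsub>M j\<^esub>)"

lemma single_hom:
  assumes R: "cring R" and M: "\<And>i. i \<in> I \<Longrightarrow> module R (M i)" and i: "i \<in> I"
  shows "single I M i \<in> mod_hom R (M i) (direct_sum I M)"
proof (rule mod_homI)
  note mc = module_closed[OF M]
  fix x assume x: "x \<in> carrier (M i)"
  have "{j \<in> I. single I M i x j \<noteq> \<zero>\<^bsub>M j\<^esub>} \<subseteq> {i}" by (auto simp: single_def)
  then show "single I M i x \<in> carrier (direct_sum I M)"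
    using x mc(1) finite_subset[of _ "{i}"] unfolding direct_sum_simps
    by (auto simp: single_def)
  show "single I M i (x \<oplus>\<^bsub>M i\<^esub> y) = single I M i x \<oplus>\<^bsub>direct_sum I M\<^esub> single I M i y" for y
    unfolding direct_sum_simps single_def
    using abelian_groupE(5)[OF module.axioms(2)[OF M]] mc(1) by (auto intro!: restrict_ext)
next
  fix a x assume a: "a \<in> carrier R"
  show "single I M i (a \<odot>\<^bsub>M i\<^esub> x) = a \<odot>\<^bsub>direct_sum I M\<^esub> single I M i x"
    unfolding direct_sum_simps single_def
    using module.smult_r_null[OF M a] by (auto intro!: restrict_ext)
qed

lemma direct_sum_in_submodule:
  assumes R: "cring R" and M: "\<And>i. i \<in> I \<Longrightarrow> module R (M i)"
    and H: "submodule H R (direct_sum I M)" and x: "x \<in> carrier (direct_sum I M)"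
    and single: "\<And>i. i \<in> I \<Longrightarrow> x i \<noteq> \<zero>\<^bsub>M i\<^esub> \<Longrightarrow> single I M i (x i) \<in> H"
  shows "x \<in> H"
proof -
  note Hc = submodule_closed[OF direct_sum_module[OF R M] H, simplified]
  note ab = abelian_groupE[OF module.axioms(2)[OF M]]
  have mem: "x i \<in> carrier (M i)" if "i \<in> I" for i
    using x that unfolding direct_sum_simps by (auto simp: PiE_iff)
  have part: "(\<lambda>j\<in>I. if j \<in> T then x j else \<zero>\<^bsub>M j\<^esub>) \<in> H"
    if "finite T" "T \<subseteq> {i \<in> I. x i \<noteq> \<zero>\<^bsub>M i\<^esub>}" for T
    using that
  proof induction
    case empty
    then show ?case using Hc(2) by (simp add: direct_sum_simps restrict_def)
  next
    case (insert i T)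
    have "(\<lambda>j\<in>I. if j \<in> insert i T then x j else \<zero>\<^bsub>M j\<^esub>) =
      single I M i (x i) \<oplus>\<^bsub>direct_sum I M\<^esub> (\<lambda>j\<in>I. if j \<in> T then x j else \<zero>\<^bsub>M j\<^esub>)"
      unfolding direct_sum_simps single_def
    proof (rule restrict_ext)
      fix j assume j: "j \<in> I"
      have "x j \<oplus>\<^bsub>M j\<^esub> \<zero>\<^bsub>M j\<^esub> = x j" using ab(4,5)[OF j] ab(2)[OF j] mem[OF j] by metis
      then show "(if j \<in> insert i T then x j else \<zero>\<^bsub>M j\<^esub>) =
        (\<lambda>j\<in>I. if j = i then x i else \<zero>\<^bsub>M j\<^esub>) j \<oplus>\<^bsub>M j\<^esub> (\<lambda>j\<in>I. if j \<in> T then x j else \<zero>\<^bsub>M j\<^esub>) j"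
        using j insert.hyps(2) ab(5)[OF j] ab(2)[OF j] mem[OF j] by auto
    qed
    moreover have "single I M i (x i) \<in> H" using single insert.prems by auto
    moreover have "(\<lambda>j\<in>I. if j \<in> T then x j else \<zero>\<^bsub>M j\<^esub>) \<in> H"
      by (rule insert.IH) (use insert.prems in blast)
    ultimately show ?case using Hc(3) by (simp only:)
  qed
  have "(\<lambda>j\<in>I. if j \<in> {i \<in> I. x i \<noteq> \<zero>\<^bsub>M i\<^esub>} then x j else \<zero>\<^bsub>M j\<^esub>) \<in> H"
    by (rule part) (use x in \<open>auto simp: direct_sum_simps\<close>)
  moreover have "(\<lambda>j\<in>I. if j \<in> {i \<in> I. x i \<noteq> \<zero>\<^bsub>M i\<^esub>} then x j else \<zero>\<^bsub>M j\<^esub>) = x"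
    using x unfolding direct_sum_simps by (auto simp: PiE_iff extensional_def fun_eq_iff)
  ultimately show ?thesis by simp
qed

lemma free_module_simps:
  "u \<in> carrier (free_module R B) \<longleftrightarrow>
    u \<in> (\<Pi>\<^sub>E p\<in>B. carrier R) \<and> finite {p \<in> B. u p \<noteq> \<zero>\<^bsub>R\<^esub>}"
  "\<zero>\<^bsub>free_module R B\<^esub> = (\<lambda>p\<in>B. \<zero>\<^bsub>R\<^esub>)"
  "u \<oplus>\<^bsub>free_module R B\<^esub> v = (\<lambda>p\<in>B. u p \<oplus>\<^bsub>R\<^esub> v p)"
  "a \<odot>\<^bsub>free_module R B\<^esub> u = (\<lambda>p\<in>B. a \<otimes>\<^bsub>R\<^esub> u p)"
  unfolding free_module_def direct_sum_simps by (auto simp: regular_module_def)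

lemma free_module_module: "cring R \<Longrightarrow> module R (free_module R B)"
  unfolding free_module_def by (rule direct_sum_module) (auto intro: regular_module_module)

lemma basis_vec_in_free:
  assumes "cring R" "p \<in> B" shows "basis_vec R B p \<in> carrier (free_module R B)"
proof -
  interpret cring R by fact
  have "{q \<in> B. basis_vec R B p q \<noteq> \<zero>\<^bsub>R\<^esub>} \<subseteq> {p}" by (auto simp: basis_vec_def)
  then have "finite {q \<in> B. basis_vec R B p q \<noteq> \<zero>\<^bsub>R\<^esub>}" by (rule finite_subset) simp
  then show ?thesis unfolding free_module_simps by (auto simp: basis_vec_def)
qed

lemma free_in_submodule:
  assumes R: "cring R" and H: "submodule H R (free_module R B)"
    and u: "u \<in> carrier (free_module R B)"
    and basis: "\<And>p. p \<in> B \<Longrightarrow> u p \<odot>\<^bsub>free_module R B\<^esub> basis_vec R B p \<in> H"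
  shows "u \<in> H"
  using R _ H[unfolded free_module_def] u[unfolded free_module_def]
proof (rule direct_sum_in_submodule)
  interpret cring R by fact
  fix p assume p: "p \<in> B"
  have up: "u p \<in> carrier R" using u p unfolding free_module_simps by (auto simp: PiE_iff)
  have "single B (\<lambda>_. regular_module R) p (u p) = u p \<odot>\<^bsub>free_module R B\<^esub> basis_vec R B p"
    unfolding free_module_simps single_def basis_vec_def
    using up by (auto intro!: restrict_ext simp: regular_module_def)
  then show "single B (\<lambda>_. regular_module R) p (u p) \<in> H" using basis[OF p] by simp
qed (rule regular_module_module[OF R])

text \<open>The linear map on the free module with \<open>e\<^sub>p \<mapsto> b p\<close>, written with the same sum over the support
that occurs in \<^const>\<open>tensor_map\<close>.\<close>

definition lin_ext ::
  "('a, 'r) ring_scheme \<Rightarrow> ('a, 'n) module \<Rightarrow> 'b set \<Rightarrow> ('b \<Rightarrow> 'n) \<Rightarrow> ('b \<Rightarrow> 'a) \<Rightarrow> 'n" where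
  "lin_ext R Q B b u = (\<Oplus>\<^bsub>Q\<^esub> p\<in>{p \<in> B. u p \<noteq> \<zero>\<^bsub>R\<^esub>}. u p \<odot>\<^bsub>Q\<^esub> b p)"

lemma lin_ext_superset:
  assumes Q: "module R Q" and b: "\<And>p. p \<in> B \<Longrightarrow> b p \<in> carrier Q"
    and u: "u \<in> carrier (free_module R B)"
    and T: "finite T" "{p \<in> B. u p \<noteq> \<zero>\<^bsub>R\<^esub>} \<subseteq> T" "T \<subseteq> B"
  shows "lin_ext R Q B b u = (\<Oplus>\<^bsub>Q\<^esub> p\<in>T. u p \<odot>\<^bsub>Q\<^esub> b p)"
proof -
  interpret module R Q by fact
  have up: "u p \<in> carrier R" if "p \<in> B" for p
    using u that unfolding free_module_simps by (auto simp: PiE_iff)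
  show ?thesis
    unfolding lin_ext_def
  proof (rule M.add.finprod_mono_neutral_cong_left[OF T(1,2)])
    show "u p \<odot>\<^bsub>Q\<^esub> b p = \<zero>\<^bsub>Q\<^esub>" if "p \<in> T - {p \<in> B. u p \<noteq> \<zero>\<^bsub>R\<^esub>}" for p
    proof -
      have "p \<in> B" "u p = \<zero>\<^bsub>R\<^esub>" using that T(3) by auto
      then show ?thesis using b by simp
    qed
    show "(\<lambda>p. u p \<odot>\<^bsub>Q\<^esub> b p) \<in> T \<rightarrow> carrier Q" using up b T(3) by auto
  qed simp
qed

lemma lin_ext_hom:
  assumes Q: "module R Q" and b: "\<And>p. p \<in> B \<Longrightarrow> b p \<in> carrier Q"
  shows "lin_ext R Q B b \<in> mod_hom R (free_module R B) Q"
proof -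
  interpret module R Q by fact
  have up: "u p \<in> carrier R" if "u \<in> carrier (free_module R B)" "p \<in> B" for u p
    using that unfolding free_module_simps by (auto simp: PiE_iff)
  have fin: "finite {p \<in> B. u p \<noteq> \<zero>\<^bsub>R\<^esub>}" if "u \<in> carrier (free_module R B)" for u
    using that unfolding free_module_simps by simp
  note Fc = module_closed[OF free_module_module[OF R.is_cring]]
  note sup = lin_ext_superset[OF Q b]
  show ?thesis
  proof (rule mod_homI)
    fix u assume u: "u \<in> carrier (free_module R B)"
    show "lin_ext R Q B b u \<in> carrier Q"
      unfolding lin_ext_def using up[OF u] b by (intro M.finsum_closed) auto
    fix v assume v: "v \<in> carrier (free_module R B)"
    define T where "T = {p \<in> B. u p \<noteq> \<zero>\<^bsub>R\<^esub>} \<union> {p \<in> B. v p \<noteq> \<zero>\<^bsub>R\<^esub>}"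
    have T: "finite T" "T \<subseteq> B" unfolding T_def using fin[OF u] fin[OF v] by auto
    have uv: "{p \<in> B. (u \<oplus>\<^bsub>free_module R B\<^esub> v) p \<noteq> \<zero>\<^bsub>R\<^esub>} \<subseteq> T"
      unfolding T_def free_module_simps by auto
    have "lin_ext R Q B b (u \<oplus>\<^bsub>free_module R B\<^esub> v) =
        (\<Oplus>\<^bsub>Q\<^esub> p\<in>T. (u \<oplus>\<^bsub>free_module R B\<^esub> v) p \<odot>\<^bsub>Q\<^esub> b p)"
      by (rule sup[OF _ Fc(2)[OF u v] T(1) uv T(2)])
    also have "\<dots> = (\<Oplus>\<^bsub>Q\<^esub> p\<in>T. u p \<odot>\<^bsub>Q\<^esub> b p \<oplus>\<^bsub>Q\<^esub> v p \<odot>\<^bsub>Q\<^esub> b p)"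
    proof (rule M.finsum_cong')
      show "T = T" ..
      show "(\<lambda>p. u p \<odot>\<^bsub>Q\<^esub> b p \<oplus>\<^bsub>Q\<^esub> v p \<odot>\<^bsub>Q\<^esub> b p) \<in> T \<rightarrow> carrier Q"
        using T(2) up[OF u] up[OF v] b by auto
      fix p assume "p \<in> T"
      then have "p \<in> B" using T(2) by auto
      then show "(u \<oplus>\<^bsub>free_module R B\<^esub> v) p \<odot>\<^bsub>Q\<^esub> b p = u p \<odot>\<^bsub>Q\<^esub> b p \<oplus>\<^bsub>Q\<^esub> v p \<odot>\<^bsub>Q\<^esub> b p"
        unfolding free_module_simps using up[OF u] up[OF v] b by (simp add: smult_l_distr)
    qed
    also have "\<dots> = (\<Oplus>\<^bsub>Q\<^esub> p\<in>T. u p \<odot>\<^bsub>Q\<^esub> b p) \<oplus>\<^bsub>Q\<^esub> (\<Oplus>\<^bsub>Q\<^esub> p\<in>T. v p \<odot>\<^bsub>Q\<^esub> b p)"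
      using T(2) up[OF u] up[OF v] b by (intro M.finsum_addf) auto
    also have "(\<Oplus>\<^bsub>Q\<^esub> p\<in>T. u p \<odot>\<^bsub>Q\<^esub> b p) = lin_ext R Q B b u"
      by (rule sup[OF _ u T(1) _ T(2), symmetric]) (auto simp: T_def)
    also have "(\<Oplus>\<^bsub>Q\<^esub> p\<in>T. v p \<odot>\<^bsub>Q\<^esub> b p) = lin_ext R Q B b v"
      by (rule sup[OF _ v T(1) _ T(2), symmetric]) (auto simp: T_def)
    finally show "lin_ext R Q B b (u \<oplus>\<^bsub>free_module R B\<^esub> v) = lin_ext R Q B b u \<oplus>\<^bsub>Q\<^esub> lin_ext R Q B b v" .
  next
    fix a u assume a: "a \<in> carrier R" and u: "u \<in> carrier (free_module R B)"
    define T where "T = {p \<in> B. u p \<noteq> \<zero>\<^bsub>R\<^esub>}"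
    have T: "finite T" "T \<subseteq> B" unfolding T_def using fin[OF u] by auto
    have au: "{p \<in> B. (a \<odot>\<^bsub>free_module R B\<^esub> u) p \<noteq> \<zero>\<^bsub>R\<^esub>} \<subseteq> T"
      unfolding T_def free_module_simps using a by auto
    have "lin_ext R Q B b (a \<odot>\<^bsub>free_module R B\<^esub> u) =
        (\<Oplus>\<^bsub>Q\<^esub> p\<in>T. (a \<odot>\<^bsub>free_module R B\<^esub> u) p \<odot>\<^bsub>Q\<^esub> b p)"
      by (rule sup[OF _ Fc(3)[OF a u] T(1) au T(2)])
    also have "\<dots> = (\<Oplus>\<^bsub>Q\<^esub> p\<in>T. a \<odot>\<^bsub>Q\<^esub> (u p \<odot>\<^bsub>Q\<^esub> b p))"
    proof (rule M.finsum_cong')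
      show "T = T" ..
      show "(\<lambda>p. a \<odot>\<^bsub>Q\<^esub> (u p \<odot>\<^bsub>Q\<^esub> b p)) \<in> T \<rightarrow> carrier Q"
        using T(2) up[OF u] a b by auto
      fix p assume "p \<in> T"
      then have "p \<in> B" using T(2) by auto
      then show "(a \<odot>\<^bsub>free_module R B\<^esub> u) p \<odot>\<^bsub>Q\<^esub> b p = a \<odot>\<^bsub>Q\<^esub> (u p \<odot>\<^bsub>Q\<^esub> b p)"
        unfolding free_module_simps using up[OF u] a b by (simp add: smult_assoc1)
    qed
    also have "\<dots> = a \<odot>\<^bsub>Q\<^esub> lin_ext R Q B b u"
      unfolding lin_ext_def T_def[symmetric]
      using T up[OF u] a b by (intro finsum_smult_ldistr[symmetric]) auto
    finally show "lin_ext R Q B b (a \<odot>\<^bsub>free_module R B\<^esub> u) = a \<odot>\<^bsub>Q\<^esub> lin_ext R Q B b u" .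
  qed
qed

lemma lin_ext_basis:
  assumes Q: "module R Q" and b: "\<And>p. p \<in> B \<Longrightarrow> b p \<in> carrier Q" and p: "p \<in> B"
  shows "lin_ext R Q B b (basis_vec R B p) = b p"
proof -
  interpret module R Q by fact
  have "lin_ext R Q B b (basis_vec R B p) = (\<Oplus>\<^bsub>Q\<^esub> q\<in>{p}. basis_vec R B p q \<odot>\<^bsub>Q\<^esub> b q)"
    using p by (intro lin_ext_superset[OF Q b basis_vec_in_free[OF R.is_cring p]])
      (auto simp: basis_vec_def)
  also have "\<dots> = basis_vec R B p p \<odot>\<^bsub>Q\<^esub> b p \<oplus>\<^bsub>Q\<^esub> \<zero>\<^bsub>Q\<^esub>"
    using b[OF p] p by (subst M.finsum_insert) (auto simp: basis_vec_def)
  also have "\<dots> = b p" using b[OF p] p by (simp add: basis_vec_def)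
  finally show ?thesis .
qed

text \<open>For a free module \<open>F\<close> the submodule \<open>JF\<close> consists of the elements whose coordinates lie in \<open>J\<close>. Everything
below that uses freeness goes through this description.\<close>

lemma free_fin_rank_coordinates:
  assumes R: "cring R" and F: "free_fin_rank R F"
  shows "\<exists>n (c :: nat \<Rightarrow> 'f \<Rightarrow> 'a). (\<forall>k<n. c k \<in> mod_hom R F (regular_module R)) \<and>
    (\<forall>J. ideal J R \<longrightarrow> (\<forall>v\<in>carrier (F :: ('a, 'f) module).
      v \<in> ideal_smult R J F \<longleftrightarrow> (\<forall>k<n. c k v \<in> J)))"
proof -
  interpret cring R by fact
  obtain n where FM: "module R F" and iso: "mod_isomorphic R (free_module R {..<n::nat}) F"
    using F unfolding free_fin_rank_def by blast
  let ?E = "free_module R {..<n::nat}"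
  obtain h where h: "h \<in> mod_hom R ?E F" "bij_betw h (carrier ?E) (carrier F)"
    using iso unfolding mod_isomorphic_def by blast
  have E: "module R ?E" by (rule free_module_module[OF R])
  have RM: "module R (regular_module R)" by (rule regular_module_module[OF R])
  obtain g where g: "g \<in> mod_hom R F ?E" "\<And>v. v \<in> carrier F \<Longrightarrow> h (g v) = v"
    using mod_hom_inverse[OF E FM h] by blast
  note ga = mod_hom_apply[OF FM E g(1)] and ha = mod_hom_apply[OF E FM h(1)]
  have coord: "u k \<in> carrier R" if "u \<in> carrier ?E" "k < n" for u k
    using that unfolding free_module_simps PiE_iff by blast
  define c where "c k v = g v k" for k v
  have c: "c k \<in> mod_hom R F (regular_module R)" if k: "k < n" for k
  proof (rule mod_homI)
    fix v w assume v: "v \<in> carrier F"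
    show "c k v \<in> carrier (regular_module R)"
      unfolding c_def using coord[OF ga(1)[OF v] k] by (simp add: regular_module_def)
    assume w: "w \<in> carrier F"
    show "c k (v \<oplus>\<^bsub>F\<^esub> w) = c k v \<oplus>\<^bsub>regular_module R\<^esub> c k w"
      unfolding c_def ga(2)[OF v w] free_module_simps using k by (simp add: regular_module_def)
  next
    fix a v assume a: "a \<in> carrier R" and v: "v \<in> carrier F"
    show "c k (a \<odot>\<^bsub>F\<^esub> v) = a \<odot>\<^bsub>regular_module R\<^esub> c k v"
      unfolding c_def ga(3)[OF a v] free_module_simps using k by (simp add: regular_module_def)
  qed
  have "v \<in> ideal_smult R J F \<longleftrightarrow> (\<forall>k<n. c k v \<in> J)" if J: "ideal J R" and v: "v \<in> carrier F" for J v
  proof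
    note Jc = ideal_closed[OF J] and JF = ideal_smult_closed[OF FM ideal_closed(1)[OF J]]
    assume vJ: "v \<in> ideal_smult R J F"
    show "\<forall>k<n. c k v \<in> J"
    proof (intro allI impI)
      fix k assume k: "k < n"
      note ca = mod_hom_apply[OF FM RM c[OF k]]
      have J': "submodule J R (regular_module R)"
        by (rule submodule_criterion[OF RM]) (use Jc in \<open>auto simp: regular_module_def\<close>)
      have "ideal_smult R J F \<subseteq> {v \<in> carrier F. c k v \<in> J}"
      proof (rule ideal_smult_least[OF submodule_vimage[OF FM RM c[OF k] J']])
        fix a x assume a: "a \<in> J" and x: "x \<in> carrier F"
        have ac: "a \<in> carrier R" using a Jc(1) by auto
        have "c k x \<in> carrier R" using ca(1)[OF x] by (simp add: regular_module_def)
        then have "a \<otimes>\<^bsub>R\<^esub> c k x \<in> J" using Jc(6)[OF a] by simp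
        then show "a \<odot>\<^bsub>F\<^esub> x \<in> {v \<in> carrier F. c k v \<in> J}"
          using ca(3)[OF ac x] module_closed(3)[OF FM ac x] by (simp add: regular_module_def)
      qed
      then show "c k v \<in> J" using vJ by blast
    qed
  next
    note Jc = ideal_closed[OF J] and JF = ideal_smult_closed[OF FM ideal_closed(1)[OF J]]
    assume cJ: "\<forall>k<n. c k v \<in> J"
    have "g v \<in> {u \<in> carrier ?E. h u \<in> ideal_smult R J F}"
    proof (rule free_in_submodule[OF R submodule_vimage[OF E FM h(1) JF(1)] ga(1)[OF v]])
      fix k assume k: "k \<in> {..<n}"
      have e: "basis_vec R {..<n} k \<in> carrier ?E" by (rule basis_vec_in_free[OF R k])
      have gk: "g v k \<in> J" using cJ k unfolding c_def by simp
      then have gc: "g v k \<in> carrier R" using Jc(1) by auto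
      show "g v k \<odot>\<^bsub>?E\<^esub> basis_vec R {..<n} k \<in> {u \<in> carrier ?E. h u \<in> ideal_smult R J F}"
        using ha(3)[OF gc e] module_closed(3)[OF E gc e] JF(2)[OF gk ha(1)[OF e]] by simp
    qed
    then show "v \<in> ideal_smult R J F" using g(2)[OF v] by simp
  qed
  then show ?thesis using c by blast
qed

section \<open>Tensor products\<close>

definition bilinear ::
  "('a, 'r) ring_scheme \<Rightarrow> ('a, 'm) module \<Rightarrow> ('a, 'n) module \<Rightarrow> ('a, 'q) module
     \<Rightarrow> ('m \<Rightarrow> 'n \<Rightarrow> 'q) \<Rightarrow> bool" where
  "bilinear R M N Q b \<longleftrightarrow>
     (\<forall>x\<in>carrier M. \<forall>y\<in>carrier N. b x y \<in> carrier Q) \<and>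
     (\<forall>x\<in>carrier M. \<forall>x'\<in>carrier M. \<forall>y\<in>carrier N. b (x \<oplus>\<^bsub>M\<^esub> x') y = b x y \<oplus>\<^bsub>Q\<^esub> b x' y) \<and>
     (\<forall>x\<in>carrier M. \<forall>y\<in>carrier N. \<forall>y'\<in>carrier N. b x (y \<oplus>\<^bsub>N\<^esub> y') = b x y \<oplus>\<^bsub>Q\<^esub> b x y') \<and>
     (\<forall>a\<in>carrier R. \<forall>x\<in>carrier M. \<forall>y\<in>carrier N. b (a \<odot>\<^bsub>M\<^esub> x) y = a \<odot>\<^bsub>Q\<^esub> b x y) \<and>
     (\<forall>a\<in>carrier R. \<forall>x\<in>carrier M. \<forall>y\<in>carrier N. b x (a \<odot>\<^bsub>N\<^esub> y) = a \<odot>\<^bsub>Q\<^esub> b x y)"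

lemma bilinearD:
  assumes "bilinear R M N Q b"
  shows "\<And>x y. x \<in> carrier M \<Longrightarrow> y \<in> carrier N \<Longrightarrow> b x y \<in> carrier Q"
    and "\<And>x x' y. x \<in> carrier M \<Longrightarrow> x' \<in> carrier M \<Longrightarrow> y \<in> carrier N \<Longrightarrow>
      b (x \<oplus>\<^bsub>M\<^esub> x') y = b x y \<oplus>\<^bsub>Q\<^esub> b x' y"
    and "\<And>x y y'. x \<in> carrier M \<Longrightarrow> y \<in> carrier N \<Longrightarrow> y' \<in> carrier N \<Longrightarrow>
      b x (y \<oplus>\<^bsub>N\<^esub> y') = b x y \<oplus>\<^bsub>Q\<^esub> b x y'"
    and "\<And>a x y. a \<in> carrier R \<Longrightarrow> x \<in> carrier M \<Longrightarrow> y \<in> carrier N \<Longrightarrow>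
      b (a \<odot>\<^bsub>M\<^esub> x) y = a \<odot>\<^bsub>Q\<^esub> b x y"
    and "\<And>a x y. a \<in> carrier R \<Longrightarrow> x \<in> carrier M \<Longrightarrow> y \<in> carrier N \<Longrightarrow>
      b x (a \<odot>\<^bsub>N\<^esub> y) = a \<odot>\<^bsub>Q\<^esub> b x y"
  using assms unfolding bilinear_def by simp_all

lemma tensor_structure:
  assumes M: "module R M" and N: "module R N"
  shows "module R (tensor_free R M N)"
    and "tensor_rels R M N \<subseteq> carrier (tensor_free R M N)"
    and "submodule (tensor_kernel R M N) R (tensor_free R M N)"
    and "tensor_rels R M N \<subseteq> tensor_kernel R M N"
    and "module R (tensor_product R M N)"
proof -
  have R: "cring R" using module.axioms(1)[OF M] .
  show F: "module R (tensor_free R M N)" unfolding tensor_free_def by (rule free_module_module[OF R])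
  interpret F: module R "tensor_free R M N" by (rule F)
  have e: "basis_vec R (carrier M \<times> carrier N) (x, y) \<in> carrier (tensor_free R M N)"
    if "x \<in> carrier M" "y \<in> carrier N" for x y
    unfolding tensor_free_def using that by (intro basis_vec_in_free[OF R]) auto
  show rels: "tensor_rels R M N \<subseteq> carrier (tensor_free R M N)"
    unfolding tensor_rels_def Let_def
    using module_closed(2,3)[OF M] module_closed(2,3)[OF N] by (auto intro!: F.M.minus_closed F.smult_closed F.M.a_closed e)
  show K: "submodule (tensor_kernel R M N) R (tensor_free R M N)"
    and "tensor_rels R M N \<subseteq> tensor_kernel R M N"
    unfolding tensor_kernel_def using submodule_span_closed[OF F rels] by auto
  show "module R (tensor_product R M N)"
    unfolding tensor_product_def by (rule quot_module_module[OF F K])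
qed

lemma tensor_basis:
  assumes "module R M" and "x \<in> carrier M" "y \<in> carrier N"
  shows "basis_vec R (carrier M \<times> carrier N) (x, y) \<in> carrier (tensor_free R M N)"
  unfolding tensor_free_def using assms by (intro basis_vec_in_free module.axioms(1)[OF assms(1)]) auto

lemma tensor_relsI:
  fixes R :: "('a, 'r) ring_scheme" and M :: "('a, 'm) module" and N :: "('a, 'n) module"
  defines "e \<equiv> \<lambda>x y. basis_vec R (carrier M \<times> carrier N) (x, y)" and "F \<equiv> tensor_free R M N"
  shows "\<And>x x' y. x \<in> carrier M \<Longrightarrow> x' \<in> carrier M \<Longrightarrow> y \<in> carrier N \<Longrightarrow>
      e (x \<oplus>\<^bsub>M\<^esub> x') y \<ominus>\<^bsub>F\<^esub> (e x y \<oplus>\<^bsub>F\<^esub> e x' y) \<in> tensor_rels R M N"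
    and "\<And>x y y'. x \<in> carrier M \<Longrightarrow> y \<in> carrier N \<Longrightarrow> y' \<in> carrier N \<Longrightarrow>
      e x (y \<oplus>\<^bsub>N\<^esub> y') \<ominus>\<^bsub>F\<^esub> (e x y \<oplus>\<^bsub>F\<^esub> e x y') \<in> tensor_rels R M N"
    and "\<And>a x y. a \<in> carrier R \<Longrightarrow> x \<in> carrier M \<Longrightarrow> y \<in> carrier N \<Longrightarrow>
      e (a \<odot>\<^bsub>M\<^esub> x) y \<ominus>\<^bsub>F\<^esub> (a \<odot>\<^bsub>F\<^esub> e x y) \<in> tensor_rels R M N"
    and "\<And>a x y. a \<in> carrier R \<Longrightarrow> x \<in> carrier M \<Longrightarrow> y \<in> carrier N \<Longrightarrow>
      e x (a \<odot>\<^bsub>N\<^esub> y) \<ominus>\<^bsub>F\<^esub> (a \<odot>\<^bsub>F\<^esub> e x y) \<in> tensor_rels R M N"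
  unfolding tensor_rels_def Let_def e_def F_def by fast+

lemma pure_tensor_bilinear:
  assumes M: "module R M" and N: "module R N"
  shows "bilinear R M N (tensor_product R M N) (pure_tensor R M N)"
proof -
  note T = tensor_structure[OF M N] and Mc = module_closed[OF M] and Nc = module_closed[OF N]
  note q = quot_module_facts[OF T(1,3), folded tensor_product_def]
  note Fc = module_closed[OF T(1)]
  note e = tensor_basis[OF M]
  have mem: "pure_tensor R M N x y \<in> carrier (tensor_product R M N)"
    if "x \<in> carrier M" "y \<in> carrier N" for x y
    unfolding pure_tensor_def q(1) using e[OF that] by simp
  have rel: "\<alpha> \<ominus>\<^bsub>tensor_free R M N\<^esub> \<beta> \<in> tensor_kernel R M N"
    if "\<alpha> \<ominus>\<^bsub>tensor_free R M N\<^esub> \<beta> \<in> tensor_rels R M N" for \<alpha> \<beta>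
    using that T(4) by auto
  show ?thesis
    unfolding bilinear_def
  proof (intro conjI ballI)
    fix x x' y assume xy: "x \<in> carrier M" "x' \<in> carrier M" "y \<in> carrier N"
    show "pure_tensor R M N (x \<oplus>\<^bsub>M\<^esub> x') y =
      pure_tensor R M N x y \<oplus>\<^bsub>tensor_product R M N\<^esub> pure_tensor R M N x' y"
      unfolding pure_tensor_def q(4)[OF e[OF xy(1,3)] e[OF xy(2,3)]]
      by (subst q(2)[OF e[OF Mc(2)[OF xy(1,2)] xy(3)] Fc(2)[OF e[OF xy(1,3)] e[OF xy(2,3)]]], rule rel)
        (use xy in \<open>blast intro: tensor_relsI\<close>)
  next
    fix x y y' assume xy: "x \<in> carrier M" "y \<in> carrier N" "y' \<in> carrier N"
    show "pure_tensor R M N x (y \<oplus>\<^bsub>N\<^esub> y') =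
      pure_tensor R M N x y \<oplus>\<^bsub>tensor_product R M N\<^esub> pure_tensor R M N x y'"
      unfolding pure_tensor_def q(4)[OF e[OF xy(1,2)] e[OF xy(1,3)]]
      by (subst q(2)[OF e[OF xy(1) Nc(2)[OF xy(2,3)]] Fc(2)[OF e[OF xy(1,2)] e[OF xy(1,3)]]], rule rel)
        (use xy in \<open>blast intro: tensor_relsI\<close>)
  next
    fix a x y assume xy: "a \<in> carrier R" "x \<in> carrier M" "y \<in> carrier N"
    show "pure_tensor R M N (a \<odot>\<^bsub>M\<^esub> x) y = a \<odot>\<^bsub>tensor_product R M N\<^esub> pure_tensor R M N x y"
      unfolding pure_tensor_def q(5)[OF xy(1) e[OF xy(2,3)]]
      by (subst q(2)[OF e[OF Mc(3)[OF xy(1,2)] xy(3)] Fc(3)[OF xy(1) e[OF xy(2,3)]]], rule rel)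
        (use xy in \<open>blast intro: tensor_relsI\<close>)
    show "pure_tensor R M N x (a \<odot>\<^bsub>N\<^esub> y) = a \<odot>\<^bsub>tensor_product R M N\<^esub> pure_tensor R M N x y"
      unfolding pure_tensor_def q(5)[OF xy(1) e[OF xy(2,3)]]
      by (subst q(2)[OF e[OF xy(2) Nc(3)[OF xy(1,3)]] Fc(3)[OF xy(1) e[OF xy(2,3)]]], rule rel)
        (use xy in \<open>blast intro: tensor_relsI\<close>)
  qed (rule mem)
qed

text \<open>The universal property of the tensor product: the linear extension of a bilinear map kills the
defining relations, hence the submodule they span.\<close>

lemma tensor_kernel_lin_ext:
  assumes M: "module R M" and N: "module R N" and Q: "module R Q" and b: "bilinear R M N Q b"
    and u: "u \<in> tensor_kernel R M N"
  shows "lin_ext R Q (carrier M \<times> carrier N) (\<lambda>p. b (fst p) (snd p)) u = \<zero>\<^bsub>Q\<^esub>"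
proof -
  let ?h = "lin_ext R Q (carrier M \<times> carrier N) (\<lambda>p. b (fst p) (snd p))"
  note T = tensor_structure[OF M N] and Mc = module_closed[OF M] and Nc = module_closed[OF N]
  note Qc = module_closed[OF Q]
  interpret Q: module R Q by (rule Q)
  interpret F: module R "tensor_free R M N" by (rule T(1))
  have bc: "b (fst p) (snd p) \<in> carrier Q" if "p \<in> carrier M \<times> carrier N" for p
    using that b unfolding bilinear_def by auto
  have h: "?h \<in> mod_hom R (tensor_free R M N) Q"
    unfolding tensor_free_def by (rule lin_ext_hom[OF Q bc])
  note ha = mod_hom_apply[OF T(1) Q h] and e = tensor_basis[OF M]
  have he: "?h (basis_vec R (carrier M \<times> carrier N) (x, y)) = b x y"
    if "x \<in> carrier M" "y \<in> carrier N" for x y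
    using lin_ext_basis[where b = "\<lambda>p. b (fst p) (snd p)" and p = "(x, y)", OF Q bc] that
    by simp
  have bq: "b x y \<in> carrier Q" if "x \<in> carrier M" "y \<in> carrier N" for x y
    using bc[of "(x, y)"] that by simp
  have zero: "z \<ominus>\<^bsub>Q\<^esub> z = \<zero>\<^bsub>Q\<^esub>" if "z \<in> carrier Q" for z
    unfolding a_minus_def using that by (rule Q.M.r_neg)
  have "tensor_rels R M N \<subseteq> {u \<in> carrier (tensor_free R M N). ?h u \<in> {\<zero>\<^bsub>Q\<^esub>}}"
  proof
    fix u assume u: "u \<in> tensor_rels R M N"
    have "?h u = \<zero>\<^bsub>Q\<^esub>"
      using u unfolding tensor_rels_def Let_def
      by (auto simp: ha e Mc Nc he bq zero bilinearD(2-5)[OF b])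
    then show "u \<in> {u \<in> carrier (tensor_free R M N). ?h u \<in> {\<zero>\<^bsub>Q\<^esub>}}" using u T(2) by auto
  qed
  then have "tensor_kernel R M N \<subseteq> {u \<in> carrier (tensor_free R M N). ?h u \<in> {\<zero>\<^bsub>Q\<^esub>}}"
    unfolding tensor_kernel_def
    by (rule submodule_span_least[OF submodule_vimage[OF T(1) Q h submodule_zero[OF Q]]])
  then show ?thesis using u by auto
qed

lemma bilinear_comp_right:
  assumes M: "module R M" and N: "module R N" and N': "module R N'"
    and b: "bilinear R M N' Q b" and f: "f \<in> mod_hom R N N'"
  shows "bilinear R M N Q (\<lambda>x y. b x (f y))"
  unfolding bilinear_def
  by (simp add: mod_hom_apply[OF N N' f] bilinearD[OF b])

lemma bilinear_zero_right:
  assumes M: "module R M" and N: "module R N" and Q: "module R Q"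
    and b: "bilinear R M N Q b" and x: "x \<in> carrier M"
  shows "b x \<zero>\<^bsub>N\<^esub> = \<zero>\<^bsub>Q\<^esub>"
proof -
  interpret N: module R N by fact
  interpret Q: module R Q by fact
  show ?thesis
    using bilinearD(5)[OF b N.R.zero_closed x N.M.zero_closed] bilinearD(1)[OF b x N.M.zero_closed]
    by simp
qed

text \<open>The sum that defines \<^const>\<open>tensor_map\<close> is the linear extension of a bilinear map, so it is
constant on cosets and any representative computes it.\<close>

lemma tensor_map_coset:
  assumes M: "module R M" and N: "module R N" and N': "module R N'"
    and f: "f \<in> mod_hom R N N'" and u: "u \<in> carrier (tensor_free R M N)"
  shows "tensor_map R M N N' f (tensor_kernel R M N +>\<^bsub>tensor_free R M N\<^esub> u) =
    lin_ext R (tensor_product R M N') (carrier M \<times> carrier N)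
      (\<lambda>p. pure_tensor R M N' (fst p) (f (snd p))) u"
proof -
  let ?Q = "tensor_product R M N'" and ?K = "tensor_kernel R M N" and ?F = "tensor_free R M N"
  let ?h = "lin_ext R ?Q (carrier M \<times> carrier N) (\<lambda>p. pure_tensor R M N' (fst p) (f (snd p)))"
  note T = tensor_structure[OF M N]
  have Q: "module R ?Q" by (rule tensor_structure[OF M N'])
  have b: "bilinear R M N ?Q (\<lambda>x y. pure_tensor R M N' x (f y))"
    by (rule bilinear_comp_right[OF M N N' pure_tensor_bilinear[OF M N'] f])
  have bc: "pure_tensor R M N' (fst p) (f (snd p)) \<in> carrier ?Q" if "p \<in> carrier M \<times> carrier N" for p
    using that b unfolding bilinear_def by auto
  have h: "?h \<in> mod_hom R ?F ?Q"
    unfolding tensor_free_def by (rule lin_ext_hom[OF Q bc])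
  note ha = mod_hom_apply[OF T(1) Q h] and q = quot_module_facts[OF T(1,3)]
  interpret Q: module R ?Q by (rule Q)
  interpret F: module R ?F by (rule T(1))
  have const: "?h v = ?h u" if v: "v \<in> ?K +>\<^bsub>?F\<^esub> u" for v
  proof -
    have vc: "v \<in> carrier ?F" "?K +>\<^bsub>?F\<^esub> v = ?K +>\<^bsub>?F\<^esub> u" using q(6)[OF u v] by auto
    then have "v \<ominus>\<^bsub>?F\<^esub> u \<in> ?K" using q(2)[OF vc(1) u] by simp
    then have "?h (v \<ominus>\<^bsub>?F\<^esub> u) = \<zero>\<^bsub>?Q\<^esub>" by (rule tensor_kernel_lin_ext[OF M N Q b])
    then have "?h v \<ominus>\<^bsub>?Q\<^esub> ?h u = \<zero>\<^bsub>?Q\<^esub>" using ha(5)[OF vc(1) u] by simp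
    then show ?thesis
      using Q.M.minus_equality[of "?h v" "\<ominus>\<^bsub>?Q\<^esub> ?h u"] ha(1)[OF vc(1)] ha(1)[OF u]
      by (simp add: a_minus_def)
  qed
  have "tensor_map R M N N' f (?K +>\<^bsub>?F\<^esub> u) = the_elem (?h ` (?K +>\<^bsub>?F\<^esub> u))"
    unfolding tensor_map_def lin_ext_def ..
  also have "\<dots> = ?h u"
  proof (rule the_elem_image_unique)
    show "?K +>\<^bsub>?F\<^esub> u \<noteq> {}" using q(7)[OF u] by blast
  qed (rule const)
  finally show ?thesis .
qed


lemma tensor_map_pure:
  assumes M: "module R M" and N: "module R N" and N': "module R N'"
    and f: "f \<in> mod_hom R N N'" and xy: "x \<in> carrier M" "y \<in> carrier N"
  shows "tensor_map R M N N' f (pure_tensor R M N x y) = pure_tensor R M N' x (f y)"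
proof -
  have b: "pure_tensor R M N' (fst p) (f (snd p)) \<in> carrier (tensor_product R M N')"
    if "p \<in> carrier M \<times> carrier N" for p
    using bilinearD(1)[OF pure_tensor_bilinear[OF M N']] mod_hom_apply(1)[OF N N' f] that by auto
  show ?thesis
    unfolding pure_tensor_def[of R M N] tensor_map_coset[OF M N N' f tensor_basis[OF M xy]]
    using lin_ext_basis[where b = "\<lambda>p. pure_tensor R M N' (fst p) (f (snd p))" and p = "(x, y)",
        OF tensor_structure(5)[OF M N'] b] xy
    by simp
qed

lemma tensor_map_zero:
  assumes M: "module R M" and N: "module R N" and N': "module R N'"
    and f: "f \<in> mod_hom R N N'" and zero: "\<And>y. y \<in> carrier N \<Longrightarrow> f y = \<zero>\<^bsub>N'\<^esub>"
    and t: "t \<in> carrier (tensor_product R M N)"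
  shows "tensor_map R M N N' f t = \<zero>\<^bsub>tensor_product R M N'\<^esub>"
proof -
  let ?Q = "tensor_product R M N'"
  note T = tensor_structure[OF M N]
  have Q: "module R ?Q" by (rule tensor_structure[OF M N'])
  interpret Q: module R ?Q by (rule Q)
  obtain u where u: "u \<in> carrier (tensor_free R M N)"
    and t': "t = tensor_kernel R M N +>\<^bsub>tensor_free R M N\<^esub> u"
    using t unfolding tensor_product_def quot_module_facts(1)[OF T(1,3)] by blast
  have p0: "pure_tensor R M N' (fst p) (f (snd p)) = \<zero>\<^bsub>?Q\<^esub>"
    if "p \<in> carrier M \<times> carrier N" for p
    using bilinear_zero_right[OF M N' Q pure_tensor_bilinear[OF M N']] zero that by auto
  have up: "u p \<in> carrier R" if "p \<in> carrier M \<times> carrier N" for p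
    using u that unfolding tensor_free_def free_module_simps PiE_iff by blast
  show ?thesis
    unfolding t' tensor_map_coset[OF M N N' f u] lin_ext_def
    by (rule Q.M.add.finprod_one_eqI) (use p0 up in auto)
qed

lemma tensor_zero_mem:
  assumes M: "module R M" and N: "module R N"
  shows "\<zero>\<^bsub>tensor_product R M N\<^esub> \<in> carrier (tensor_product R M N)"
  by (rule module_closed(1)[OF tensor_structure(5)[OF M N]])

section \<open>Cyclic modules\<close>

text \<open>The quotient \<open>R/J\<close>, built from the free module of rank one so that its elements have the type of the
test modules in the flatness hypothesis.\<close>

definition cyclic_class :: "('a, 'r) ring_scheme \<Rightarrow> 'a set \<Rightarrow> 'a \<Rightarrow> (nat \<Rightarrow> 'a) set" where
  "cyclic_class R J a = {v \<in> carrier (free_module R {0}). v 0 \<in> J} +>\<^bsub>free_module R {0}\<^esub> (\<lambda>i\<in>{0}. a)"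

definition cyclic_module :: "('a, 'r) ring_scheme \<Rightarrow> 'a set \<Rightarrow> ('a, (nat \<Rightarrow> 'a) set) module" where
  "cyclic_module R J = quot_module (free_module R {0}) {v \<in> carrier (free_module R {0}). v 0 \<in> J}"

context cring
begin

lemma cyclic_module_facts:
  assumes J: "ideal J R"
  shows "module R (cyclic_module R J)"
    and "carrier (cyclic_module R J) = cyclic_class R J ` carrier R"
    and "\<And>a b. a \<in> carrier R \<Longrightarrow> b \<in> carrier R \<Longrightarrow>
      cyclic_class R J a = cyclic_class R J b \<longleftrightarrow> a \<ominus> b \<in> J"
    and "\<zero>\<^bsub>cyclic_module R J\<^esub> = cyclic_class R J \<zero>"
    and "\<And>a b. a \<in> carrier R \<Longrightarrow> b \<in> carrier R \<Longrightarrow>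
      cyclic_class R J a \<oplus>\<^bsub>cyclic_module R J\<^esub> cyclic_class R J b = cyclic_class R J (a \<oplus> b)"
    and "\<And>a b. a \<in> carrier R \<Longrightarrow> b \<in> carrier R \<Longrightarrow>
      a \<odot>\<^bsub>cyclic_module R J\<^esub> cyclic_class R J b = cyclic_class R J (a \<otimes> b)"
proof -
  let ?F = "free_module R {0::nat}" and ?H = "{v \<in> carrier (free_module R {0::nat}). v 0 \<in> J}"
  let ?v = "\<lambda>a. (\<lambda>i\<in>{0::nat}. a)"
  note Jc = ideal_closed[OF J]
  have F: "module R ?F" by (rule free_module_module[OF is_cring])
  interpret F: module R ?F by (rule F)
  have vc: "?v a \<in> carrier ?F" if "a \<in> carrier R" for a
    using that unfolding free_module_simps by auto
  have carr: "\<exists>a\<in>carrier R. w = ?v a" if "w \<in> carrier ?F" for w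
  proof -
    have "w = ?v (w 0)" "w 0 \<in> carrier R"
      using that unfolding free_module_simps
      by (auto simp: PiE_iff extensional_def fun_eq_iff)
    then show ?thesis by blast
  qed
  have H: "submodule ?H R ?F"
  proof (rule submodule_criterion[OF F])
    show "\<zero>\<^bsub>?F\<^esub> \<in> ?H" using F.M.zero_closed Jc(2) by (simp add: free_module_simps(2))
    show "x \<oplus>\<^bsub>?F\<^esub> y \<in> ?H" if "x \<in> ?H" "y \<in> ?H" for x y
      using that F.M.a_closed[of x y] Jc(3)[of "x 0" "y 0"] by (simp add: free_module_simps(3))
    show "a \<odot>\<^bsub>?F\<^esub> x \<in> ?H" if "a \<in> carrier R" "x \<in> ?H" for a x
      using that F.smult_closed[of a x] Jc(5)[of "x 0" a] by (simp add: free_module_simps(4))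
  qed auto
  note q = quot_module_facts[OF F H, folded cyclic_module_def]
  show "module R (cyclic_module R J)"
    unfolding cyclic_module_def by (rule quot_module_module[OF F H])
  show "carrier (cyclic_module R J) = cyclic_class R J ` carrier R"
    unfolding q(1) cyclic_class_def using carr vc by fast
  have add: "?v a \<oplus>\<^bsub>?F\<^esub> ?v b = ?v (a \<oplus> b)" for a b
    unfolding free_module_simps by (rule restrict_ext) simp
  have smult: "a \<odot>\<^bsub>?F\<^esub> ?v b = ?v (a \<otimes> b)" for a b
    unfolding free_module_simps by (rule restrict_ext) simp
  have minus: "?v a \<ominus>\<^bsub>?F\<^esub> ?v b = ?v (a \<ominus> b)" if "a \<in> carrier R" "b \<in> carrier R" for a b
  proof -
    have "?v a \<ominus>\<^bsub>?F\<^esub> ?v b = ?v a \<oplus>\<^bsub>?F\<^esub> (\<ominus> \<one>) \<odot>\<^bsub>?F\<^esub> ?v b"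
      unfolding a_minus_def module_closed(4)[OF F vc[OF that(2)]] ..
    also have "\<dots> = ?v (a \<oplus> (\<ominus> \<one>) \<otimes> b)" unfolding smult add ..
    also have "a \<oplus> (\<ominus> \<one>) \<otimes> b = a \<ominus> b" using that by (simp add: l_minus a_minus_def)
    finally show ?thesis .
  qed
  show "cyclic_class R J a = cyclic_class R J b \<longleftrightarrow> a \<ominus> b \<in> J"
    if "a \<in> carrier R" "b \<in> carrier R" for a b
    unfolding cyclic_class_def q(2)[OF vc[OF that(1)] vc[OF that(2)]] minus[OF that]
    using vc[of "a \<ominus> b"] that by simp
  have "\<zero>\<^bsub>?F\<^esub> = ?v \<zero>" unfolding free_module_simps ..
  then show "\<zero>\<^bsub>cyclic_module R J\<^esub> = cyclic_class R J \<zero>"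
    unfolding q(3) cyclic_class_def by simp
  show "cyclic_class R J a \<oplus>\<^bsub>cyclic_module R J\<^esub> cyclic_class R J b = cyclic_class R J (a \<oplus> b)"
    if "a \<in> carrier R" "b \<in> carrier R" for a b
    unfolding cyclic_class_def q(4)[OF vc[OF that(1)] vc[OF that(2)]] add ..
  show "a \<odot>\<^bsub>cyclic_module R J\<^esub> cyclic_class R J b = cyclic_class R J (a \<otimes> b)"
    if "a \<in> carrier R" "b \<in> carrier R" for a b
    unfolding cyclic_class_def q(5)[OF that(1) vc[OF that(2)]] smult ..
qed

lemma cyclic_class_cong:
  assumes J: "ideal J R" and ab: "a \<in> carrier R" "b \<in> carrier R" and "a \<ominus> b \<in> J"
  shows "cyclic_class R J a = cyclic_class R J b"
  using cyclic_module_facts(3)[OF J ab] assms(4) by simp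

definition cyclic_rep :: "'a set \<Rightarrow> (nat \<Rightarrow> 'a) set \<Rightarrow> 'a" where
  "cyclic_rep J Y = (SOME a. a \<in> carrier R \<and> Y = cyclic_class R J a)"

lemma cyclic_rep:
  assumes J: "ideal J R" and a: "a \<in> carrier R"
  shows "cyclic_rep J (cyclic_class R J a) \<in> carrier R"
    and "cyclic_rep J (cyclic_class R J a) \<ominus> a \<in> J"
proof -
  have "cyclic_rep J (cyclic_class R J a) \<in> carrier R \<and>
      cyclic_class R J a = cyclic_class R J (cyclic_rep J (cyclic_class R J a))"
    unfolding cyclic_rep_def by (rule someI[of _ a]) (use a in simp)
  then show "cyclic_rep J (cyclic_class R J a) \<in> carrier R"
    and "cyclic_rep J (cyclic_class R J a) \<ominus> a \<in> J"
    using cyclic_module_facts(3)[OF J _ a, of "cyclic_rep J (cyclic_class R J a)"] by auto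
qed

definition cyclic_map :: "'a set \<Rightarrow> 'a set \<Rightarrow> 'a \<Rightarrow> (nat \<Rightarrow> 'a) set \<Rightarrow> (nat \<Rightarrow> 'a) set" where
  "cyclic_map J J' s Y = cyclic_class R J' (s \<otimes> cyclic_rep J Y)"

lemma cyclic_map:
  assumes J: "ideal J R" and J': "ideal J' R" and s: "s \<in> carrier R"
    and sub: "\<forall>a\<in>J. s \<otimes> a \<in> J'"
  shows "\<And>a. a \<in> carrier R \<Longrightarrow> cyclic_map J J' s (cyclic_class R J a) = cyclic_class R J' (s \<otimes> a)"
    and "cyclic_map J J' s \<in> mod_hom R (cyclic_module R J) (cyclic_module R J')"
proof -
  show eq: "cyclic_map J J' s (cyclic_class R J a) = cyclic_class R J' (s \<otimes> a)" if a: "a \<in> carrier R" for a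
  proof -
    note r = cyclic_rep[OF J a]
    have "s \<otimes> cyclic_rep J (cyclic_class R J a) \<ominus> s \<otimes> a = s \<otimes> (cyclic_rep J (cyclic_class R J a) \<ominus> a)"
      using r(1) a s by algebra
    then show ?thesis
      unfolding cyclic_map_def using r a s sub by (intro cyclic_class_cong[OF J']) auto
  qed
  note C = cyclic_module_facts[OF J] and C' = cyclic_module_facts[OF J']
  show "cyclic_map J J' s \<in> mod_hom R (cyclic_module R J) (cyclic_module R J')"
  proof (rule mod_homI)
    fix Y assume "Y \<in> carrier (cyclic_module R J)"
    then obtain a where a: "a \<in> carrier R" "Y = cyclic_class R J a" unfolding C(2) by blast
    show "cyclic_map J J' s Y \<in> carrier (cyclic_module R J')"
      unfolding a(2) eq[OF a(1)] C'(2) using a(1) s by simp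
    fix Z assume "Z \<in> carrier (cyclic_module R J)"
    then obtain b where b: "b \<in> carrier R" "Z = cyclic_class R J b" unfolding C(2) by blast
    show "cyclic_map J J' s (Y \<oplus>\<^bsub>cyclic_module R J\<^esub> Z) =
        cyclic_map J J' s Y \<oplus>\<^bsub>cyclic_module R J'\<^esub> cyclic_map J J' s Z"
      unfolding a(2) b(2) using a(1) b(1) s by (simp add: C(5) C'(5) eq r_distr)
  next
    fix r Y assume r: "r \<in> carrier R" and "Y \<in> carrier (cyclic_module R J)"
    then obtain a where a: "a \<in> carrier R" "Y = cyclic_class R J a" unfolding C(2) by blast
    show "cyclic_map J J' s (r \<odot>\<^bsub>cyclic_module R J\<^esub> Y) = r \<odot>\<^bsub>cyclic_module R J'\<^esub> cyclic_map J J' s Y"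
      unfolding a(2) using a(1) r s by (simp add: C(6) C'(6) eq m_lcomm)
  qed
qed

text \<open>For \<open>a \<in> J\<close> the scalar in \<open>a x \<otimes> z = x \<otimes> a z\<close> kills \<open>R/J\<close>; this gives one half of
\<open>M \<otimes> R/J \<cong> M/JM\<close>.\<close>

lemma tensor_cyclic_zero:
  assumes M: "module R M" and J: "ideal J R" and y: "y \<in> ideal_smult R J M"
    and Z: "Z \<in> carrier (cyclic_module R J)"
  shows "pure_tensor R M (cyclic_module R J) y Z = \<zero>\<^bsub>tensor_product R M (cyclic_module R J)\<^esub>"
proof -
  let ?C = "cyclic_module R J" and ?T = "tensor_product R M (cyclic_module R J)"
  note C = cyclic_module_facts[OF J] and Jc = ideal_closed[OF J] and Mc = module_closed[OF M]
  note b = bilinearD[OF pure_tensor_bilinear[OF M C(1)]]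
  have T: "module R ?T" by (rule tensor_structure(5)[OF M C(1)])
  interpret T: module R ?T by (rule T)
  have hom: "(\<lambda>x. pure_tensor R M ?C x Z) \<in> mod_hom R M ?T"
    by (rule mod_homI) (simp_all add: b Z)
  have "ideal_smult R J M \<subseteq> {x \<in> carrier M. pure_tensor R M ?C x Z \<in> {\<zero>\<^bsub>?T\<^esub>}}"
  proof (rule ideal_smult_least[OF submodule_vimage[OF M T hom submodule_zero[OF T]]])
    fix a x assume a: "a \<in> J" and x: "x \<in> carrier M"
    have ac: "a \<in> carrier R" using a Jc(1) by auto
    obtain c where c: "c \<in> carrier R" "Z = cyclic_class R J c" using Z unfolding C(2) by blast
    have "a \<otimes> c \<ominus> \<zero> \<in> J" using Jc(6)[OF a c(1)] Jc(1) by (auto simp: a_minus_def)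
    then have "a \<odot>\<^bsub>?C\<^esub> Z = \<zero>\<^bsub>?C\<^esub>"
      unfolding c(2) C(4) C(6)[OF ac c(1)] using ac c(1) by (intro cyclic_class_cong[OF J]) auto
    then have "pure_tensor R M ?C (a \<odot>\<^bsub>M\<^esub> x) Z = pure_tensor R M ?C x \<zero>\<^bsub>?C\<^esub>"
      using b(4)[OF ac x Z] b(5)[OF ac x Z] by simp
    also have "\<dots> = \<zero>\<^bsub>?T\<^esub>"
      by (rule bilinear_zero_right[OF M C(1) T pure_tensor_bilinear[OF M C(1)] x])
    finally show "a \<odot>\<^bsub>M\<^esub> x \<in> {x \<in> carrier M. pure_tensor R M ?C x Z \<in> {\<zero>\<^bsub>?T\<^esub>}}"
      using Mc(3)[OF ac x] by simp
  qed
  then show ?thesis using y by auto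
qed

text \<open>The bilinear map \<open>(x, a mod J) \<mapsto> a x mod JM\<close> detects that \<open>y\<close> is in \<open>JM\<close>.\<close>

lemma tensor_cyclic_zeroD:
  assumes M: "module R M" and J: "ideal J R" and y: "y \<in> carrier M"
    and zero: "pure_tensor R M (cyclic_module R J) y (cyclic_class R J \<one>) =
      \<zero>\<^bsub>tensor_product R M (cyclic_module R J)\<^esub>"
  shows "y \<in> ideal_smult R J M"
proof -
  let ?C = "cyclic_module R J" and ?H = "ideal_smult R J M"
  let ?Q = "quot_module M ?H"
  note C = cyclic_module_facts[OF J] and Jc = ideal_closed[OF J] and Mc = module_closed[OF M]
  have H: "submodule ?H R M" by (rule ideal_smult_closed(1)[OF M Jc(1)])
  have Q: "module R ?Q" by (rule quot_module_module[OF M H])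
  interpret M: module R M by (rule M)
  note q = quot_module_facts[OF M H] and T = tensor_structure[OF M C(1)]
  define b where "b x Y = ?H +>\<^bsub>M\<^esub> (cyclic_rep J Y \<odot>\<^bsub>M\<^esub> x)" for x Y
  have b: "b x (cyclic_class R J a) = ?H +>\<^bsub>M\<^esub> (a \<odot>\<^bsub>M\<^esub> x)" if x: "x \<in> carrier M" and a: "a \<in> carrier R" for x a
  proof -
    note r = cyclic_rep[OF J a]
    have "cyclic_rep J (cyclic_class R J a) \<odot>\<^bsub>M\<^esub> x \<ominus>\<^bsub>M\<^esub> a \<odot>\<^bsub>M\<^esub> x =
        (cyclic_rep J (cyclic_class R J a) \<ominus> a) \<odot>\<^bsub>M\<^esub> x"
      unfolding a_minus_def using r(1) a x by (simp add: M.smult_l_distr M.smult_l_minus)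
    then show ?thesis
      unfolding b_def using q(2) r a x ideal_smult_closed(2)[OF M Jc(1) r(2) x] by simp
  qed
  have bil: "bilinear R M ?C ?Q b"
    unfolding bilinear_def
  proof (intro conjI ballI)
    fix x Y assume x: "x \<in> carrier M" and "Y \<in> carrier ?C"
    then obtain a where a: "a \<in> carrier R" "Y = cyclic_class R J a" unfolding C(2) by blast
    show "b x Y \<in> carrier ?Q" unfolding a(2) by (simp add: b x a(1) q(1))
    show "b (x \<oplus>\<^bsub>M\<^esub> x') Y = b x Y \<oplus>\<^bsub>?Q\<^esub> b x' Y" if "x' \<in> carrier M" for x'
      unfolding a(2) by (simp add: b x a(1) q(4) M.smult_r_distr that)
    show "b (r \<odot>\<^bsub>M\<^esub> x) Y = r \<odot>\<^bsub>?Q\<^esub> b x Y" if "r \<in> carrier R" for r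
      unfolding a(2) by (simp add: b x a(1) q(5) M.smult_assoc1[symmetric] m_comm that)
    show "b x (r \<odot>\<^bsub>?C\<^esub> Y) = r \<odot>\<^bsub>?Q\<^esub> b x Y" if "r \<in> carrier R" for r
      unfolding a(2) by (simp add: b x a(1) q(5) C(6) M.smult_assoc1 that)
    fix Y' assume "Y' \<in> carrier ?C"
    then obtain a' where a': "a' \<in> carrier R" "Y' = cyclic_class R J a'" unfolding C(2) by blast
    show "b x (Y \<oplus>\<^bsub>?C\<^esub> Y') = b x Y \<oplus>\<^bsub>?Q\<^esub> b x Y'"
      unfolding a(2) a'(2) by (simp add: b x a(1) a'(1) q(4) C(5) M.smult_l_distr)
  qed
  have one: "cyclic_class R J \<one> \<in> carrier ?C" unfolding C(2) by simp
  let ?e = "basis_vec R (carrier M \<times> carrier ?C) (y, cyclic_class R J \<one>)"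
  have e: "?e \<in> carrier (tensor_free R M ?C)" by (rule tensor_basis[OF M y one])
  have "?e \<in> tensor_kernel R M ?C"
    using zero quot_zero_iff[OF T(1,3) e] unfolding pure_tensor_def tensor_product_def by simp
  then have "lin_ext R ?Q (carrier M \<times> carrier ?C) (\<lambda>p. b (fst p) (snd p)) ?e = \<zero>\<^bsub>?Q\<^esub>"
    by (rule tensor_kernel_lin_ext[OF M C(1) Q bil])
  moreover have "lin_ext R ?Q (carrier M \<times> carrier ?C) (\<lambda>p. b (fst p) (snd p)) ?e = b y (cyclic_class R J \<one>)"
    using lin_ext_basis[where b = "\<lambda>p. b (fst p) (snd p)" and p = "(y, cyclic_class R J \<one>)"
        and B = "carrier M \<times> carrier ?C", OF Q] bilinearD(1)[OF bil] y one by auto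
  ultimately have "?H +>\<^bsub>M\<^esub> y = \<zero>\<^bsub>?Q\<^esub>" using b[OF y one_closed] y by simp
  then show ?thesis using quot_zero_iff[OF M H y] by simp
qed

section \<open>Consequences of faithful flatness\<close>

lemma exact_atD:
  assumes "exact_at L M N f g" "x \<in> carrier M" "g x = \<zero>\<^bsub>N\<^esub>"
  shows "x \<in> f ` carrier L"
  using assms unfolding exact_at_def a_kernel_def kernel_def by auto

lemma exact_at_iff:
  "exact_at L M N f g \<longleftrightarrow> f ` carrier L = {x \<in> carrier M. g x = \<zero>\<^bsub>N\<^esub>}"
  unfolding exact_at_def a_kernel_def kernel_def by auto

text \<open>Multiplication by \<open>s\<close> is an injection \<open>R/(J : s) \<longrightarrow> R/J\<close>, so \<open>M/(J : s)M \<longrightarrow> M/JM\<close> is injective as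
well. Injectivity is expressed by exactness of \<open>R/R \<longrightarrow> R/(J : s) \<longrightarrow> R/J\<close>.\<close>

lemma faithfully_flat_colon:
  assumes ff: "faithfully_flat TYPE((nat \<Rightarrow> 'a) set) R M"
    and J: "ideal J R" and s: "s \<in> carrier R" and y: "y \<in> carrier M"
    and sy: "s \<odot>\<^bsub>M\<^esub> y \<in> ideal_smult R J M"
  shows "y \<in> ideal_smult R (colon J s) M"
proof -
  have M: "module R M" using ff unfolding faithfully_flat_def by blast
  have K: "ideal (colon J s) R" by (rule colon_ideal(1)[OF J s])
  let ?L = "cyclic_module R (carrier R)" and ?N = "cyclic_module R (colon J s)" and ?P = "cyclic_module R J"
  let ?f = "cyclic_map (carrier R) (colon J s) \<zero>" and ?g = "cyclic_map (colon J s) J s"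
  note CL = cyclic_module_facts[OF oneideal] and CN = cyclic_module_facts[OF K]
    and CP = cyclic_module_facts[OF J]
  have f0: "\<forall>a\<in>carrier R. \<zero> \<otimes> a \<in> colon J s"
    using ideal_closed(2)[OF K] by simp
  note f = cyclic_map[OF oneideal K zero_closed f0]
  have sK: "\<forall>a\<in>colon J s. s \<otimes> a \<in> J"
    using s unfolding colon_def by (auto simp: m_comm)
  note g = cyclic_map[OF K J s sK]
  have fz: "?f Y = \<zero>\<^bsub>?N\<^esub>" if "Y \<in> carrier ?L" for Y
    using that unfolding CL(2) by (auto simp: f(1) CN(4))
  have "exact_at ?L ?N ?P ?f ?g"
    unfolding exact_at_iff
  proof (intro equalityI subsetI)
    fix Y assume "Y \<in> ?f ` carrier ?L"
    then have Y: "Y = \<zero>\<^bsub>?N\<^esub>" using fz by auto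
    show "Y \<in> {x \<in> carrier ?N. ?g x = \<zero>\<^bsub>?P\<^esub>}"
      unfolding Y using module_closed(1)[OF CN(1)] mod_hom_apply(4)[OF CN(1) CP(1) g(2)] by simp
  next
    fix Y assume "Y \<in> {x \<in> carrier ?N. ?g x = \<zero>\<^bsub>?P\<^esub>}"
    then obtain a where a: "a \<in> carrier R" "Y = cyclic_class R (colon J s) a" "?g Y = \<zero>\<^bsub>?P\<^esub>"
      unfolding CN(2) by blast
    then have "cyclic_class R J (s \<otimes> a) = cyclic_class R J \<zero>" using g(1)[OF a(1)] CP(4) by simp
    then have "s \<otimes> a \<ominus> \<zero> \<in> J" using CP(3)[of "s \<otimes> a" \<zero>] a(1) s by simp
    moreover have "s \<otimes> a \<ominus> \<zero> = a \<otimes> s" using a(1) s by algebra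
    ultimately have "a \<in> colon J s" unfolding colon_def using a(1) by simp
    moreover have "a \<ominus> \<zero> = a" using a(1) by algebra
    ultimately have "Y = \<zero>\<^bsub>?N\<^esub>"
      unfolding a(2) CN(4) using a(1) by (intro cyclic_class_cong[OF K]) auto
    moreover have "\<zero>\<^bsub>?L\<^esub> \<in> carrier ?L" by (rule module_closed(1)[OF CL(1)])
    ultimately show "Y \<in> ?f ` carrier ?L" using fz by (intro image_eqI[of _ _ "\<zero>\<^bsub>?L\<^esub>"]) auto
  qed
  then have ex: "exact_at (tensor_product R M ?L) (tensor_product R M ?N) (tensor_product R M ?P)
      (tensor_map R M ?L ?N ?f) (tensor_map R M ?N ?P ?g)"
    using ff CL(1) CN(1) CP(1) f(2) g(2) unfolding faithfully_flat_def by blast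
  let ?t = "pure_tensor R M ?N y (cyclic_class R (colon J s) \<one>)"
  have one: "cyclic_class R (colon J s) \<one> \<in> carrier ?N" "cyclic_class R J \<one> \<in> carrier ?P"
    unfolding CN(2) CP(2) by auto
  have tc: "?t \<in> carrier (tensor_product R M ?N)"
    by (rule bilinearD(1)[OF pure_tensor_bilinear[OF M CN(1)] y one(1)])
  have "tensor_map R M ?N ?P ?g ?t = pure_tensor R M ?P y (cyclic_class R J (s \<otimes> \<one>))"
    using tensor_map_pure[OF M CN(1) CP(1) g(2) y one(1)] g(1)[OF one_closed] by simp
  also have "\<dots> = pure_tensor R M ?P y (s \<odot>\<^bsub>?P\<^esub> cyclic_class R J \<one>)"
    using CP(6)[OF s one_closed] by simp
  also have "\<dots> = pure_tensor R M ?P (s \<odot>\<^bsub>M\<^esub> y) (cyclic_class R J \<one>)"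
    using bilinearD(4,5)[OF pure_tensor_bilinear[OF M CP(1)] s y one(2)] by simp
  also have "\<dots> = \<zero>\<^bsub>tensor_product R M ?P\<^esub>" by (rule tensor_cyclic_zero[OF M J sy one(2)])
  finally have "?t \<in> tensor_map R M ?L ?N ?f ` carrier (tensor_product R M ?L)"
    by (rule exact_atD[OF ex tc])
  then have "?t = \<zero>\<^bsub>tensor_product R M ?N\<^esub>"
    using tensor_map_zero[OF M CL(1) CN(1) f(2) fz] by auto
  then show ?thesis by (rule tensor_cyclic_zeroD[OF M K y])
qed

text \<open>If \<open>M = JM\<close>, then \<open>M \<otimes> R/J = 0\<close>, so \<open>0 \<longrightarrow> R/J \<longrightarrow> 0\<close> becomes exact after tensoring with \<open>M\<close>. Then it is
exact itself, which is false for proper \<open>J\<close>.\<close>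

lemma faithfully_flat_proper:
  assumes ff: "faithfully_flat TYPE((nat \<Rightarrow> 'a) set) R M"
    and J: "ideal J R" and proper: "\<one> \<notin> J"
  shows "\<exists>y\<in>carrier M. y \<notin> ideal_smult R J M"
proof (rule ccontr)
  assume no: "\<not> ?thesis"
  have M: "module R M" using ff unfolding faithfully_flat_def by blast
  let ?L = "cyclic_module R (carrier R)" and ?N = "cyclic_module R J"
  let ?f = "cyclic_map (carrier R) J \<zero>" and ?g = "cyclic_map J (carrier R) \<zero>"
  note CL = cyclic_module_facts[OF oneideal] and CN = cyclic_module_facts[OF J]
  have f0: "\<forall>a\<in>carrier R. \<zero> \<otimes> a \<in> J" using ideal_closed(2)[OF J] by simp
  have g0: "\<forall>a\<in>J. \<zero> \<otimes> a \<in> carrier R" using ideal_closed(1)[OF J] by auto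
  note f = cyclic_map[OF oneideal J zero_closed f0] and g = cyclic_map[OF J oneideal zero_closed g0]
  have fz: "?f Y = \<zero>\<^bsub>?N\<^esub>" if "Y \<in> carrier ?L" for Y
    using that unfolding CL(2) by (auto simp: f(1) CN(4))
  have gz: "?g Y = \<zero>\<^bsub>?L\<^esub>" if "Y \<in> carrier ?N" for Y
    using that unfolding CN(2) by (auto simp: g(1) CL(4))
  let ?TL = "tensor_product R M ?L" and ?TN = "tensor_product R M ?N"
  note T = tensor_structure[OF M CN(1)]
  have trivial: "t = \<zero>\<^bsub>?TN\<^esub>" if t: "t \<in> carrier ?TN" for t
  proof -
    obtain u where u: "u \<in> carrier (tensor_free R M ?N)"
      and t': "t = tensor_kernel R M ?N +>\<^bsub>tensor_free R M ?N\<^esub> u"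
      using t unfolding tensor_product_def quot_module_facts(1)[OF T(1,3)] by blast
    have "u \<in> tensor_kernel R M ?N"
    proof (rule free_in_submodule[OF is_cring T(3)[unfolded tensor_free_def] u[unfolded tensor_free_def]])
      fix p assume p: "p \<in> carrier M \<times> carrier ?N"
      have up: "u p \<in> carrier R" using u p unfolding tensor_free_def free_module_simps PiE_iff by blast
      have mem: "fst p \<in> carrier M" "snd p \<in> carrier ?N" using p by auto
      have "fst p \<in> ideal_smult R J M" using no mem(1) by blast
      then have "pure_tensor R M ?N (fst p) (snd p) = \<zero>\<^bsub>?TN\<^esub>"
        by (rule tensor_cyclic_zero[OF M J _ mem(2)])
      then have "basis_vec R (carrier M \<times> carrier ?N) p \<in> tensor_kernel R M ?N"
        using quot_zero_iff[OF T(1,3) tensor_basis[OF M mem]]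
        unfolding pure_tensor_def tensor_product_def by simp
      then show "u p \<odot>\<^bsub>free_module R (carrier M \<times> carrier ?N)\<^esub> basis_vec R (carrier M \<times> carrier ?N) p
          \<in> tensor_kernel R M ?N"
        using submodule_closed(5)[OF T(1,3) up] unfolding tensor_free_def by blast
    qed
    then show ?thesis unfolding t' using quot_zero_iff[OF T(1,3) u] unfolding tensor_product_def by simp
  qed
  have "exact_at ?TL ?TN ?TL (tensor_map R M ?L ?N ?f) (tensor_map R M ?N ?L ?g)"
    unfolding exact_at_iff
  proof (intro equalityI subsetI)
    fix t assume "t \<in> tensor_map R M ?L ?N ?f ` carrier ?TL"
    then have t: "t = \<zero>\<^bsub>?TN\<^esub>" using tensor_map_zero[OF M CL(1) CN(1) f(2) fz] by auto
    then show "t \<in> {x \<in> carrier ?TN. tensor_map R M ?N ?L ?g x = \<zero>\<^bsub>?TL\<^esub>}"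
      using tensor_zero_mem[OF M CN(1)] tensor_map_zero[OF M CN(1) CL(1) g(2) gz] by simp
  next
    fix t assume "t \<in> {x \<in> carrier ?TN. tensor_map R M ?N ?L ?g x = \<zero>\<^bsub>?TL\<^esub>}"
    then have "t = \<zero>\<^bsub>?TN\<^esub>" using trivial by simp
    then have "t = tensor_map R M ?L ?N ?f \<zero>\<^bsub>?TL\<^esub>"
      using tensor_map_zero[OF M CL(1) CN(1) f(2) fz tensor_zero_mem[OF M CL(1)]] by simp
    then show "t \<in> tensor_map R M ?L ?N ?f ` carrier ?TL" using tensor_zero_mem[OF M CL(1)] by blast
  qed
  then have ex: "exact_at ?L ?N ?L ?f ?g"
    using ff CL(1) CN(1) f(2) g(2) unfolding faithfully_flat_def by blast
  have one: "cyclic_class R J \<one> \<in> carrier ?N" unfolding CN(2) by simp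
  have "cyclic_class R J \<one> \<in> ?f ` carrier ?L" by (rule exact_atD[OF ex one gz[OF one]])
  then have "cyclic_class R J \<one> = cyclic_class R J \<zero>" using fz CN(4) by auto
  then have "\<one> \<ominus> \<zero> \<in> J" using CN(3)[OF one_closed zero_closed] by simp
  moreover have "\<one> \<ominus> \<zero> = \<one>" by algebra
  ultimately show False using proper by simp
qed

end

section \<open>The minimal resolution of the residue field\<close>

text \<open>The minimal free resolution of the residue field. The augmentation enters only through the
consequence that all of \<open>\<mm>F\<^sub>0\<close> consists of boundaries.\<close>

locale residue_field_resolution = noetherian_local_ring R \<mm> for R (structure) and \<mm> +
  fixes F :: "nat \<Rightarrow> ('a, 'f) module" and d :: "nat \<Rightarrow> 'f \<Rightarrow> 'f"
  assumes free: "\<And>i. free_fin_rank R (F i)"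
    and differential: "\<And>i. d i \<in> mod_hom R (F (Suc i)) (F i)"
    and exact: "\<And>i. exact_at (F (Suc (Suc i))) (F (Suc i)) (F i) (d (Suc i)) (d i)"
    and minimal: "\<And>i. d i ` carrier (F (Suc i)) \<subseteq> ideal_smult R \<mm> (F i)"
    and augmentation: "ideal_smult R \<mm> (F 0) \<subseteq> d 0 ` carrier (F (Suc 0))"
begin

lemma F_module: "module R (F i)"
  using free unfolding free_fin_rank_def by blast

lemma coordinates:
  obtains n :: nat and c where
    "\<And>k v. k < n \<Longrightarrow> v \<in> carrier (F i) \<Longrightarrow> c k v \<in> carrier R"
    "\<And>k a v. k < n \<Longrightarrow> a \<in> carrier R \<Longrightarrow> v \<in> carrier (F i) \<Longrightarrow> c k (a \<odot>\<^bsub>F i\<^esub> v) = a \<otimes> c k v"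
    "\<And>J v. ideal J R \<Longrightarrow> v \<in> carrier (F i) \<Longrightarrow> v \<in> ideal_smult R J (F i) \<longleftrightarrow> (\<forall>k<n. c k v \<in> J)"
proof -
  obtain n and c :: "nat \<Rightarrow> 'f \<Rightarrow> 'a" where
    c': "\<forall>k<n. c k \<in> mod_hom R (F i) (regular_module R)"
    and J: "\<forall>J. ideal J R \<longrightarrow> (\<forall>v\<in>carrier (F i).
      v \<in> ideal_smult R J (F i) \<longleftrightarrow> (\<forall>k<n. c k v \<in> J))"
    using free_fin_rank_coordinates[OF is_cring free[of i]] by (elim exE conjE)
  have c: "c k \<in> mod_hom R (F i) (regular_module R)" if "k < n" for k using c' that by blast
  note ca = mod_hom_apply[OF F_module regular_module_module[OF is_cring] c]
  show ?thesis
  proof (rule that)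
    show "c k v \<in> carrier R" if "k < n" "v \<in> carrier (F i)" for k v
      using ca(1)[OF that] by (simp add: regular_module_def)
    show "c k (a \<odot>\<^bsub>F i\<^esub> v) = a \<otimes> c k v"
      if "k < n" "a \<in> carrier R" "v \<in> carrier (F i)" for k a v
      using ca(3)[OF that] by (simp add: regular_module_def)
  qed (use J in blast)
qed

lemma nonzerodivisor_cancel:
  assumes J: "ideal J R" and x: "x \<in> carrier R" "nonzerodivisor_mod J x" and v: "v \<in> carrier (F i)"
    and xv: "x \<odot>\<^bsub>F i\<^esub> v \<in> ideal_smult R J (F i)"
  shows "v \<in> ideal_smult R J (F i)"
proof -
  obtain n :: nat and c where c: "\<And>k v. k < n \<Longrightarrow> v \<in> carrier (F i) \<Longrightarrow> c k v \<in> carrier R"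
    "\<And>k a v. k < n \<Longrightarrow> a \<in> carrier R \<Longrightarrow> v \<in> carrier (F i) \<Longrightarrow> c k (a \<odot>\<^bsub>F i\<^esub> v) = a \<otimes> c k v"
    "\<And>J v. ideal J R \<Longrightarrow> v \<in> carrier (F i) \<Longrightarrow> v \<in> ideal_smult R J (F i) \<longleftrightarrow> (\<forall>k<n. c k v \<in> J)"
    using coordinates[of i] by blast
  have "\<forall>k<n. x \<otimes> c k v \<in> J"
    using xv c(3)[OF J module_closed(3)[OF F_module x(1) v]] c(2)[OF _ x(1) v] by simp
  then have "\<forall>k<n. c k v \<in> J" using x(2) c(1)[OF _ v] unfolding nonzerodivisor_mod_def by blast
  then show ?thesis using c(3)[OF J v] by simp
qed

text \<open>If a coordinate of \<open>v\<close> were a unit, then \<open>x\<close> would be in \<open>J\<close>.\<close>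

lemma cancel_into_m:
  assumes J: "ideal J R" and x: "x \<in> carrier R" "x \<notin> J" and v: "v \<in> carrier (F i)"
    and xv: "x \<odot>\<^bsub>F i\<^esub> v \<in> ideal_smult R J (F i)"
  shows "v \<in> ideal_smult R \<mm> (F i)"
proof -
  obtain n :: nat and c where c: "\<And>k v. k < n \<Longrightarrow> v \<in> carrier (F i) \<Longrightarrow> c k v \<in> carrier R"
    "\<And>k a v. k < n \<Longrightarrow> a \<in> carrier R \<Longrightarrow> v \<in> carrier (F i) \<Longrightarrow> c k (a \<odot>\<^bsub>F i\<^esub> v) = a \<otimes> c k v"
    "\<And>J v. ideal J R \<Longrightarrow> v \<in> carrier (F i) \<Longrightarrow> v \<in> ideal_smult R J (F i) \<longleftrightarrow> (\<forall>k<n. c k v \<in> J)"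
    using coordinates[of i] by blast
  have xc: "\<forall>k<n. x \<otimes> c k v \<in> J"
    using xv c(3)[OF J module_closed(3)[OF F_module x(1) v]] c(2)[OF _ x(1) v] by simp
  have "c k v \<in> \<mm>" if k: "k < n" for k
  proof (rule ccontr)
    assume "c k v \<notin> \<mm>"
    then obtain b where b: "b \<in> carrier R" "b \<otimes> c k v = \<one>"
      using invertible_outside_m[OF c(1)[OF k v]] by blast
    have "b \<otimes> (x \<otimes> c k v) \<in> J" using ideal_closed(5)[OF J _ b(1)] xc k by blast
    moreover have "b \<otimes> (x \<otimes> c k v) = x \<otimes> (b \<otimes> c k v)" using b(1) x(1) c(1)[OF k v] by (simp add: m_lcomm)
    ultimately show False using b(2) x by simp
  qed
  then show ?thesis using c(3)[OF ideal_m v] by simp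
qed

lemma differential_m2:
  assumes v: "v \<in> ideal_smult R \<mm> (F (Suc i))"
  shows "d i v \<in> ideal_smult R (\<mm> \<cdot> \<mm>) (F i)"
proof -
  note da = mod_hom_apply[OF F_module F_module differential[of i]]
  note mm = ideal_smult_closed[OF F_module ideal_closed(1)[OF ideal_prod_is_ideal[OF ideal_m ideal_m]]]
  have "ideal_smult R \<mm> (F (Suc i)) \<subseteq> {v \<in> carrier (F (Suc i)). d i v \<in> ideal_smult R (\<mm> \<cdot> \<mm>) (F i)}"
  proof (rule ideal_smult_least[OF submodule_vimage[OF F_module F_module differential mm(1)]])
    fix a x assume a: "a \<in> \<mm>" and x: "x \<in> carrier (F (Suc i))"
    have ac: "a \<in> carrier R" using a m_subset by auto
    have "d i x \<in> ideal_smult R \<mm> (F i)" using minimal x by blast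
    then show "a \<odot>\<^bsub>F (Suc i)\<^esub> x \<in> {v \<in> carrier (F (Suc i)). d i v \<in> ideal_smult R (\<mm> \<cdot> \<mm>) (F i)}"
      using smult_ideal_prod[OF F_module ideal_m ideal_m a] da(3)[OF ac x]
        module_closed(3)[OF F_module ac x] by simp
  qed
  then show ?thesis using v by blast
qed

lemma socle_smult:
  assumes J: "ideal J R" and s: "socle_element J s" and v: "v \<in> ideal_smult R \<mm> (F i)"
  shows "s \<odot>\<^bsub>F i\<^esub> v \<in> ideal_smult R J (F i)"
proof -
  interpret Fi: module R "F i" by (rule F_module)
  have sc: "s \<in> carrier R" using s unfolding socle_element_def by simp
  note JF = ideal_smult_closed[OF F_module[of i] ideal_closed(1)[OF J]]
  have "ideal_smult R \<mm> (F i) \<subseteq> {v \<in> carrier (F i). s \<odot>\<^bsub>F i\<^esub> v \<in> ideal_smult R J (F i)}"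
  proof (rule ideal_smult_least[OF submodule_vimage[OF F_module F_module smult_hom[OF F_module sc] JF(1)]])
    fix a x assume a: "a \<in> \<mm>" and x: "x \<in> carrier (F i)"
    have ac: "a \<in> carrier R" using a m_subset by auto
    have "s \<odot>\<^bsub>F i\<^esub> (a \<odot>\<^bsub>F i\<^esub> x) = (a \<otimes> s) \<odot>\<^bsub>F i\<^esub> x"
      using ac sc x by (simp add: Fi.smult_assoc1[symmetric] m_comm)
    moreover have "a \<otimes> s \<in> J" using s a unfolding socle_element_def by simp
    ultimately show "a \<odot>\<^bsub>F i\<^esub> x \<in> {v \<in> carrier (F i). s \<odot>\<^bsub>F i\<^esub> v \<in> ideal_smult R J (F i)}"
      using JF(2)[OF _ x] ac x by simp
  qed
  then show ?thesis using v by blast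
qed

lemma differential_squared:
  assumes "x \<in> carrier (F (Suc (Suc i)))"
  shows "d i (d (Suc i) x) = \<zero>\<^bsub>F i\<^esub>"
  using exact[of i] assms unfolding exact_at_iff by blast

lemma ideal_smult_zero:
  assumes M: "module R M" shows "ideal_smult R {\<zero>} M = {\<zero>\<^bsub>M\<^esub>}"
proof -
  interpret M: module R M by fact
  have "ideal_smult R {\<zero>} M \<subseteq> {\<zero>\<^bsub>M\<^esub>}"
    by (rule ideal_smult_least[OF submodule_zero[OF M]]) auto
  moreover have "\<zero>\<^bsub>M\<^esub> \<in> ideal_smult R {\<zero>} M"
    by (rule submodule_closed(2)[OF M ideal_smult_closed(1)[OF M]]) simp
  ultimately show ?thesis by blast
qed

text \<open>A class in \<open>Tor\<^sub>n(R/J, k) = H\<^sub>n(F/JF)\<close> that vanishes in \<open>Tor\<^sub>n(k, k) = F\<^sub>n/\<mm>F\<^sub>n\<close> is zero, by induction on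
the sequence. Let \<open>d v \<in> (J + (x))F\<close>, say \<open>d v = j + x w\<close>. Applying \<open>d\<close> gives \<open>x (d w) \<in> JF\<close>, so \<open>d w \<in> JF\<close>
as \<open>x\<close> is a nonzerodivisor modulo \<open>J\<close>. Moreover \<open>d v \<in> \<mm>\<^sup>2F\<close> by minimality, so
\<open>x w \<in> (J + \<mm>\<^sup>2)F\<close>, and \<open>w \<in> \<mm>F\<close> because \<open>x \<notin> J + \<mm>\<^sup>2\<close>. The induction hypothesis applies to \<open>w\<close>: it is
\<open>d u + j'\<close> with \<open>j' \<in> JF\<close>. Then \<open>v - x u\<close> has boundary \<open>j + x j' \<in> JF\<close>, and the induction hypothesis
applies once more.\<close>

lemma tor_residue_field_injective:
  assumes "minimal_regular xs" and "v \<in> ideal_smult R \<mm> (F n)"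
    and "\<And>i. n = Suc i \<Longrightarrow> d i v \<in> ideal_smult R (Idl (set xs)) (F i)"
  shows "\<exists>w\<in>carrier (F (Suc n)). \<exists>j\<in>ideal_smult R (Idl (set xs)) (F n). v = d n w \<oplus>\<^bsub>F n\<^esub> j"
  using assms
proof (induction xs arbitrary: n v)
  case Nil
  interpret Fn: module R "F n" by (rule F_module)
  have mF: "ideal_smult R \<mm> (F n) \<subseteq> carrier (F n)"
    by (rule submodule_closed(1)[OF F_module ideal_smult_closed(1)[OF F_module m_subset]])
  have "v \<in> d n ` carrier (F (Suc n))"
  proof (cases n)
    case 0
    then show ?thesis using Nil.prems(2) augmentation by auto
  next
    case (Suc i)
    have "d i v = \<zero>\<^bsub>F i\<^esub>" using Nil.prems(3)[OF Suc] ideal_smult_zero[OF F_module[of i]] by (simp add: Idl_empty)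
    moreover have "v \<in> carrier (F (Suc i))" using Nil.prems(2) mF Suc by auto
    ultimately show ?thesis using exact_atD[OF exact[of i]] Suc by simp
  qed
  then obtain w where w: "w \<in> carrier (F (Suc n))" "v = d n w" by blast
  have "v \<in> carrier (F n)" using Nil.prems(2) mF by auto
  then have "v = d n w \<oplus>\<^bsub>F n\<^esub> \<zero>\<^bsub>F n\<^esub>" using w(2) by simp
  moreover have "\<zero>\<^bsub>F n\<^esub> \<in> ideal_smult R (Idl (set [])) (F n)"
    using ideal_smult_zero[OF F_module[of n]] by (simp add: Idl_empty)
  ultimately show ?case using w(1) by blast
next
  case (Cons x xs)
  have xs: "minimal_regular xs" and xm: "x \<in> \<mm>" and x2: "x \<notin> Idl (set xs) <+>\<^bsub>R\<^esub> \<mm> \<cdot> \<mm>"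
    and nzd: "nonzerodivisor_mod (Idl (set xs)) x" using Cons.prems(1) by auto
  define J where "J = Idl (set xs)"
  have xc: "x \<in> carrier R" using xm m_subset by auto
  have J: "ideal J R" unfolding J_def by (rule minimal_regular_ideal(3)[OF xs])
  have eq: "Idl (set (x # xs)) = adjoin J x"
    unfolding J_def using Idl_insert[OF minimal_regular_ideal(2)[OF xs] xc] by simp
  note adj = adjoin_ideal[OF J xc] and Jc = ideal_closed[OF J]
  note mmi = ideal_prod_is_ideal[OF ideal_m ideal_m]
  note sum = ideal_sum[OF J mmi]
  note sumc = ideal_closed(1)[OF sum(1)]
  note Fc = module_closed[OF F_module]
  note mF = ideal_smult_closed[OF F_module m_subset]
  note mFc = submodule_closed[OF F_module mF(1)]
  note JF = ideal_smult_closed[OF F_module Jc(1)]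
  note JFc = submodule_closed[OF F_module JF(1)]
  note AF = ideal_smult_closed[OF F_module ideal_closed(1)[OF adj(1)]]
  note AFc = submodule_closed[OF F_module AF(1)]
  note IH = Cons.IH[OF xs, folded J_def]
  have JA: "ideal_smult R J (F k) \<subseteq> ideal_smult R (adjoin J x) (F k)" for k
    by (rule ideal_smult_mono[OF F_module adj(2) ideal_closed(1)[OF adj(1)]])
  have vc: "v \<in> carrier (F n)" using Cons.prems(2) mFc(1) by blast
  show ?case
  proof (cases n)
    case 0
    then obtain w j where w: "w \<in> carrier (F (Suc n))" "j \<in> ideal_smult R J (F n)" "v = d n w \<oplus>\<^bsub>F n\<^esub> j"
      using IH[OF Cons.prems(2)] by auto
    then show ?thesis unfolding eq using JA by blast
  next
    case (Suc i)
    interpret Fn: module R "F n" by (rule F_module)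
    interpret Fi: module R "F i" by (rule F_module)
    note da = mod_hom_apply[OF F_module F_module differential[of i], folded Suc]
    have "d i v \<in> ideal_smult R (adjoin J x) (F i)" using Cons.prems(3)[OF Suc] unfolding eq .
    then obtain j w where j: "j \<in> ideal_smult R J (F i)" and w: "w \<in> carrier (F i)"
      and dv: "d i v = j \<oplus>\<^bsub>F i\<^esub> x \<odot>\<^bsub>F i\<^esub> w"
      using adjoin_smult_decomp[OF F_module J xc] by blast
    have jc: "j \<in> carrier (F i)" using j JFc(1) by blast
    have xw: "x \<odot>\<^bsub>F i\<^esub> w = d i v \<ominus>\<^bsub>F i\<^esub> j"
      unfolding dv using jc w xc Fi.smult_closed[OF xc w]
      by (simp add: a_minus_def Fi.M.a_comm[of j] Fi.M.a_assoc Fi.M.r_neg)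
    have "x \<odot>\<^bsub>F i\<^esub> w \<in> ideal_smult R (J <+>\<^bsub>R\<^esub> \<mm> \<cdot> \<mm>) (F i)"
    proof -
      have "d i v \<in> ideal_smult R (\<mm> \<cdot> \<mm>) (F i)"
        using differential_m2[of v i] Cons.prems(2) Suc by simp
      then have "d i v \<in> ideal_smult R (J <+>\<^bsub>R\<^esub> \<mm> \<cdot> \<mm>) (F i)"
        using ideal_smult_mono[OF F_module sum(3) sumc] by blast
      moreover have "j \<in> ideal_smult R (J <+>\<^bsub>R\<^esub> \<mm> \<cdot> \<mm>) (F i)"
        using j ideal_smult_mono[OF F_module sum(2) sumc] by blast
      ultimately show ?thesis
        unfolding xw by (rule submodule_closed(4)[OF F_module ideal_smult_closed(1)[OF F_module sumc]])
    qed
    then have wm: "w \<in> ideal_smult R \<mm> (F i)"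
      by (rule cancel_into_m[OF sum(1) xc x2[folded J_def] w])
    have "\<exists>u\<in>carrier (F (Suc i)). \<exists>j'\<in>ideal_smult R J (F i). w = d i u \<oplus>\<^bsub>F i\<^esub> j'"
    proof (rule IH[OF wm])
      fix l assume l: "i = Suc l"
      note dl = mod_hom_apply[OF F_module F_module differential[of l], folded l]
      have "d l (d i v) = \<zero>\<^bsub>F l\<^esub>" using differential_squared[of v l] vc Suc l by simp
      then have "x \<odot>\<^bsub>F l\<^esub> d l w = \<zero>\<^bsub>F l\<^esub> \<ominus>\<^bsub>F l\<^esub> d l j"
        using dl(5)[of "d i v" j] da(1)[OF vc] jc dl(3)[OF xc w] unfolding xw[symmetric] by simp
      moreover have "\<dots> \<in> ideal_smult R J (F l)"
        using JFc(2) mod_hom_ideal_smult[OF F_module F_module differential[of l, folded l] Jc(1) j]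
        by (rule JFc(4))
      ultimately show "d l w \<in> ideal_smult R J (F l)"
        using nonzerodivisor_cancel[OF J xc nzd[folded J_def] dl(1)[OF w]] by simp
    qed
    then obtain u j' where u: "u \<in> carrier (F n)" and j': "j' \<in> ideal_smult R J (F i)"
      and wu: "w = d i u \<oplus>\<^bsub>F i\<^esub> j'" unfolding Suc by blast
    have j'c: "j' \<in> carrier (F i)" using j' JFc(1) by blast
    let ?v = "v \<ominus>\<^bsub>F n\<^esub> x \<odot>\<^bsub>F n\<^esub> u"
    have xu: "x \<odot>\<^bsub>F n\<^esub> u \<in> carrier (F n)" using xc u by simp
    have "?v \<in> ideal_smult R \<mm> (F n)" using mFc(4)[OF Cons.prems(2) mF(2)[OF xm u]] .
    moreover have dv': "d i ?v = j \<oplus>\<^bsub>F i\<^esub> x \<odot>\<^bsub>F i\<^esub> j'"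
    proof -
      have cc: "x \<odot>\<^bsub>F i\<^esub> d i u \<in> carrier (F i)" "x \<odot>\<^bsub>F i\<^esub> j' \<in> carrier (F i)"
        using xc da(1)[OF u] j'c by auto
      have "d i ?v = d i v \<ominus>\<^bsub>F i\<^esub> x \<odot>\<^bsub>F i\<^esub> d i u" using da(5)[OF vc xu] da(3)[OF xc u] by simp
      also have "d i v = j \<oplus>\<^bsub>F i\<^esub> (x \<odot>\<^bsub>F i\<^esub> j' \<oplus>\<^bsub>F i\<^esub> x \<odot>\<^bsub>F i\<^esub> d i u)"
        unfolding dv wu using xc da(1)[OF u] j'c cc by (simp add: Fi.smult_r_distr Fi.M.a_comm)
      also have "\<dots> \<ominus>\<^bsub>F i\<^esub> x \<odot>\<^bsub>F i\<^esub> d i u = j \<oplus>\<^bsub>F i\<^esub> x \<odot>\<^bsub>F i\<^esub> j'"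
        using cc jc by (simp add: a_minus_def Fi.M.a_assoc Fi.M.r_neg)
      finally show ?thesis .
    qed
    have "d i ?v \<in> ideal_smult R J (F i)"
      unfolding dv' using JFc(3)[OF j JFc(5)[OF xc j']] .
    ultimately have "\<exists>w'\<in>carrier (F (Suc n)). \<exists>j''\<in>ideal_smult R J (F n). ?v = d n w' \<oplus>\<^bsub>F n\<^esub> j''"
      by (intro IH) (use Suc in auto)
    then obtain w' j'' where w': "w' \<in> carrier (F (Suc n))" and j'': "j'' \<in> ideal_smult R J (F n)"
      and v': "?v = d n w' \<oplus>\<^bsub>F n\<^esub> j''" by blast
    have c: "d n w' \<in> carrier (F n)" "j'' \<in> carrier (F n)"
      using mod_hom_apply(1)[OF F_module F_module differential w'] j'' JFc(1) by auto
    have "v = ?v \<oplus>\<^bsub>F n\<^esub> x \<odot>\<^bsub>F n\<^esub> u"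
      using vc xu by (simp add: a_minus_def Fn.M.a_assoc Fn.M.l_neg)
    also have "\<dots> = d n w' \<oplus>\<^bsub>F n\<^esub> (j'' \<oplus>\<^bsub>F n\<^esub> x \<odot>\<^bsub>F n\<^esub> u)"
      unfolding v' using c xu by (simp add: Fn.M.a_assoc)
    finally have "v = d n w' \<oplus>\<^bsub>F n\<^esub> (j'' \<oplus>\<^bsub>F n\<^esub> x \<odot>\<^bsub>F n\<^esub> u)" .
    moreover have "j'' \<oplus>\<^bsub>F n\<^esub> x \<odot>\<^bsub>F n\<^esub> u \<in> ideal_smult R (adjoin J x) (F n)"
      using AFc(3) JA j'' AF(2)[OF adj(3) u] by blast
    ultimately show ?thesis unfolding eq using w' by blast
  qed
qed

text \<open>A map from the \<open>n\<close>-th syzygy of \<open>k\<close> to \<open>M\<close> is a map \<open>f\<close> on \<open>F\<^sub>n\<close> that kills boundaries. If its image is not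
inside \<open>\<mm>M\<close>, then \<open>s (e + \<mm>F\<^sub>n)\<close> is a class of \<open>Tor\<^sub>n(k, R/J)\<close> that, by flatness, \<open>f\<close> does not
annihilate; here \<open>s\<close> embeds \<open>k\<close> in \<open>R/J\<close>. But for \<open>s \<in> \<mm>\<close> this class is zero, because its image in \<open>Tor\<^sub>n(k, k)\<close> is.\<close>

lemma regular_of_hom_to_faithfully_flat:
  fixes M :: "('a, 'm) module"
  assumes ff: "faithfully_flat TYPE((nat \<Rightarrow> 'a) set) R M"
    and f: "f \<in> mod_hom R (F n) M" and fd: "\<And>w. w \<in> carrier (F (Suc n)) \<Longrightarrow> f (d n w) = \<zero>\<^bsub>M\<^esub>"
    and e: "e \<in> carrier (F n)" "f e \<notin> ideal_smult R \<mm> M"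
  shows "regular_local_ring R \<mm>"
proof -
  have M: "module R M" using ff unfolding faithfully_flat_def by blast
  interpret M: module R M by (rule M)
  obtain xs s where xs: "minimal_regular xs" and s: "socle_element (Idl (set xs)) s"
    using exists_maximal_minimal_regular by blast
  define J where "J = Idl (set xs)"
  note I = minimal_regular_ideal[OF xs, folded J_def]
  note Jc = ideal_closed[OF I(3)]
  have sc: "s \<in> carrier R" and sJ: "s \<notin> J" and ms: "\<And>a. a \<in> \<mm> \<Longrightarrow> a \<otimes> s \<in> J"
    using s unfolding socle_element_def J_def by auto
  note fa = mod_hom_apply[OF F_module M f]
  have "s \<notin> \<mm>"
  proof
    assume sm: "s \<in> \<mm>"
    let ?v = "s \<odot>\<^bsub>F n\<^esub> e"
    have "?v \<in> ideal_smult R \<mm> (F n)"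
      by (rule ideal_smult_closed(2)[OF F_module m_subset sm e(1)])
    moreover have "d i ?v \<in> ideal_smult R J (F i)" if n: "n = Suc i" for i
    proof -
      have ei: "e \<in> carrier (F (Suc i))" using e(1) n by simp
      have "d i ?v = s \<odot>\<^bsub>F i\<^esub> d i e"
        unfolding n by (rule mod_hom_apply(3)[OF F_module F_module differential sc ei])
      moreover have "d i e \<in> ideal_smult R \<mm> (F i)" using minimal ei by blast
      ultimately show ?thesis using socle_smult[OF I(3) s[folded J_def]] by simp
    qed
    ultimately obtain w j where w: "w \<in> carrier (F (Suc n))" and j: "j \<in> ideal_smult R J (F n)"
      and v: "?v = d n w \<oplus>\<^bsub>F n\<^esub> j"
      using tor_residue_field_injective[OF xs, folded J_def, of ?v n] by blast
    have jc: "j \<in> carrier (F n)"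
      using j submodule_closed(1)[OF F_module ideal_smult_closed(1)[OF F_module Jc(1)]] by blast
    have dw: "d n w \<in> carrier (F n)" by (rule mod_hom_apply(1)[OF F_module F_module differential w])
    have "s \<odot>\<^bsub>M\<^esub> f e = f ?v" using fa(3)[OF sc e(1)] by simp
    also have "\<dots> = f j" unfolding v using fa(2)[OF dw jc] fd[OF w] fa(1)[OF jc] by simp
    finally have "s \<odot>\<^bsub>M\<^esub> f e \<in> ideal_smult R J M"
      using mod_hom_ideal_smult[OF F_module M f Jc(1) j] by simp
    then have "f e \<in> ideal_smult R (colon J s) M"
      by (rule faithfully_flat_colon[OF ff I(3) sc fa(1)[OF e(1)]])
    moreover have "colon J s \<subseteq> \<mm>"
    proof (rule proper_ideal_subset_m[OF colon_ideal(1)[OF I(3) sc]])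
      show "\<one> \<notin> colon J s" unfolding colon_def using sJ sc by simp
    qed
    ultimately show False using e(2) ideal_smult_mono[OF M _ m_subset] by blast
  qed
  then obtain b where b: "b \<in> carrier R" "b \<otimes> s = \<one>" using invertible_outside_m sc by blast
  have "\<mm> \<subseteq> J"
  proof
    fix a assume a: "a \<in> \<mm>"
    have ac: "a \<in> carrier R" using a m_subset by auto
    have "b \<otimes> (a \<otimes> s) \<in> J" using Jc(5)[OF ms[OF a] b(1)] .
    moreover have "b \<otimes> (a \<otimes> s) = a \<otimes> (b \<otimes> s)" using ac b(1) sc by (simp add: m_lcomm)
    ultimately show "a \<in> J" using b(2) ac by simp
  qed
  then have "Idl (set xs) = \<mm>" using I(4) unfolding J_def by blast
  then show ?thesis by (rule regular_of_minimal_regular[OF xs])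
qed

end

context noetherian_local_ring
begin

lemma residue_field_facts:
  shows "module R (residue_field_module R \<mm>)"
    and "\<And>a x. a \<in> \<mm> \<Longrightarrow> x \<in> carrier (residue_field_module R \<mm>) \<Longrightarrow>
      a \<odot>\<^bsub>residue_field_module R \<mm>\<^esub> x = \<zero>\<^bsub>residue_field_module R \<mm>\<^esub>"
proof -
  note mc = ideal_closed[OF ideal_m]
  have RM: "module R (regular_module R)" by (rule regular_module_module[OF is_cring])
  have H: "submodule \<mm> R (regular_module R)"
    by (rule submodule_criterion[OF RM]) (use mc in \<open>auto simp: regular_module_def\<close>)
  show "module R (residue_field_module R \<mm>)"
    unfolding residue_field_module_def by (rule quot_module_module[OF RM H])
  note q = quot_module_facts[OF RM H]
  fix a x assume a: "a \<in> \<mm>" and "x \<in> carrier (residue_field_module R \<mm>)"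
  then obtain r where r: "r \<in> carrier (regular_module R)" "x = \<mm> +>\<^bsub>regular_module R\<^esub> r"
    unfolding residue_field_module_def q(1) by blast
  have ac: "a \<in> carrier R" using a m_subset by auto
  have "a \<odot>\<^bsub>regular_module R\<^esub> r \<in> \<mm>" using mc(6)[OF a] r(1) by (simp add: regular_module_def)
  then show "a \<odot>\<^bsub>residue_field_module R \<mm>\<^esub> x = \<zero>\<^bsub>residue_field_module R \<mm>\<^esub>"
    unfolding residue_field_module_def r(2) q(5)[OF ac r(1)]
    using quot_zero_iff[OF RM H module_closed(3)[OF RM ac r(1)]] by simp
qed

lemma residue_field_resolutionI:
  assumes "minimal_free_resolution R \<mm> (residue_field_module R \<mm>) F d \<epsilon>"
  shows "residue_field_resolution R \<mm> F d"
proof -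
  let ?k = "residue_field_module R \<mm>"
  have res: "\<And>i. free_fin_rank R (F i)" "\<And>i. d i \<in> mod_hom R (F (Suc i)) (F i)"
    "\<epsilon> \<in> mod_hom R (F 0) ?k" "exact_at (F 1) (F 0) ?k (d 0) \<epsilon>"
    "\<And>i. exact_at (F (Suc (Suc i))) (F (Suc i)) (F i) (d (Suc i)) (d i)"
    "\<And>i. d i ` carrier (F (Suc i)) \<subseteq> ideal_smult R \<mm> (F i)"
    using assms unfolding minimal_free_resolution_def by auto
  note k = residue_field_facts
  have F0: "module R (F 0)" using res(1) unfolding free_fin_rank_def by blast
  note ea = mod_hom_apply[OF F0 k(1) res(3)]
  have "ideal_smult R \<mm> (F 0) \<subseteq> {x \<in> carrier (F 0). \<epsilon> x \<in> {\<zero>\<^bsub>?k\<^esub>}}"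
  proof (rule ideal_smult_least[OF submodule_vimage[OF F0 k(1) res(3) submodule_zero[OF k(1)]]])
    fix a x assume a: "a \<in> \<mm>" and x: "x \<in> carrier (F 0)"
    have ac: "a \<in> carrier R" using a m_subset by auto
    show "a \<odot>\<^bsub>F 0\<^esub> x \<in> {x \<in> carrier (F 0). \<epsilon> x \<in> {\<zero>\<^bsub>?k\<^esub>}}"
      using ea(3)[OF ac x] k(2)[OF a ea(1)[OF x]] module_closed(3)[OF F0 ac x] by simp
  qed
  then have "ideal_smult R \<mm> (F 0) \<subseteq> d 0 ` carrier (F (Suc 0))"
    using res(4) unfolding exact_at_iff by auto
  then show ?thesis
    using res by (intro residue_field_resolution.intro residue_field_resolution_axioms.intro
      noetherian_local_ring_axioms)
qed

text \<open>The map is the augmentation for \<open>n = 0\<close> and the differential \<open>d\<^bsub>n-1\<^esub>\<close> otherwise, followed by the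
isomorphism with \<open>S\<close>; this removes the case distinction in the definition of a syzygy.\<close>

lemma syzygy_cover:
  assumes "is_syzygy R \<mm> (residue_field_module R \<mm>) n S"
  shows "\<exists>(F :: nat \<Rightarrow> ('a, nat \<Rightarrow> 'a) module) d \<phi>. residue_field_resolution R \<mm> F d \<and>
    \<phi> \<in> mod_hom R (F n) S \<and> \<phi> ` carrier (F n) = carrier S \<and>
    (\<forall>w\<in>carrier (F (Suc n)). \<phi> (d n w) = \<zero>\<^bsub>S\<^esub>)"
proof -
  let ?k = "residue_field_module R \<mm>"
  obtain F :: "nat \<Rightarrow> ('a, nat \<Rightarrow> 'a) module" and d \<epsilon>
    where S: "module R S" and res: "minimal_free_resolution R \<mm> ?k F d \<epsilon>"
      and iso: "case n of 0 \<Rightarrow> mod_isomorphic R ?k S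
         | Suc j \<Rightarrow> mod_isomorphic R ((F j)\<lparr>carrier := d j ` carrier (F (Suc j))\<rparr>) S"
    using assms unfolding is_syzygy_def by blast
  interpret residue_field_resolution R \<mm> F d by (rule residue_field_resolutionI[OF res])
  have eps: "\<epsilon> \<in> mod_hom R (F 0) ?k" "\<epsilon> ` carrier (F 0) = carrier ?k"
    "exact_at (F 1) (F 0) ?k (d 0) \<epsilon>"
    using res unfolding minimal_free_resolution_def by auto
  note k = residue_field_facts
  have "\<exists>\<phi>. \<phi> \<in> mod_hom R (F n) S \<and> \<phi> ` carrier (F n) = carrier S \<and>
    (\<forall>w\<in>carrier (F (Suc n)). \<phi> (d n w) = \<zero>\<^bsub>S\<^esub>)"
  proof (cases n)
    case 0
    obtain h where h: "h \<in> mod_hom R ?k S" "bij_betw h (carrier ?k) (carrier S)"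
      using iso 0 unfolding mod_isomorphic_def by auto
    have "h \<circ> \<epsilon> \<in> mod_hom R (F 0) S" by (rule mod_hom_comp[OF eps(1) h(1)])
    moreover have "(h \<circ> \<epsilon>) ` carrier (F 0) = carrier S"
      unfolding image_comp[symmetric] eps(2) by (rule bij_betw_imp_surj_on[OF h(2)])
    moreover have "(h \<circ> \<epsilon>) (d 0 w) = \<zero>\<^bsub>S\<^esub>" if "w \<in> carrier (F (Suc 0))" for w
    proof -
      have "\<epsilon> (d 0 w) = \<zero>\<^bsub>?k\<^esub>" using eps(3) that unfolding exact_at_iff by auto
      then show ?thesis using mod_hom_apply(4)[OF k(1) S h(1)] by simp
    qed
    ultimately show ?thesis unfolding 0 by blast
  next
    case (Suc j)
    let ?B = "(F j)\<lparr>carrier := d j ` carrier (F (Suc j))\<rparr>"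
    obtain h where h: "h \<in> mod_hom R ?B S" "bij_betw h (carrier ?B) (carrier S)"
      using iso Suc unfolding mod_isomorphic_def by auto
    have "d j \<in> mod_hom R (F (Suc j)) ?B"
      using differential[of j] unfolding mod_hom_def hom_def by auto
    then have \<phi>: "h \<circ> d j \<in> mod_hom R (F (Suc j)) S" by (rule mod_hom_comp[OF _ h(1)])
    moreover have "(h \<circ> d j) ` carrier (F (Suc j)) = carrier S"
      unfolding image_comp[symmetric] using bij_betw_imp_surj_on[OF h(2)] by simp
    moreover have "(h \<circ> d j) (d (Suc j) w) = \<zero>\<^bsub>S\<^esub>" if "w \<in> carrier (F (Suc (Suc j)))" for w
    proof -
      have "d j (d (Suc j) w) = d j \<zero>\<^bsub>F (Suc j)\<^esub>"
        using differential_squared[OF that] mod_hom_apply(4)[OF F_module F_module differential] by simp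
      then show ?thesis using mod_hom_apply(4)[OF F_module S \<phi>] by simp
    qed
    ultimately show ?thesis unfolding Suc by blast
  qed
  then show ?thesis using residue_field_resolutionI[OF res] by blast
qed

end

section \<open>Syzygies mapping onto a faithfully flat module\<close>

theorem corollary1p4:
  fixes R :: "('a, 'r) ring_scheme" and \<mm> :: "'a set"
    and I :: "'i set" and S :: "'i \<Rightarrow> ('a, 's) module"
    and M :: "('a, 'm) module" and \<pi> :: "('i \<Rightarrow> 's) \<Rightarrow> 'm"
  assumes "noetherian_local_ring R \<mm>"
    and "\<And>i. i \<in> I \<Longrightarrow> \<exists>n. is_syzygy R \<mm> (residue_field_module R \<mm>) n (S i)"
    and "faithfully_flat TYPE((nat \<Rightarrow> 'a) set) R M"
    and "\<pi> \<in> mod_hom R (direct_sum I S) M"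
    and "\<pi> ` carrier (direct_sum I S) = carrier M"
  shows "regular_local_ring R \<mm>"
proof -
  interpret noetherian_local_ring R \<mm> by fact
  have M: "module R M" using assms(3) unfolding faithfully_flat_def by blast
  have S: "module R (S i)" if "i \<in> I" for i using assms(2)[OF that] unfolding is_syzygy_def by blast
  have D: "module R (direct_sum I S)" by (rule direct_sum_module[OF is_cring S])
  let ?mM = "ideal_smult R \<mm> M"
  note mM = ideal_smult_closed[OF M m_subset]
  obtain y where y: "y \<in> carrier M" "y \<notin> ?mM"
    using faithfully_flat_proper[OF assms(3) ideal_m one_notin_m] by blast
  have "y \<in> \<pi> ` carrier (direct_sum I S)" unfolding assms(5) by (rule y(1))
  then obtain x where x: "x \<in> carrier (direct_sum I S)" "\<pi> x = y" by (elim imageE) simp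
  have "\<exists>i\<in>I. \<pi> (single I S i (x i)) \<notin> ?mM"
  proof (rule ccontr)
    assume no: "\<not> ?thesis"
    have "x \<in> {x \<in> carrier (direct_sum I S). \<pi> x \<in> ?mM}"
    proof (rule direct_sum_in_submodule[OF is_cring S submodule_vimage[OF D M assms(4) mM(1)] x(1)])
      fix i assume i: "i \<in> I"
      have "x i \<in> carrier (S i)" using x(1) i unfolding direct_sum_simps PiE_iff by blast
      then have "single I S i (x i) \<in> carrier (direct_sum I S)"
        using mod_hom_apply(1)[OF S[OF i] D single_hom[OF is_cring S i]] by blast
      then show "single I S i (x i) \<in> {x \<in> carrier (direct_sum I S). \<pi> x \<in> ?mM}" using no i by blast
    qed
    then show False using x(2) y(2) by simp
  qed
  then obtain i where i: "i \<in> I" "\<pi> (single I S i (x i)) \<notin> ?mM" by blast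
  have xi: "x i \<in> carrier (S i)" using x(1) i(1) unfolding direct_sum_simps PiE_iff by blast
  obtain n where "is_syzygy R \<mm> (residue_field_module R \<mm>) n (S i)" using assms(2)[OF i(1)] by blast
  from syzygy_cover[OF this] obtain F :: "nat \<Rightarrow> ('a, nat \<Rightarrow> 'a) module" and d \<phi>
    where res: "residue_field_resolution R \<mm> F d"
      and \<phi>: "\<phi> \<in> mod_hom R (F n) (S i)" "\<phi> ` carrier (F n) = carrier (S i)"
        "\<forall>w\<in>carrier (F (Suc n)). \<phi> (d n w) = \<zero>\<^bsub>S i\<^esub>"
    by (elim exE conjE)
  have g: "\<pi> \<circ> single I S i \<in> mod_hom R (S i) M"
    by (rule mod_hom_comp[OF single_hom[OF is_cring S i(1)] assms(4)])
  obtain e where e: "e \<in> carrier (F n)" "\<phi> e = x i"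
    using xi unfolding \<phi>(2)[symmetric] by (elim imageE) simp
  show ?thesis
  proof (rule residue_field_resolution.regular_of_hom_to_faithfully_flat[OF res assms(3)])
    show "\<pi> \<circ> single I S i \<circ> \<phi> \<in> mod_hom R (F n) M" by (rule mod_hom_comp[OF \<phi>(1) g])
    show "(\<pi> \<circ> single I S i \<circ> \<phi>) (d n w) = \<zero>\<^bsub>M\<^esub>" if "w \<in> carrier (F (Suc n))" for w
      using \<phi>(3) that mod_hom_apply(4)[OF S[OF i(1)] M g] by simp
    show "(\<pi> \<circ> single I S i \<circ> \<phi>) e \<notin> ?mM" using e(2) i(2) by simp
  qed (rule e(1))
qed

end
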